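(* Let $n,m,t \geq 1$ and let $s\ge1$ be an integer with $s \leq m/2$. Then $w(\mathbb{Z}_m^n,t,s) = w(n,t,s/m)$. Furthermore, if $s < m/2$ and $\mathcal{F}\subseteq\mathbb{Z}_m^n$ is $t$-agreeing up to $s$ and has measure $w(n,t,s/m)$, then $\mathcal{F}$ is equivalent to a $t$-intersecting family on $n$ points of $\mu_{s/m}$-measure $w(n,t,s/m)$. The same holds if $m=2$, $s=1$ and $t > 1$.
   Context: A family on $\mathbb{Z}_m^n$ is a subset of $\mathbb{Z}_m^n$, measured by the uniform probability measure $\mu_m^n$. For $s\le m/2$, $\mathcal{F}\subseteq\mathbb{Z}_m^n$ is $t$-agreeing up to $s$ if every $x,y\in\mathcal{F}$ have $t$ distinct coordinates $i_1,\dots,i_t$ with $x_{i_j}-y_{i_j}\in\{-(s-1),\dots,s-1\}$ (subtraction in $\mathbb{Z}_m$). $w(\mathbb{Z}_m^n,t,s)$ is the maximum measure of such a family. For a family on $n$ points (a set of subsets of $[n]$), $t$-intersecting means any two members share at least $t$ elements; $\mu_p(A)=p^{|A|}(1-p)^{n-|A|}$; and $w(n,t,p)$ is the maximum $\mu_p$-measure of a $t$-intersecting family on $n$ points (equal to $0$, attained only by the empty family, if $n<t$). For $y\in\mathbb{Z}_m^n$ let $\sigma_y\colon\mathbb{Z}_m^n\to 2^{[n]}$, $\sigma_y(x)=\{i\in[n] : x_i-y_i\in\{1,\dots,s\}\}$. A family $\mathcal{F}\subseteq\mathbb{Z}_m^n$ is equivalent to a family $\mathcal{G}$ on $n$ points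 if $\mathcal{F}=\sigma_y^{-1}(\mathcal{G})$ for some $y\in\mathbb{Z}_m^n$. *)

theory Defs
  imports "HOL-Analysis.Analysis" "HOL-Number_Theory.Cong"
begin

(* Z_m is represented by {0..<m} in int, and its arithmetic by congruences mod m; the coordinate
   set [n] is {1..n}. Points are extensional functions, so that equal points are equal terms. *)
definition zmod_pow :: "nat \<Rightarrow> nat \<Rightarrow> (nat \<Rightarrow> int) set" where
  "zmod_pow m n = {1..n} \<rightarrow>\<^sub>E {0..<int m}"

definition mu_zmod :: "nat \<Rightarrow> nat \<Rightarrow> (nat \<Rightarrow> int) set \<Rightarrow> real" where
  "mu_zmod m n \<F> = measure (uniform_count_measure (zmod_pow m n)) \<F>"

(* x and y are allowed to coincide, so for n < t only the empty family is t-agreeing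
   (and likewise only the empty family is t-intersecting). *)
definition agreeing :: "nat \<Rightarrow> nat \<Rightarrow> nat \<Rightarrow> nat \<Rightarrow> (nat \<Rightarrow> int) set \<Rightarrow> bool" where
  "agreeing m n t s \<F> \<longleftrightarrow> \<F> \<subseteq> zmod_pow m n \<and>
     (\<forall>x\<in>\<F>. \<forall>y\<in>\<F>. \<exists>I\<subseteq>{1..n}. card I = t \<and>
        (\<forall>i\<in>I. \<exists>d\<in>{-(int s - 1)..int s - 1}. [x i - y i = d] (mod int m)))"

definition w_zmod :: "nat \<Rightarrow> nat \<Rightarrow> nat \<Rightarrow> nat \<Rightarrow> real" where
  "w_zmod m n t s = Max {mu_zmod m n \<F> | \<F>. agreeing m n t s \<F>}"

definition intersecting :: "nat \<Rightarrow> nat \<Rightarrow> nat set set \<Rightarrow> bool" where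
  "intersecting n t \<G> \<longleftrightarrow> \<G> \<subseteq> Pow {1..n} \<and> (\<forall>A\<in>\<G>. \<forall>B\<in>\<G>. t \<le> card (A \<inter> B))"

definition mu_p :: "nat \<Rightarrow> real \<Rightarrow> nat set set \<Rightarrow> real" where
  "mu_p n p \<G> = (\<Sum>A\<in>\<G>. p ^ card A * (1 - p) ^ (n - card A))"

definition w_p :: "nat \<Rightarrow> nat \<Rightarrow> real \<Rightarrow> real" where
  "w_p n t p = Max {mu_p n p \<G> | \<G>. intersecting n t \<G>}"

definition sigma :: "nat \<Rightarrow> nat \<Rightarrow> nat \<Rightarrow> (nat \<Rightarrow> int) \<Rightarrow> (nat \<Rightarrow> int) \<Rightarrow> nat set" where
  "sigma m n s y x = {i\<in>{1..n}. \<exists>d\<in>{1..int s}. [x i - y i = d] (mod int m)}"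

definition equivalent_family ::
  "nat \<Rightarrow> nat \<Rightarrow> nat \<Rightarrow> (nat \<Rightarrow> int) set \<Rightarrow> nat set set \<Rightarrow> bool" where
  "equivalent_family m n s \<F> \<G> \<longleftrightarrow>
     (\<exists>y\<in>zmod_pow m n. \<F> = sigma m n s y -` \<G> \<inter> zmod_pow m n)"

(* The sets in the two definitions of w are finite and nonempty, so the maxima are attained. *)
lemma w_zmod_set:
  "finite {mu_zmod m n \<F> | \<F>. agreeing m n t s \<F>}"
  "{mu_zmod m n \<F> | \<F>. agreeing m n t s \<F>} \<noteq> {}"
proof -
  have "{mu_zmod m n \<F> | \<F>. agreeing m n t s \<F>} \<subseteq> mu_zmod m n ` Pow (zmod_pow m n)"
    by (auto simp: agreeing_def)
  moreover have "finite (zmod_pow m n)"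
    by (auto simp: zmod_pow_def intro!: finite_PiE)
  ultimately show "finite {mu_zmod m n \<F> | \<F>. agreeing m n t s \<F>}"
    by (meson finite_Pow_iff finite_imageI finite_subset)
  have "agreeing m n t s {}"
    by (simp add: agreeing_def)
  then show "{mu_zmod m n \<F> | \<F>. agreeing m n t s \<F>} \<noteq> {}"
    by blast
qed

lemma w_p_set:
  "finite {mu_p n p \<G> | \<G>. intersecting n t \<G>}"
  "{mu_p n p \<G> | \<G>. intersecting n t \<G>} \<noteq> {}"
proof -
  have "{mu_p n p \<G> | \<G>. intersecting n t \<G>} \<subseteq> mu_p n p ` Pow (Pow {1..n})"
    by (auto simp: intersecting_def)
  then show "finite {mu_p n p \<G> | \<G>. intersecting n t \<G>}"
    by (meson finite_Pow_iff finite_imageI finite_subset finite_atLeastAtMost)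
  have "intersecting n t {}"
    by (simp add: intersecting_def)
  then show "{mu_p n p \<G> | \<G>. intersecting n t \<G>} \<noteq> {}"
    by blast
qed

end

theory Submission
  imports Defs
begin

text \<open>Put \<open>p = s / m \<le> 1/2\<close>. The coordinates are converted one at a time: at a converted coordinate two
points agree when both values lie in the window \<open>{1..s}\<close>, at the others when their circular distance
is below \<open>s\<close>. Let \<open>S\<close> be the set of values that a line in direction \<open>i\<close> has in \<open>F\<close>. For \<open>c < s\<close> the
\<open>c\<close>-th conversion of \<open>F\<close> keeps the window of the line if \<open>s - c \<le> |S|\<close> and its remaining values if
\<open>s + c + 1 \<le> |S|\<close>. Nonempty sets of residues that agree elementwise have total size at most \<open>2s\<close>, so
every conversion satisfies the agreement condition again, and the \<open>s\<close> conversions together have at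
least \<open>s|F|\<close> points. When all coordinates are converted, the family is contained in the pullback of a
\<open>t\<close>-intersecting family.

In the case of equality every line has \<open>0\<close>, \<open>s\<close> or \<open>m\<close> points, and by induction the \<open>0\<close>-th conversion is
the pullback of an optimal \<open>t\<close>-intersecting family. By the uniqueness part of the biased
Ahlswede--Khachatrian theorem (shifting, then pushing-pulling) the latter is
\<open>{A. t + r \<le> |A \<inter> T|}\<close> with \<open>|T| = t + 2r\<close>. The lines with \<open>s\<close> points are those with exactly \<open>r\<close> misses on
\<open>T - {i}\<close>. Two of them with fewer than \<open>t\<close> agreements must have the same \<open>S\<close>, a cyclic interval, and a
Kneser-type connectivity argument shows that all of them share it; it is the window of coordinate \<open>i\<close>.\<close>

section \<open>A Kneser-type connectivity argument\<close>

text \<open>Two reversals lose information: undoing a shift, where each merged pair of sets leaves a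
  choice, and undoing a conversion, where each line with \<open>s\<close> points leaves a choice of
  its \<open>s\<close> residues. In both, the choice matters only at configurations that are one hit
  short of the threshold, and two of these with fewer than \<open>t\<close> agreements elsewhere
  force each other's choice. The connectivity argument is therefore stated for abstract coordinates
  and applied twice, to Boolean values and to residues. The excluded cases show up at precise
  points. For \<open>m = 2 * s > 2\<close>, two sets of \<open>s\<close> residues that agree
  elementwise need not be windows; at \<open>p = 1/2\<close> and \<open>t = 1\<close>, optimal
  families need not be threshold families. For \<open>m = 2\<close> disagreement in one coordinate
  is a single edge, and two coordinates outside \<open>T\<close> would already give a disconnected
  graph; hence the care to show that at \<open>p = 1/2\<close> at most one point lies outside
  \<open>T\<close>.\<close>

text \<open>The relation \<open>dis\<close> is disagreement. The last assumption says that the coordinates outside \<open>T\<close> form a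
connected graph under simultaneous disagreement: every function respecting its edges is constant.\<close>

locale kneser =
  fixes I T :: "'i set" and V :: "'i \<Rightarrow> 'v set" and win :: "'i \<Rightarrow> 'v \<Rightarrow> bool"
    and dis :: "'i \<Rightarrow> 'v \<Rightarrow> 'v \<Rightarrow> bool" and t r :: nat and f :: "('i \<Rightarrow> 'v) \<Rightarrow> 'b"
  assumes fin: "finite I" and TI: "T \<subseteq> I" and cT: "card T + 1 = t + 2 * r" and tr: "2 \<le> t \<or> r = 0"
    and flip: "\<And>i v. i \<in> I \<Longrightarrow> v \<in> V i \<Longrightarrow> \<exists>u\<in>V i. dis i v u \<and> win i u = (\<not> win i v)"
    and conflict: "\<And>x y. x \<in> PiE I V \<Longrightarrow> y \<in> PiE I V \<Longrightarrow> card {i\<in>T. \<not> win i (x i)} = r \<Longrightarrow>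
      card {i\<in>T. \<not> win i (y i)} = r \<Longrightarrow> card {i\<in>I. \<not> dis i (x i) (y i)} < t \<Longrightarrow> f x = f y"
    and outside: "\<And>(g :: _ \<Rightarrow> 'b) u v. (\<And>u v. u \<in> PiE (I - T) V \<Longrightarrow> v \<in> PiE (I - T) V \<Longrightarrow>
        (\<And>i. i \<in> I - T \<Longrightarrow> dis i (u i) (v i)) \<Longrightarrow> g u = g v) \<Longrightarrow>
      u \<in> PiE (I - T) V \<Longrightarrow> v \<in> PiE (I - T) V \<Longrightarrow> g u = g v"
begin

definition miss :: "('i \<Rightarrow> 'v) \<Rightarrow> 'i set" where "miss x = {i\<in>T. \<not> win i (x i)}"

text \<open>In both applications \<open>T\<close> is the set of the extremal family without its
  pivotal coordinate. Then \<open>r\<close> misses mean \<open>t + r - 1\<close> hits, one short of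
  the threshold, and the coordinate taken away decides membership.\<close>

definition pts :: "('i \<Rightarrow> 'v) set" where "pts = {x \<in> PiE I V. card (miss x) = r}"

lemma finT: "finite T" using fin TI finite_subset by blast

lemma miss_T: "miss x \<subseteq> T" "finite (miss x)" using finT by (auto simp: miss_def)

lemma f_conflict: "x \<in> pts \<Longrightarrow> y \<in> pts \<Longrightarrow> card {i\<in>I. \<not> dis i (x i) (y i)} < t \<Longrightarrow> f x = f y"
  using conflict by (auto simp: pts_def miss_def)

text \<open>Disjoint sets of misses use up \<open>2 * r\<close> of the \<open>t + 2 * r - 1\<close>
  coordinates of \<open>T\<close>, which leaves \<open>t - 1\<close> for agreements.\<close>

lemma few_agreements:
  assumes "x \<in> pts" "y \<in> pts" "miss x \<inter> miss y = {}"
    and d: "\<And>i. i \<in> miss x \<union> miss y \<union> (I - T) \<Longrightarrow> dis i (x i) (y i)"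
  shows "card {i\<in>I. \<not> dis i (x i) (y i)} < t"
proof -
  have "{i\<in>I. \<not> dis i (x i) (y i)} \<subseteq> T - (miss x \<union> miss y)" using d by blast
  hence "card {i\<in>I. \<not> dis i (x i) (y i)} \<le> card (T - (miss x \<union> miss y))"
    by (rule card_mono[rotated]) (use finT in auto)
  also have "\<dots> = card T - card (miss x \<union> miss y)"
    using miss_T by (intro card_Diff_subset) auto
  also have "card (miss x \<union> miss y) = r + r"
    using assms miss_T by (subst card_Un_disjoint) (auto simp: pts_def)
  finally show "card {i\<in>I. \<not> dis i (x i) (y i)} < t" using cT miss_T
    using tr by linarith
qed

lemma f_conflict_miss:
  assumes "x \<in> pts" "y \<in> pts" "miss x \<inter> miss y = {}"
    and "\<And>i. i \<in> miss x \<union> miss y \<union> (I - T) \<Longrightarrow> dis i (x i) (y i)"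
  shows "f x = f y"
  by (rule f_conflict[OF assms(1,2) few_agreements[OF assms]])

text \<open>The two points have a common neighbour that misses exactly \<open>N\<close>.\<close>

lemma common:
  assumes x: "x \<in> pts" and x': "x' \<in> pts" and N: "N \<subseteq> T" "card N = r" "N \<inter> (miss x \<union> miss x') = {}"
    and eq: "\<And>i. i \<in> I - T \<union> N \<union> (miss x \<inter> miss x') \<Longrightarrow> x i = x' i"
  shows "f x = f x'"
proof -
  obtain op where op: "\<And>i v. i \<in> I \<Longrightarrow> v \<in> V i \<Longrightarrow> op i v \<in> V i \<and> dis i v (op i v) \<and> win i (op i v) = (\<not> win i v)"
    using flip by metis
  \<comment> \<open>\<open>v\<close> is the value that \<open>y\<close> opposes. Where exactly one
    of the two points misses, only that point has to disagree with \<open>y\<close>; at the other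
    changed coordinates both have the same value by \<open>eq\<close>.\<close>
  define v where "v = (\<lambda>i. if i \<in> miss x' then x' i else x i)"
  define y where "y = (\<lambda>i. if i \<in> miss x \<union> miss x' \<union> N \<union> (I - T) then op i (v i) else x i)"
  have vV: "v i \<in> V i" if "i \<in> I" for i using that x x' by (auto simp: v_def pts_def)
  have sub: "miss x \<union> miss x' \<union> N \<union> (I - T) \<subseteq> I" using TI miss_T N by blast
  have yP: "y \<in> PiE I V"
  proof (rule PiE_I)
    fix i assume "i \<in> I" thus "y i \<in> V i" using op[of i "v i"] vV[of i] x by (auto simp: y_def pts_def)
  next
    fix i assume "i \<notin> I"
    hence "i \<notin> miss x \<union> miss x' \<union> N \<union> (I - T)" using sub by blast
    thus "y i = undefined" using x \<open>i \<notin> I\<close> by (auto simp: y_def pts_def PiE_def extensional_def)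
  qed
  have my: "miss y = N"
  proof -
    have "(\<not> win i (y i)) = (i \<in> N)" if iT: "i \<in> T" for i
    proof -
      have iI: "i \<in> I" using iT TI by blast
      have o: "win i (op i (v i)) = (\<not> win i (v i))" using op[OF iI vV[OF iI]] by blast
      consider "i \<in> N" | "i \<notin> N" "i \<in> miss x'" | "i \<notin> N" "i \<in> miss x" "i \<notin> miss x'"
        | "i \<notin> N" "i \<notin> miss x" "i \<notin> miss x'" by blast
      thus ?thesis
        using o N(3) iT by cases (auto simp: y_def v_def miss_def)
    qed
    thus ?thesis using N(1) by (auto simp: miss_def)
  qed
  have yp: "y \<in> pts" using yP my N by (auto simp: pts_def)
  have dv: "dis i (v i) (y i)" if "i \<in> miss x \<union> miss x' \<union> N \<union> (I - T)" for i
    using op[of i "v i"] vV[of i] that sub by (auto simp: y_def)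
  have vx: "v i = x i" if "i \<in> miss x \<union> N \<union> (I - T)" for i
    using eq[of i] that by (auto simp: v_def)
  have vx': "v i = x' i" if "i \<in> miss x' \<union> N \<union> (I - T)" for i
    using eq[of i] that by (auto simp: v_def)
  have "f x = f y"
  proof (rule f_conflict_miss[OF x yp])
    show "miss x \<inter> miss y = {}" using my N(3) by blast
    fix i assume i: "i \<in> miss x \<union> miss y \<union> (I - T)"
    have "dis i (v i) (y i)" by (rule dv) (use i my in blast)
    moreover have "v i = x i" by (rule vx) (use i my in blast)
    ultimately show "dis i (x i) (y i)" by simp
  qed
  moreover have "f x' = f y"
  proof (rule f_conflict_miss[OF x' yp])
    show "miss x' \<inter> miss y = {}" using my N(3) by blast
    fix i assume i: "i \<in> miss x' \<union> miss y \<union> (I - T)"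
    have "dis i (v i) (y i)" by (rule dv) (use i my in blast)
    moreover have "v i = x' i" by (rule vx') (use i my in blast)
    ultimately show "dis i (x' i) (y i)" by simp
  qed
  ultimately show ?thesis by simp
qed

text \<open>At least \<open>t + r - 2\<close> coordinates of \<open>T\<close> remain, and this is at
  least \<open>r\<close> because \<open>r > 0\<close> forces \<open>2 \<le> t\<close>.\<close>

lemma obtain_N:
  assumes "x \<in> pts" "b \<in> T" "r > 0"
  obtains N where "N \<subseteq> T" "card N = r" "N \<inter> (miss x \<union> {b}) = {}"
proof -
  have "card (miss x \<union> {b}) \<le> r + 1"
    using assms miss_T(2)[of x] by (auto simp: pts_def card_insert_if)
  moreover have "card (T - (miss x \<union> {b})) = card T - card (miss x \<union> {b})"
    using finT miss_T(1)[of x] assms(2) by (intro card_Diff_subset) (auto intro: finite_subset)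
  ultimately have "card (T - (miss x \<union> {b})) \<ge> card T - (r + 1)" by linarith
  hence "card (T - (miss x \<union> {b})) \<ge> r" using cT tr assms by linarith
  then obtain N where "N \<subseteq> T - (miss x \<union> {b})" "card N = r" by (meson obtain_subset_with_card_n)
  thus ?thesis using that[of N] by blast
qed

lemma upd_PiE: "x \<in> PiE I V \<Longrightarrow> i \<in> I \<Longrightarrow> v \<in> V i \<Longrightarrow> x(i := v) \<in> PiE I V"
  by (auto simp: PiE_def extensional_def)

text \<open>Two sets of \<open>r\<close> misses that differ in one element occupy only
  \<open>r + 1\<close> coordinates, so some third set of \<open>r\<close> misses avoids both: a
  common neighbour in the Kneser graph.\<close>

lemma exchange:
  assumes x: "x \<in> pts" and a: "a \<in> miss x" and b: "b \<in> T - miss x"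
    and u: "u \<in> V a" "win a u" and w: "w \<in> V b" "\<not> win b w"
  shows "x(a := u, b := w) \<in> pts" "f (x(a := u, b := w)) = f x"
    "miss (x(a := u, b := w)) = insert b (miss x - {a})"
proof -
  let ?y = "x(a := u, b := w)"
  show m: "miss ?y = insert b (miss x - {a})" using a b u w by (auto simp: miss_def)
  have "card (insert b (miss x - {a})) = card (miss x)"
    using a b miss_T(2)[of x] card_Suc_Diff1[of "miss x" a] by simp
  thus y: "?y \<in> pts" using x m a b u w TI by (auto simp: pts_def miss_def intro!: upd_PiE)
  have "r > 0" using a x miss_T(2)[of x] by (auto simp: pts_def card_gt_0_iff)
  then obtain N where N: "N \<subseteq> T" "card N = r" "N \<inter> (miss x \<union> {b}) = {}"
    using obtain_N x b by blast
  have "f x = f ?y"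
    by (rule common[OF x y N(1,2)]) (use N(3) m b a TI miss_T in auto)
  thus "f ?y = f x" by simp
qed

lemma T_indep:
  assumes "x \<in> pts" "x' \<in> pts" "\<And>i. i \<in> I - T \<Longrightarrow> x i = x' i"
  shows "f x = f x'"
proof (cases "r = 0")
  case True
  moreover have "card (miss x) = r" "card (miss x') = r" using assms by (auto simp: pts_def)
  ultimately have "miss x = {}" "miss x' = {}" using miss_T(2) by (metis card_0_eq)+
  thus ?thesis using assms(3) by (intro common[OF assms(1,2), of "{}"]) (auto simp: True)
next
  case r: False
  hence t2: "t \<ge> 2" using tr by blast
  show ?thesis using assms
  proof (induction "card {i\<in>T. x i \<noteq> x' i}" arbitrary: x rule: less_induct)
    case less
    have dec: "f y = f x'" if y: "y \<in> pts" "\<And>i. i \<in> I - T \<Longrightarrow> y i = x i"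
      "\<And>i. i \<in> T \<Longrightarrow> x i = x' i \<Longrightarrow> y i = x' i" "a \<in> T" "x a \<noteq> x' a" "y a = x' a" for y a
    proof -
      have "{i\<in>T. y i \<noteq> x' i} \<subset> {i\<in>T. x i \<noteq> x' i}" using y(3-6) by blast
      hence "card {i\<in>T. y i \<noteq> x' i} < card {i\<in>T. x i \<noteq> x' i}"
        using finT by (intro psubset_card_mono) auto
      moreover have "y i = x' i" if "i \<in> I - T" for i using y(2)[OF that] less.prems(3)[OF that] by simp
      ultimately show ?thesis using less.hyps[of y] y(1) less.prems(2) by blast
    qed
    have xV: "x i \<in> V i" "x' i \<in> V i" if "i \<in> T" for i using less.prems that TI by (auto simp: pts_def)
    consider (eq) "\<forall>i\<in>T. x i = x' i"
      | (win) i where "i \<in> T" "x i \<noteq> x' i" "win i (x i)" "win i (x' i)"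
      | (mis) a where "a \<in> miss x" "win a (x' a)"
      | (oth) "miss x \<subseteq> miss x'" "\<not> (\<forall>i\<in>T. x i = x' i)" "\<forall>i\<in>T. x i \<noteq> x' i \<longrightarrow> \<not> (win i (x i) \<and> win i (x' i))"
      by (auto simp: miss_def)
    thus ?case
    proof cases
      case eq
      hence "x i = x' i" for i
        using less.prems TI by (cases "i \<in> I") (auto simp: pts_def PiE_def extensional_def)
      hence "x = x'" by blast
      thus ?thesis by simp
    next
      case (win i)
      let ?y = "x(i := x' i)"
      have m: "miss ?y = miss x" using win by (auto simp: miss_def)
      have y: "?y \<in> pts" using less.prems m win xV TI by (auto simp: pts_def intro!: upd_PiE)
      obtain N where N: "N \<subseteq> T" "card N = r" "N \<inter> (miss x \<union> {i}) = {}"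
        using obtain_N less.prems(1) win(1) r by blast
      have "f x = f ?y"
        by (rule common[OF less.prems(1) y N(1,2)]) (use N(3) m win TI miss_T in \<open>auto simp: miss_def\<close>)
      also have "f ?y = f x'" by (rule dec[OF y, of i]) (use win TI in auto)
      finally show ?thesis .
    next
      case (mis a)
      have "card (miss x) = card (miss x')" using less.prems by (auto simp: pts_def)
      moreover have "miss x \<noteq> miss x'" using mis by (auto simp: miss_def)
      ultimately have "\<not> miss x' \<subseteq> miss x" using card_subset_eq[OF miss_T(2)[of x]] by metis
      then obtain b where b: "b \<in> miss x'" "b \<notin> miss x" by blast
      have ab: "a \<in> T" "b \<in> T" using mis b by (auto simp: miss_def)
      have bb: "b \<in> T - miss x" and wb: "\<not> win b (x' b)" using b by (auto simp: miss_def)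
      note y = exchange(1,2)[OF less.prems(1) mis(1) bb xV(2)[OF ab(1)] mis(2) xV(2)[OF ab(2)] wb]
      have "f (x(a := x' a, b := x' b)) = f x'"
      proof (rule dec[OF y(1), of a])
        show "x a \<noteq> x' a" using mis by (auto simp: miss_def)
      qed (use ab in auto)
      thus ?thesis using y by simp
    next
      \<comment> \<open>Both points miss at the same places, but with different values at
        \<open>i\<close>. The miss is moved from \<open>i\<close> to a hit \<open>b\<close>, then
        back to \<open>i\<close> with the value \<open>x' i\<close>.\<close>
      case oth
      have mm: "miss x = miss x'"
        using oth(1) less.prems by (intro card_subset_eq) (auto simp: pts_def miss_T)
      obtain i where i: "i \<in> T" "x i \<noteq> x' i" using oth by blast
      hence im: "i \<in> miss x" "i \<in> miss x'" using oth mm by (auto simp: miss_def)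
      have "card (miss x) < card T" using cT t2 less.prems by (auto simp: pts_def)
      hence "miss x \<noteq> T" by auto
      then obtain b where b: "b \<in> T - miss x" using miss_T by blast
      obtain u where u: "u \<in> V i" "win i u" using flip[of i "x i"] i TI xV im by (auto simp: miss_def)
      obtain w where w: "w \<in> V b" "\<not> win b w" using flip[of b "x b"] b TI xV by (auto simp: miss_def)
      let ?y = "x(i := u, b := w)"
      note y = exchange[OF less.prems(1) im(1) b u w]
      let ?z = "?y(b := x b, i := x' i)"
      have ib: "i \<noteq> b" using b im by blast
      have z: "?z = x(i := x' i)" using ib by auto
      have e: "b \<in> miss ?y" "i \<in> T - miss ?y" "win b (x b)" "\<not> win i (x' i)" "b \<in> T"
        using y(3) i b im ib by (auto simp: miss_def)
      have "?z \<in> pts" "f ?z = f ?y"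
        using exchange(1,2)[OF y(1) e(1,2) xV(1)[OF e(5)] e(3) xV(2)[OF i(1)] e(4)] by blast+
      hence "x(i := x' i) \<in> pts" "f (x(i := x' i)) = f x" using y z by auto
      moreover have "f (x(i := x' i)) = f x'" by (rule dec[OF calculation(1), of i]) (use i in auto)
      ultimately show ?thesis by simp
    qed
  qed
qed

text \<open>\<open>x\<close> hits at \<open>t + r - 1 \<ge> r\<close> coordinates of
  \<open>T\<close>, which leaves room for a fresh set of misses. The bound on agreements stays in
  the conclusion because an actual conflicting pair is needed later to recognize the common fibre as
  a window.\<close>

lemma partner:
  assumes x: "x \<in> pts" and v: "v \<in> PiE (I - T) V" and d: "\<And>i. i \<in> I - T \<Longrightarrow> dis i (x i) (v i)"
  shows "\<exists>y\<in>pts. (\<forall>i\<in>I-T. y i = v i) \<and> card {i\<in>I. \<not> dis i (x i) (y i)} < t"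
proof -
  obtain op where op: "\<And>i v. i \<in> I \<Longrightarrow> v \<in> V i \<Longrightarrow> op i v \<in> V i \<and> dis i v (op i v) \<and> win i (op i v) = (\<not> win i v)"
    using flip by metis
  have "card (T - miss x) = card T - r" using x miss_T by (simp add: card_Diff_subset pts_def)
  hence "card (T - miss x) \<ge> r" using cT tr by linarith
  then obtain N where N: "N \<subseteq> T - miss x" "card N = r" by (meson obtain_subset_with_card_n)
  define y where "y = (\<lambda>i. if i \<in> miss x \<union> N then op i (x i) else if i \<in> I - T then v i else x i)"
  have sub: "miss x \<union> N \<subseteq> T" using N miss_T by blast
  have xV: "x i \<in> V i" if "i \<in> I" for i using that x by (auto simp: pts_def)
  have yP: "y \<in> PiE I V"
  proof (rule PiE_I)
    fix i assume "i \<in> I" thus "y i \<in> V i" using op[of i "x i"] xV[of i] v by (auto simp: y_def)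
  next
    fix i assume "i \<notin> I" thus "y i = undefined" using x sub TI by (auto simp: y_def pts_def PiE_def extensional_def)
  qed
  have my: "miss y = N"
  proof -
    have "(\<not> win i (y i)) = (i \<in> N)" if iT: "i \<in> T" for i
    proof -
      have iI: "i \<in> I" using iT TI by blast
      have o: "win i (op i (x i)) = (\<not> win i (x i))" using op[OF iI xV[OF iI]] by blast
      show ?thesis using o N(1) iT by (auto simp: y_def miss_def)
    qed
    thus ?thesis using N(1) by (auto simp: miss_def)
  qed
  have yp: "y \<in> pts" using yP my N by (auto simp: pts_def)
  have "card {i\<in>I. \<not> dis i (x i) (y i)} < t"
  proof (rule few_agreements[OF x yp])
    show "miss x \<inter> miss y = {}" using my N by auto
    fix i assume "i \<in> miss x \<union> miss y \<union> (I - T)"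
    thus "dis i (x i) (y i)" using d op[of i "x i"] xV[of i] sub TI my by (auto simp: y_def)
  qed
  moreover have "\<forall>i\<in>I-T. y i = v i" using sub by (auto simp: y_def)
  ultimately show ?thesis using yp by blast
qed

lemma step:
  assumes "x \<in> pts" "v \<in> PiE (I - T) V" "\<And>i. i \<in> I - T \<Longrightarrow> dis i (x i) (v i)"
  shows "\<exists>y\<in>pts. (\<forall>i\<in>I-T. y i = v i) \<and> f y = f x"
  using partner[OF assms] f_conflict[OF assms(1)] by metis

text \<open>By \<open>T_indep\<close> the value depends only on the part outside \<open>T\<close>;
  \<open>c\<close> completes such a part by the values of \<open>x\<close>, and \<open>step\<close>
  extends a disagreement outside \<open>T\<close> to a conflict of whole points.\<close>

theorem f_constant:
  assumes x: "x \<in> pts" and x': "x' \<in> pts"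
  shows "f x = f x'"
proof -
  define c where "c = (\<lambda>u i. if i \<in> T then x i else u i)"
  have cp: "c u \<in> pts" if "u \<in> PiE (I - T) V" for u
  proof -
    have "miss (c u) = miss x" by (auto simp: miss_def c_def)
    thus ?thesis using x that TI by (auto simp: pts_def c_def PiE_def extensional_def)
  qed
  have "f (c u) = f (c v)" if u: "u \<in> PiE (I - T) V" and v: "v \<in> PiE (I - T) V"
    and d: "\<And>i. i \<in> I - T \<Longrightarrow> dis i (u i) (v i)" for u v
  proof -
    obtain y where y: "y \<in> pts" "\<forall>i\<in>I-T. y i = v i" "f y = f (c u)"
      using step[OF cp[OF u] v] d by (auto simp: c_def)
    have "f y = f (c v)" by (rule T_indep[OF y(1) cp[OF v]]) (use y in \<open>auto simp: c_def\<close>)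
    thus ?thesis using y by simp
  qed
  note * = outside[of "\<lambda>u. f (c u)", OF this]
  have r: "restrict z (I - T) \<in> PiE (I - T) V" if "z \<in> pts" for z using that by (auto simp: pts_def)
  have rr: "f (c (restrict z (I - T))) = f z" if "z \<in> pts" for z
    by (rule T_indep[OF cp[OF r[OF that]] that]) (auto simp: c_def)
  show ?thesis using * r rr x x' by metis
qed

end

section \<open>Shifting\<close>

definition thr :: "nat \<Rightarrow> nat set \<Rightarrow> nat \<Rightarrow> nat set set" where
  "thr n T h = {A. A \<subseteq> {1..n} \<and> h \<le> card (A \<inter> T)}"

lemma card_Int_ge:
  fixes A B T :: "'a set"
  assumes "finite T"
  shows "card (A \<inter> T) + card (B \<inter> T) \<le> card T + card (A \<inter> B \<inter> T)"
proof -
  have "card (A \<inter> T) + card (B \<inter> T) = card ((A \<inter> T) \<union> (B \<inter> T)) + card ((A \<inter> T) \<inter> (B \<inter> T))"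
    using assms by (intro card_Un_Int) auto
  moreover have "card ((A \<inter> T) \<union> (B \<inter> T)) \<le> card T" using assms by (intro card_mono) auto
  moreover have "(A \<inter> T) \<inter> (B \<inter> T) = A \<inter> B \<inter> T" by blast
  ultimately show ?thesis by simp
qed

lemma thr_intersecting:
  assumes "T \<subseteq> {1..n}" "card T + t \<le> 2 * h"
  shows "intersecting n t (thr n T h)"
  unfolding intersecting_def
proof (intro conjI ballI)
  show "thr n T h \<subseteq> Pow {1..n}" by (auto simp: thr_def)
  fix A B assume "A \<in> thr n T h" "B \<in> thr n T h"
  hence "2 * h \<le> card (A \<inter> T) + card (B \<inter> T)" "A \<subseteq> {1..n}" by (auto simp: thr_def)
  moreover have "finite T" using assms finite_subset by blast
  ultimately have "t \<le> card (A \<inter> B \<inter> T)" using card_Int_ge[of T A B] assms by linarith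
  also have "\<dots> \<le> card (A \<inter> B)" using \<open>A \<subseteq> {1..n}\<close> by (intro card_mono) (auto intro: finite_subset)
  finally show "t \<le> card (A \<inter> B)" .
qed

definition sw :: "nat \<Rightarrow> nat \<Rightarrow> nat set \<Rightarrow> nat set" where
  "sw j k A = Transposition.transpose j k ` A"

lemma in_sw: "x \<in> sw j k A \<longleftrightarrow> Transposition.transpose j k x \<in> A"
  unfolding sw_def by (metis image_iff transpose_involutory)

lemma sw_sw [simp]: "sw j k (sw j k A) = A"
  by (auto simp: in_sw)

lemma card_sw [simp]: "card (sw j k A) = card A"
  unfolding sw_def by (intro card_image inj_on_subset[OF inj_transpose]) auto

lemma sw_Int: "sw j k (A \<inter> B) = sw j k A \<inter> sw j k B"
  by (auto simp: in_sw)

lemma sw_eq_self: "(j \<in> A) = (k \<in> A) \<Longrightarrow> sw j k A = A"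
  by (auto simp: in_sw Transposition.transpose_def split: if_splits)

lemma sw_subset: "j \<in> {1..n} \<Longrightarrow> k \<in> {1..n} \<Longrightarrow> sw j k A \<subseteq> {1..n} \<longleftrightarrow> A \<subseteq> {1..n}"
  by (auto simp: in_sw subset_iff Transposition.transpose_def split: if_splits)

lemma sw_insert: "j \<in> A \<Longrightarrow> k \<notin> A \<Longrightarrow> sw j k A = insert k (A - {j})"
  by (auto simp: in_sw Transposition.transpose_def split: if_splits)

lemma sw_commute: "sw j k A = sw k j A"
  by (simp add: sw_def transpose_commute)

text \<open>The usual compression, as a membership condition on the pairs \<open>A\<close>,
  \<open>sw j k A\<close> in place of an image of \<open>G\<close>. A set with both or neither of
  \<open>j\<close>, \<open>k\<close> is fixed by the swap, so for it the condition is plain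
  membership.\<close>

definition shift :: "nat \<Rightarrow> nat \<Rightarrow> nat set set \<Rightarrow> nat set set" where
  "shift j k G = {A. if j \<in> A then A \<in> G \<or> sw j k A \<in> G else A \<in> G \<and> sw j k A \<in> G}"

lemma shift_subset:
  assumes "G \<subseteq> Pow {1..n}" "j \<in> {1..n}" "k \<in> {1..n}" shows "shift j k G \<subseteq> Pow {1..n}"
proof
  fix A assume "A \<in> shift j k G"
  hence "A \<in> G \<or> sw j k A \<in> G" by (auto simp: shift_def split: if_splits)
  thus "A \<in> Pow {1..n}" using assms sw_subset[of j n k A] by blast
qed

lemma shift_intersecting:
  assumes G: "intersecting n t G" and jk: "j \<in> {1..n}" "k \<in> {1..n}"
  shows "intersecting n t (shift j k G)"
proof -
  have G': "G \<subseteq> Pow {1..n}" using G by (auto simp: intersecting_def)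
  have gg: "t \<le> card (A \<inter> B)" if "A \<in> G" "B \<in> G" for A B using G that by (auto simp: intersecting_def)
  have ss: "t \<le> card (A \<inter> B)" if "sw j k A \<in> G" "sw j k B \<in> G" for A B
    using gg[OF that] by (simp flip: sw_Int)
  \<comment> \<open>The mixed case. If \<open>k\<close> is not in \<open>B\<close>, the swap trades
    \<open>j\<close> for \<open>k\<close>; as \<open>j\<close> lies in both sets, its loss makes up
    for the possible gain of \<open>k\<close>.\<close>
  have gs: "t \<le> card (A \<inter> B)" if "A \<in> G" "sw j k B \<in> G" "j \<in> A" "j \<in> B" for A B
  proof (cases "k \<in> B")
    case True
    thus ?thesis using that gg sw_eq_self by metis
  next
    case False
    hence e: "sw j k B = insert k (B - {j})" using that sw_insert by simp
    have fA: "finite A" using that G' by (meson Pow_iff finite_atLeastAtMost finite_subset subsetD)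
    have "t \<le> card (A \<inter> sw j k B)" using that gg by blast
    also have "\<dots> \<le> card (insert k (A \<inter> B - {j}))" using fA e by (intro card_mono) auto
    also have "\<dots> \<le> Suc (card (A \<inter> B - {j}))" using fA by (simp add: card_insert_if)
    also have "\<dots> = card (A \<inter> B)" using fA that by (intro card_Suc_Diff1) auto
    finally show ?thesis .
  qed
  have "t \<le> card (A \<inter> B)" if "A \<in> shift j k G" "B \<in> shift j k G" for A B
    using that gg[of A B] ss[of A B] gs[of A B] gs[of B A] unfolding shift_def
    by (auto split: if_splits simp: Int_commute)
  thus ?thesis using shift_subset[OF G' jk] by (simp add: intersecting_def)
qed

lemma shift_bij:
  assumes "j \<noteq> k"
  shows "bij_betw (\<lambda>A. if j \<notin> A \<and> sw j k A \<notin> G then sw j k A else A) G (shift j k G)" (is "bij_betw ?f _ _")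
proof (rule bij_betw_imageI)
  have jk: "j \<in> sw j k A \<longleftrightarrow> k \<in> A" "k \<in> sw j k A \<longleftrightarrow> j \<in> A" for A by (auto simp: in_sw)
  have neither: "sw j k A = A" if "j \<notin> A" "k \<notin> A" for A using that sw_eq_self by blast
  show "inj_on ?f G"
  proof (rule inj_onI)
    fix A B assume "A \<in> G" "B \<in> G" "?f A = ?f B"
    thus "A = B" by (metis (no_types, lifting) sw_sw)
  qed
  show "?f ` G = shift j k G"
  proof (intro equalityI subsetI)
    fix A assume "A \<in> ?f ` G"
    then obtain B where B: "B \<in> G" "A = ?f B" by blast
    show "A \<in> shift j k G"
    proof (cases "j \<notin> B \<and> sw j k B \<notin> G")
      case True
      hence "j \<in> A" using B neither jk by (metis (full_types))
      thus ?thesis using B True by (auto simp: shift_def)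
    next
      case False
      thus ?thesis using B by (auto simp: shift_def)
    qed
  next
    fix A assume A: "A \<in> shift j k G"
    show "A \<in> ?f ` G"
    proof (cases "A \<in> G")
      case True
      hence "?f A = A" using A by (auto simp: shift_def)
      thus ?thesis using True by force
    next
      case False
      hence "j \<in> A" "sw j k A \<in> G" using A by (auto simp: shift_def split: if_splits)
      moreover have "k \<notin> A" using False calculation sw_eq_self by metis
      ultimately have "?f (sw j k A) = A" using False jk by auto
      thus ?thesis using \<open>sw j k A \<in> G\<close> by force
    qed
  qed
qed

lemma mu_p_shift: "j \<noteq> k \<Longrightarrow> mu_p n p (shift j k G) = mu_p n p G"
  unfolding mu_p_def
  by (subst sum.reindex_bij_betw[OF shift_bij, symmetric, of j k]) (auto intro!: sum.cong)

lemma sum_sw_less: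
  assumes "finite A" "j < k" "k \<in> A" "j \<notin> A"
  shows "\<Sum>(sw j k A) < \<Sum>(A :: nat set)"
proof -
  have "sw j k A = insert j (A - {k})" using assms sw_insert[of k A j] sw_commute by metis
  hence "\<Sum>(sw j k A) = j + \<Sum>(A - {k})" using assms by simp
  moreover have "\<Sum>A = k + \<Sum>(A - {k})" using assms by (simp add: sum.remove)
  ultimately show ?thesis using assms by simp
qed

text \<open>This potential gives shifted optimal families by minimality and is the induction measure
  when shifts are undone.\<close>

lemma shift_potential:
  assumes "G \<subseteq> Pow {1..n}" "j < k" "shift j k G \<noteq> G"
  shows "(\<Sum>A\<in>shift j k G. \<Sum>A) < (\<Sum>A\<in>G. \<Sum>A)"
proof -
  let ?f = "\<lambda>A. if j \<notin> A \<and> sw j k A \<notin> G then sw j k A else A"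
  have fin: "finite G" "\<And>A. A \<in> G \<Longrightarrow> finite A" using assms(1) by (auto intro: finite_subset)
  have lt: "\<Sum>(sw j k A) < \<Sum>A" if "A \<in> G" "j \<notin> A" "sw j k A \<notin> G" for A
    using that fin assms sw_eq_self[of j A k] by (intro sum_sw_less) auto
  have "\<exists>A\<in>G. j \<notin> A \<and> sw j k A \<notin> G"
  proof (rule ccontr)
    assume c: "\<not> ?thesis"
    hence "?f ` G = G" by force
    thus False using shift_bij[of j k G] assms by (auto simp: bij_betw_def)
  qed
  then obtain B where B: "B \<in> G" "j \<notin> B" "sw j k B \<notin> G" by blast
  have "(\<Sum>A\<in>shift j k G. \<Sum>A) = (\<Sum>A\<in>G. \<Sum>(?f A))"
    by (rule sum.reindex_bij_betw[OF shift_bij, symmetric]) (use assms in auto)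
  also have "\<dots> < (\<Sum>A\<in>G. \<Sum>A)"
    using fin B lt by (intro sum_strict_mono_ex1) (auto intro: less_imp_le)
  finally show ?thesis .
qed

lemma sum_Pow_Suc:
  fixes g :: "nat set \<Rightarrow> real"
  assumes "H \<subseteq> Pow {1..Suc n}"
  shows "sum g H = sum g (H \<inter> Pow {1..n}) + (\<Sum>z | z \<subseteq> {1..n} \<and> insert (Suc n) z \<in> H. g (insert (Suc n) z))"
proof -
  let ?U = "{z. z \<subseteq> {1..n} \<and> insert (Suc n) z \<in> H}"
  have fin: "finite H" using assms finite_subset by blast
  have "sum g H = sum g (H \<inter> Pow {1..n}) + sum g (H - Pow {1..n})"
    using fin sum.Int_Diff by blast
  also have "H - Pow {1..n} = insert (Suc n) ` ?U"
  proof (intro equalityI subsetI)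
    fix x assume x: "x \<in> H - Pow {1..n}"
    hence "x \<subseteq> {1..Suc n}" "\<not> x \<subseteq> {1..n}" using assms by auto
    hence "Suc n \<in> x" "x - {Suc n} \<subseteq> {1..n}" by (auto simp: subset_iff le_Suc_eq)
    thus "x \<in> insert (Suc n) ` ?U" using x by (intro image_eqI[of _ _ "x - {Suc n}"]) (auto simp: insert_absorb)
  qed auto
  also have "sum g (insert (Suc n) ` ?U) = (\<Sum>z\<in>?U. g (insert (Suc n) z))"
  proof (rule sum.reindex_cong[of "insert (Suc n)"])
    have "Suc n \<notin> z" if "z \<in> ?U" for z using that by auto
    thus "inj_on (insert (Suc n)) ?U" by (intro inj_onI) (metis (lifting) insert_ident)
  qed auto
  finally show ?thesis .
qed

lemma mu_p_Suc:
  assumes "H \<subseteq> Pow {1..Suc n}"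
  shows "mu_p (Suc n) p H = (1 - p) * mu_p n p (H \<inter> Pow {1..n}) + p * mu_p n p {z. z \<subseteq> {1..n} \<and> insert (Suc n) z \<in> H}"
proof -
  have a: "card z \<le> n" "finite z" "Suc n \<notin> z" if "z \<subseteq> {1..n}" for z
    using that card_mono[OF _ that] by (auto intro: finite_subset)
  have "mu_p (Suc n) p H = (\<Sum>z\<in>H \<inter> Pow {1..n}. p ^ card z * (1 - p) ^ (Suc n - card z))
     + (\<Sum>z | z \<subseteq> {1..n} \<and> insert (Suc n) z \<in> H. p ^ card (insert (Suc n) z) * (1 - p) ^ (Suc n - card (insert (Suc n) z)))"
    unfolding mu_p_def by (rule sum_Pow_Suc[OF assms])
  also have "(\<Sum>z\<in>H \<inter> Pow {1..n}. p ^ card z * (1 - p) ^ (Suc n - card z)) = (1 - p) * mu_p n p (H \<inter> Pow {1..n})"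
    unfolding mu_p_def sum_distrib_left by (rule sum.cong) (auto simp: Suc_diff_le a algebra_simps)
  also have "(\<Sum>z | z \<subseteq> {1..n} \<and> insert (Suc n) z \<in> H. p ^ card (insert (Suc n) z) * (1 - p) ^ (Suc n - card (insert (Suc n) z)))
    = p * mu_p n p {z. z \<subseteq> {1..n} \<and> insert (Suc n) z \<in> H}"
    unfolding mu_p_def sum_distrib_left by (rule sum.cong) (auto simp: a algebra_simps)
  finally show ?thesis .
qed

section \<open>Optimal intersecting families\<close>

lemma mu_irrelevant:
  assumes H: "H \<subseteq> Pow {1..Suc n}" and irr: "\<And>z. z \<subseteq> {1..n} \<Longrightarrow> insert (Suc n) z \<in> H \<longleftrightarrow> z \<in> H"
  shows "mu_p (Suc n) p {x\<in>H. Suc n \<notin> x} = (1 - p) * mu_p (Suc n) p H"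
    "mu_p (Suc n) p {x\<in>H. Suc n \<in> x} = p * mu_p (Suc n) p H"
proof -
  have nz: "Suc n \<notin> z" if "z \<subseteq> {1..n}" for z using that by auto
  have e: "{z. z \<subseteq> {1..n} \<and> insert (Suc n) z \<in> H} = H \<inter> Pow {1..n}" using irr by blast
  have mH: "mu_p (Suc n) p H = mu_p n p (H \<inter> Pow {1..n})"
    unfolding mu_p_Suc[OF H] e by (simp add: algebra_simps)
  have s: "{x\<in>H. Suc n \<notin> x} \<subseteq> Pow {1..Suc n}" "{x\<in>H. Suc n \<in> x} \<subseteq> Pow {1..Suc n}" using H by blast+
  have 1: "{x\<in>H. Suc n \<notin> x} \<inter> Pow {1..n} = H \<inter> Pow {1..n}"
    "{z. z \<subseteq> {1..n} \<and> insert (Suc n) z \<in> {x\<in>H. Suc n \<notin> x}} = {}" using nz by blast+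
  have 2: "{x\<in>H. Suc n \<in> x} \<inter> Pow {1..n} = {}"
    "{z. z \<subseteq> {1..n} \<and> insert (Suc n) z \<in> {x\<in>H. Suc n \<in> x}} = H \<inter> Pow {1..n}" using nz irr by blast+
  show "mu_p (Suc n) p {x\<in>H. Suc n \<notin> x} = (1 - p) * mu_p (Suc n) p H"
    unfolding mu_p_Suc[OF s(1)] 1 mH by (simp add: mu_p_def)
  show "mu_p (Suc n) p {x\<in>H. Suc n \<in> x} = p * mu_p (Suc n) p H"
    unfolding mu_p_Suc[OF s(2)] 2 mH by (simp add: mu_p_def)
qed

locale biased =
  fixes t :: nat and p :: real
  assumes t1: "1 \<le> t" and p0: "0 < p" and p2: "p \<le> 1/2"
begin

definition opt :: "nat \<Rightarrow> nat set set \<Rightarrow> bool" where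
  "opt n G \<longleftrightarrow> intersecting n t G \<and> (\<forall>H. intersecting n t H \<longrightarrow> mu_p n p H \<le> mu_p n p G)"

lemma wt_pos: "0 < p ^ a * (1 - p) ^ b" using p0 p2 by simp

lemma mu_nonneg: "0 \<le> mu_p n p G"
  unfolding mu_p_def by (intro sum_nonneg) (use wt_pos less_imp_le in blast)

lemma mu_pos: "finite G \<Longrightarrow> G \<noteq> {} \<Longrightarrow> 0 < mu_p n p G"
  unfolding mu_p_def by (intro sum_pos) (use wt_pos in blast)+

lemma mu_Un: "finite G \<Longrightarrow> finite H \<Longrightarrow> G \<inter> H = {} \<Longrightarrow> mu_p n p (G \<union> H) = mu_p n p G + mu_p n p H"
  unfolding mu_p_def by (rule sum.union_disjoint)

lemma mu_Diff: "finite G \<Longrightarrow> R \<subseteq> G \<Longrightarrow> mu_p n p (G - R) = mu_p n p G - mu_p n p R"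
  unfolding mu_p_def by (rule sum_diff)

lemma intersecting_finite: "intersecting n t G \<Longrightarrow> finite G"
  unfolding intersecting_def using finite_subset by blast

lemma intersecting_D: "intersecting n t G \<Longrightarrow> A \<in> G \<Longrightarrow> B \<in> G \<Longrightarrow> t \<le> card (A \<inter> B)"
  by (simp add: intersecting_def)

lemma opt_int: "opt n G \<Longrightarrow> intersecting n t G" by (simp add: opt_def)

lemma opt_sub: "opt n G \<Longrightarrow> A \<in> G \<Longrightarrow> A \<subseteq> {1..n}" by (auto simp: opt_def intersecting_def)

lemma opt_finite: "opt n G \<Longrightarrow> finite G" using intersecting_finite opt_int by blast

text \<open>The common form of the competitions below: \<open>R\<close> has to contain every member
  that conflicts with the new sets \<open>D\<close>. In the case of equality the modified family is
  again optimal, which is what remains of a strict gain when \<open>p = 1/2\<close>.\<close>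

lemma opt_compete:
  assumes G: "opt n G" and R: "R \<subseteq> G" and D: "D \<subseteq> Pow {1..n}" "D \<inter> G = {}"
    and DD: "\<And>x y. x \<in> D \<Longrightarrow> y \<in> D \<Longrightarrow> t \<le> card (x \<inter> y)"
    and DG: "\<And>x y. x \<in> D \<Longrightarrow> y \<in> G - R \<Longrightarrow> t \<le> card (x \<inter> y)"
  shows "mu_p n p D \<le> mu_p n p R" "mu_p n p D = mu_p n p R \<Longrightarrow> opt n ((G - R) \<union> D)"
proof -
  have GD: "t \<le> card (y \<inter> x)" if "x \<in> D" "y \<in> G - R" for x y
    using DG[OF that] by (subst Int_commute)
  have GG: "t \<le> card (x \<inter> y)" if "x \<in> G" "y \<in> G" for x y
    by (rule intersecting_D[OF opt_int[OF G] that])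
  have "t \<le> card (x \<inter> y)" if "x \<in> (G - R) \<union> D" "y \<in> (G - R) \<union> D" for x y
  proof (cases "x \<in> D")
    case True
    thus ?thesis using that DD[of x y] DG[of x y] by blast
  next
    case False
    thus ?thesis using that GG[of x y] GD[of y x] by blast
  qed
  moreover have "(G - R) \<union> D \<subseteq> Pow {1..n}" using D(1) opt_sub[OF G] by blast
  ultimately have i: "intersecting n t ((G - R) \<union> D)" unfolding intersecting_def by blast
  have fin: "finite G" "finite D" using opt_finite[OF G] finite_subset[OF D(1)] by simp_all
  have e: "mu_p n p ((G - R) \<union> D) = mu_p n p G - mu_p n p R + mu_p n p D"
    using fin R D by (subst mu_Un) (auto simp: mu_Diff)
  show "mu_p n p D \<le> mu_p n p R" using G i e unfolding opt_def by force
  show "opt n ((G - R) \<union> D)" if "mu_p n p D = mu_p n p R" using G i e that unfolding opt_def by simp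
qed

lemma opt_maximal:
  assumes G: "opt n G" and x: "x \<subseteq> {1..n}" "t \<le> card x" "\<And>y. y \<in> G \<Longrightarrow> t \<le> card (x \<inter> y)"
  shows "x \<in> G"
proof (rule ccontr)
  assume "x \<notin> G"
  hence "mu_p n p {x} \<le> mu_p n p {}" using x by (intro opt_compete(1)[OF G]) auto
  thus False using mu_pos[of "{x}" n] by (simp add: mu_p_def)
qed

lemma opt_up:
  assumes G: "opt n G" and "x \<in> G" "x \<subseteq> y" "y \<subseteq> {1..n}"
  shows "y \<in> G"
proof (rule opt_maximal[OF G assms(4)])
  have fy: "finite y" using assms finite_subset by blast
  have c: "t \<le> card (x \<inter> z)" if "z \<in> G" for z using intersecting_D[OF opt_int[OF G]] assms that by blast
  have "t \<le> card x" using c[OF assms(2)] by simp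
  also have "\<dots> \<le> card y" using assms fy by (intro card_mono) auto
  finally show "t \<le> card y" .
  fix z assume "z \<in> G"
  note c[OF this]
  also have "card (x \<inter> z) \<le> card (y \<inter> z)" using assms fy by (intro card_mono) auto
  finally show "t \<le> card (y \<inter> z)" .
qed

lemma opt_eq:
  assumes G: "opt n G" and H: "intersecting n t H" and s: "G \<subseteq> H \<or> (H \<subseteq> G \<and> opt n H)"
  shows "G = H"
proof -
  have *: "A = B" if A: "opt n A" and B: "intersecting n t B" and s: "A \<subseteq> B" for A B
  proof
    show "B \<subseteq> A"
    proof
      fix x assume x: "x \<in> B"
      have i: "t \<le> card (x \<inter> y)" if "y \<in> B" for y using B x that by (auto simp: intersecting_def)
      show "x \<in> A" using i[OF x] i s B x by (intro opt_maximal[OF A]) (auto simp: intersecting_def)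
    qed
  qed (rule s)
  show ?thesis using s *[OF G H] *[of H G] opt_int[OF G] by blast
qed

lemma opt_exists: "\<exists>G. opt n G"
proof -
  have "Max {mu_p n p G |G. intersecting n t G} \<in> {mu_p n p G |G. intersecting n t G}"
    using w_p_set by (intro Max_in)
  then obtain G where "intersecting n t G" "Max {mu_p n p G |G. intersecting n t G} = mu_p n p G" by auto
  hence "opt n G" unfolding opt_def using w_p_set(1) by (metis (mono_tags, lifting) Max_ge mem_Collect_eq)
  thus ?thesis by blast
qed

lemma opt_iff: "opt n G \<longleftrightarrow> intersecting n t G \<and> mu_p n p G = w_p n t p"
proof
  assume G: "opt n G"
  have "w_p n t p = mu_p n p G" unfolding w_p_def
    using G w_p_set(1) by (intro Max_eqI) (auto simp: opt_def)
  thus "intersecting n t G \<and> mu_p n p G = w_p n t p" using opt_int[OF G] by simp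
next
  assume a: "intersecting n t G \<and> mu_p n p G = w_p n t p"
  thus "opt n G" unfolding opt_def w_p_def using w_p_set(1) by (auto intro!: Max_ge)
qed

lemma opt_shift:
  assumes "opt n G" "j \<in> {1..n}" "k \<in> {1..n}" "j \<noteq> k"
  shows "opt n (shift j k G)"
  using assms shift_intersecting by (auto simp: opt_def mu_p_shift)

definition shifted :: "nat \<Rightarrow> nat set set \<Rightarrow> bool" where
  "shifted n G \<longleftrightarrow> (\<forall>j k. 1 \<le> j \<longrightarrow> j < k \<longrightarrow> k \<le> n \<longrightarrow> shift j k G = G)"

lemma shiftedD:
  assumes "shifted n G" "1 \<le> j" "j < k" "k \<le> n" "x \<in> G" "k \<in> x" "j \<notin> x"
  shows "insert j (x - {k}) \<in> G"
proof -
  have "x \<in> shift j k G" using assms by (auto simp: shifted_def)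
  hence "sw j k x \<in> G" using assms by (auto simp: shift_def)
  thus ?thesis using assms sw_insert[of k x j] sw_commute by metis
qed

lemma shifted_opt_exists: "\<exists>G. opt n G \<and> shifted n G"
proof -
  obtain G where G: "opt n G" and m: "\<And>H. opt n H \<Longrightarrow> (\<Sum>A\<in>G. \<Sum>A) \<le> (\<Sum>A\<in>H. \<Sum>A)"
    using opt_exists exists_least_iff[of "\<lambda>k. \<exists>G. opt n G \<and> (\<Sum>A\<in>G. \<Sum>A) = k"] by (metis not_less)
  have Gs: "G \<subseteq> Pow {1..n}" using opt_int[OF G] by (simp add: intersecting_def)
  have "shift j k G = G" if "1 \<le> j" "j < k" "k \<le> n" for j k
  proof (rule ccontr)
    assume "shift j k G \<noteq> G"
    hence "(\<Sum>A\<in>shift j k G. \<Sum>A) < (\<Sum>A\<in>G. \<Sum>A)"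
      using Gs that by (intro shift_potential[of _ n]) auto
    thus False using m[OF opt_shift[OF G, of j k]] that by auto
  qed
  thus ?thesis using G by (auto simp: shifted_def)
qed

definition lift :: "nat \<Rightarrow> nat set set \<Rightarrow> nat set set" where
  "lift n G = {A. A \<subseteq> {1..Suc n} \<and> A \<inter> {1..n} \<in> G}"

lemma mu_lift:
  assumes "G \<subseteq> Pow {1..n}" shows "mu_p (Suc n) p (lift n G) = mu_p n p G"
proof -
  have n: "{1..Suc n} = insert (Suc n) {1..n}" by auto
  have "lift n G \<inter> Pow {1..n} = G"
  proof (intro equalityI subsetI)
    fix A assume "A \<in> lift n G \<inter> Pow {1..n}"
    thus "A \<in> G" by (auto simp: lift_def Int_absorb2 simp del: atLeastAtMost_iff)
  next
    fix A assume A: "A \<in> G"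
    hence As: "A \<subseteq> {1..n}" using assms by blast
    hence "A \<inter> {1..n} = A" by (rule Int_absorb2)
    moreover have "A \<subseteq> {1..Suc n}" unfolding n by (rule subset_insertI2[OF As])
    ultimately show "A \<in> lift n G \<inter> Pow {1..n}" using A As unfolding lift_def by simp
  qed
  moreover have "{z. z \<subseteq> {1..n} \<and> insert (Suc n) z \<in> lift n G} = G"
  proof -
    have e: "insert (Suc n) z \<inter> {1..n} = z" if "z \<subseteq> {1..n}" for z using that by auto
    show ?thesis
    proof (intro equalityI subsetI)
      fix z assume "z \<in> {z. z \<subseteq> {1..n} \<and> insert (Suc n) z \<in> lift n G}"
      thus "z \<in> G" using e[of z] unfolding lift_def by simp
    next
      fix z assume z: "z \<in> G"
      hence "z \<subseteq> {1..n}" using assms by blast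
      thus "z \<in> {z. z \<subseteq> {1..n} \<and> insert (Suc n) z \<in> lift n G}"
        using z e[of z] n unfolding lift_def by (simp add: subset_insertI2)
    qed
  qed
  ultimately have "mu_p (Suc n) p (lift n G) = (1 - p) * mu_p n p G + p * mu_p n p G"
    by (subst mu_p_Suc) (auto simp: lift_def)
  thus ?thesis by (simp add: algebra_simps)
qed

lemma lift_intersecting:
  assumes "intersecting n t G" shows "intersecting (Suc n) t (lift n G)"
  unfolding intersecting_def
proof (intro conjI ballI)
  show "lift n G \<subseteq> Pow {1..Suc n}" by (auto simp: lift_def)
  fix A B assume a: "A \<in> lift n G" "B \<in> lift n G"
  hence "t \<le> card ((A \<inter> {1..n}) \<inter> (B \<inter> {1..n}))" using assms by (auto simp: lift_def intersecting_def)
  also have "\<dots> \<le> card (A \<inter> B)" using a by (intro card_mono) (auto simp: lift_def intro: finite_subset)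
  finally show "t \<le> card (A \<inter> B)" .
qed

text \<open>Adding the last point never leaves an optimal family, so \<open>irr\<close> makes
  membership independent of it; a better family on \<open>n\<close> points would lift to a better
  one on \<open>n + 1\<close>.\<close>

lemma opt_irrelevant:
  assumes H: "opt (Suc n) H" and irr: "\<And>z. z \<subseteq> {1..n} \<Longrightarrow> insert (Suc n) z \<in> H \<Longrightarrow> z \<in> H"
  shows "opt n (H \<inter> Pow {1..n})" "H = lift n (H \<inter> Pow {1..n})"
proof -
  have up: "insert (Suc n) z \<in> H" if "z \<in> H" "z \<subseteq> {1..n}" for z
    by (rule opt_up[OF H that(1)]) (use that(2) in \<open>auto simp: subset_iff\<close>)
  show e: "H = lift n (H \<inter> Pow {1..n})"
  proof (intro equalityI subsetI)
    fix x assume x: "x \<in> H"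
    hence xs: "x \<subseteq> {1..Suc n}" using opt_sub[OF H] by blast
    have "x \<inter> {1..n} \<in> H"
    proof (cases "Suc n \<in> x")
      case True
      hence "insert (Suc n) (x \<inter> {1..n}) = x" using xs by (auto simp: subset_iff le_Suc_eq)
      thus ?thesis using irr[of "x \<inter> {1..n}"] x by auto
    next
      case False
      hence "x \<inter> {1..n} = x" using xs by (auto simp: subset_iff le_Suc_eq)
      thus ?thesis using x by simp
    qed
    thus "x \<in> lift n (H \<inter> Pow {1..n})" using xs by (auto simp: lift_def)
  next
    fix x assume x: "x \<in> lift n (H \<inter> Pow {1..n})"
    hence "x \<inter> {1..n} \<in> H" "x \<subseteq> {1..Suc n}" by (simp_all add: lift_def)
    thus "x \<in> H" using opt_up[OF H _ Int_lower1] by blast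
  qed
  have i: "intersecting n t (H \<inter> Pow {1..n})" using opt_int[OF H] by (auto simp: intersecting_def)
  show "opt n (H \<inter> Pow {1..n})" unfolding opt_def
  proof (intro conjI i allI impI)
    fix K assume K: "intersecting n t K"
    hence "mu_p n p K = mu_p (Suc n) p (lift n K)" by (intro mu_lift[symmetric]) (auto simp: intersecting_def)
    also have "\<dots> \<le> mu_p (Suc n) p H" using H lift_intersecting[OF K] by (auto simp: opt_def)
    also have "\<dots> = mu_p n p (H \<inter> Pow {1..n})" using e mu_lift[of "H \<inter> Pow {1..n}" n] by simp
    finally show "mu_p n p K \<le> mu_p n p (H \<inter> Pow {1..n})" .
  qed
qed

text \<open>A lift keeps the measure, so a single optimal lift shows that the maximal measures on
  \<open>n\<close> and \<open>n + 1\<close> points coincide.\<close>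

lemma opt_lift:
  assumes "opt n G" "opt n G'" "opt (Suc n) (lift n G')" shows "opt (Suc n) (lift n G)"
proof -
  have P: "G \<subseteq> Pow {1..n}" "G' \<subseteq> Pow {1..n}"
    using opt_int[OF assms(1)] opt_int[OF assms(2)] by (simp_all add: intersecting_def)
  have "mu_p (Suc n) p (lift n G) = mu_p (Suc n) p (lift n G')"
    using assms(1,2) by (simp add: mu_lift[OF P(1)] mu_lift[OF P(2)] opt_iff)
  thus ?thesis using assms(3) lift_intersecting[OF opt_int[OF assms(1)]] by (simp add: opt_iff)
qed

end

section \<open>Threshold families and the undoing of a shift\<close>

lemma sw_Int_card: "card (sw j k A \<inter> T) = card (A \<inter> sw j k T)"
proof -
  have "sw j k (sw j k A \<inter> T) = A \<inter> sw j k T" by (simp add: sw_Int)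
  thus ?thesis by (metis card_sw)
qed

lemma sw_thr:
  assumes "j \<in> {1..n}" "k \<in> {1..n}"
  shows "sw j k A \<in> thr n T h \<longleftrightarrow> A \<in> thr n (sw j k T) h"
  unfolding thr_def mem_Collect_eq sw_subset[OF assms] sw_Int_card ..

context biased begin

text \<open>At \<open>p = 1/2\<close> the optimal \<open>T\<close> omits at most one point.\<close>

definition frankl :: "nat \<Rightarrow> nat set set \<Rightarrow> bool" where
  "frankl n G \<longleftrightarrow> (\<exists>T r. T \<subseteq> {1..n} \<and> card T = t + 2 * r \<and> (2 \<le> t \<or> r = 0) \<and>
     (p = 1/2 \<longrightarrow> n \<le> t + 2 * r + 1) \<and> G = thr n T (t + r))"

lemma unshift_subset:
  assumes G: "G \<subseteq> Pow {1..n}" and sh: "shift j k G = thr n T h" and T: "finite T" "j \<in> T" "k \<notin> T"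
    and bd: "\<And>z. z \<subseteq> {1..n} - {j, k} \<Longrightarrow> card (z \<inter> T) + 1 = h \<Longrightarrow> insert j z \<in> G"
  shows "G \<subseteq> thr n T h"
proof
  fix A assume A: "A \<in> G"
  show "A \<in> thr n T h"
  proof (cases "A \<in> shift j k G")
    case False
    hence A': "j \<notin> A" "sw j k A \<notin> G" using A by (auto simp: shift_def split: if_splits)
    hence k: "k \<in> A" using A sw_eq_self[of j A k] by metis
    define z where "z = A - {k}"
    have e: "sw j k A = insert j z" using sw_insert[OF k A'(1)] sw_commute z_def by metis
    have "sw j k A \<in> shift j k G" using A k by (simp add: shift_def in_sw)
    hence "h \<le> card (insert j z \<inter> T)" unfolding sh e by (simp add: thr_def)
    also have "insert j z \<inter> T = insert j (z \<inter> T)" using T by blast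
    also have "card \<dots> = card (z \<inter> T) + 1" using T A' by (simp add: z_def)
    finally have "h \<le> card (z \<inter> T) + 1" .
    moreover have "card (z \<inter> T) + 1 \<noteq> h" using bd[of z] A A' G e by (auto simp: z_def)
    moreover have "z \<inter> T = A \<inter> T" using T by (auto simp: z_def)
    ultimately show ?thesis using A G by (auto simp: thr_def)
  qed (use sh in simp)
qed

text \<open>Swapping \<open>j\<close> and \<open>k\<close> in \<open>G\<close> reduces the case in
  which every choice is \<open>z + k\<close> to the one in which every choice is
  \<open>z + j\<close>.\<close>

lemma shift_image_sw: "shift j k (sw j k ` G) = shift j k G"
proof -
  have "A \<in> sw j k ` G \<longleftrightarrow> sw j k A \<in> G" for A by (metis image_iff sw_sw)
  thus ?thesis by (auto simp: shift_def)
qed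

text \<open>For each boundary set \<open>z\<close> the shift merges \<open>z + j\<close> and \<open>z + k\<close>; connectivity shows that the choice
between them does not depend on \<open>z\<close>.\<close>

lemma frankl_shift_constant:
  assumes G: "opt n G" and T: "T \<subseteq> {1..n}" "card T = t + 2 * r" "2 \<le> t \<or> r = 0"
    and sh: "shift j k G = thr n T (t + r)" and jk: "j \<in> T" "k \<in> {1..n} - T"
  shows "(\<forall>z. z \<subseteq> {1..n} - {j, k} \<and> card (z \<inter> T) + 1 = t + r \<longrightarrow> insert j z \<in> G) \<or>
    (\<forall>z. z \<subseteq> {1..n} - {j, k} \<and> card (z \<inter> T) + 1 = t + r \<longrightarrow> insert k z \<in> G)"
proof -
  define I where "I = {1..n} - {j, k}"
  define tr where "tr = (\<lambda>x. {i\<in>I. x i})"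
  have finT: "finite T" using T finite_subset by blast
  have jn: "j \<in> {1..n}" "j \<noteq> k" "k \<notin> T" using jk T by auto
  have bd: "insert j z \<in> G \<or> insert k z \<in> G"
    if "z \<subseteq> I" "card (z \<inter> T) + 1 = t + r" for z
  proof -
    have "insert j z \<inter> T = insert j (z \<inter> T)" using jk by blast
    hence "card (insert j z \<inter> T) = t + r" using that finT by (auto simp: I_def card_insert_if)
    moreover have "insert j z \<subseteq> {1..n}" using that jn by (auto simp: I_def)
    ultimately have "insert j z \<in> shift j k G" unfolding sh by (simp add: thr_def)
    moreover have "sw j k (insert j z) = insert k z" using that jn by (subst sw_insert) (auto simp: I_def)
    ultimately show ?thesis by (simp add: shift_def)
  qed
  have cc: "{i\<in>T - {j}. \<not> x i} = T - {j} - tr x" for x :: "nat \<Rightarrow> bool"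
    using T jn by (auto simp: tr_def I_def)
  have trT: "tr x \<inter> T = tr x \<inter> (T - {j})" for x by (auto simp: tr_def I_def)
  have size: "card (tr x \<inter> T) + 1 = t + r \<longleftrightarrow> card {i\<in>T - {j}. \<not> x i} = r" for x
  proof -
    have "card (T - {j}) = card ((T - {j}) \<inter> tr x) + card (T - {j} - tr x)"
      using finT by (metis card_Int_Diff finite_Diff)
    moreover have "card (T - {j}) + 1 = t + 2 * r" using T jk finT t1 by simp
    moreover have "(T - {j}) \<inter> tr x = tr x \<inter> T" using trT by blast
    ultimately have "card (tr x \<inter> T) + card (T - {j} - tr x) + 1 = t + 2 * r" by simp
    thus ?thesis unfolding cc by arith
  qed
  \<comment> \<open>Values record membership, and two sets disagree at a point unless both contain
    it; so agreements form the intersection. If the choices were \<open>j\<close> for one set and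
    \<open>k\<close> for the other, the resulting members of \<open>G\<close> would meet only in
    \<open>tr x \<inter> tr y\<close>.\<close>
  interpret kn: kneser I "T - {j}" "\<lambda>_. UNIV" "\<lambda>_ v. v" "\<lambda>_ u v. \<not> (u \<and> v)" t r "\<lambda>x. insert j (tr x) \<in> G"
  proof (unfold_locales, goal_cases)
    case 1 thus ?case by (simp add: I_def)
  next
    case 2 thus ?case using T jn by (auto simp: I_def)
  next
    case 3 thus ?case using T jk finT t1 by simp
  next
    case 4 thus ?case using T by blast
  next
    case (5 i v) thus ?case by auto
  next
    case (6 x y)
    have *: False if a: "card (tr x \<inter> tr y) < t" "insert j (tr x) \<in> G" "insert j (tr y) \<notin> G"
      "card (tr y \<inter> T) + 1 = t + r" for x y
    proof -
      have "insert k (tr y) \<in> G" using bd[of "tr y"] a by (auto simp: tr_def)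
      hence "t \<le> card (insert j (tr x) \<inter> insert k (tr y))" using intersecting_D[OF opt_int[OF G]] a by blast
      moreover have "insert j (tr x) \<inter> insert k (tr y) = tr x \<inter> tr y" using jn by (auto simp: tr_def I_def)
      ultimately show False using a by simp
    qed
    have "{i\<in>I. \<not> \<not> (x i \<and> y i)} = tr x \<inter> tr y" by (auto simp: tr_def)
    hence "card (tr x \<inter> tr y) < t" using 6 by simp
    thus ?case using *[of x y] *[of y x] 6(3,4) size by (auto simp: Int_commute)
  next
    \<comment> \<open>The empty set disagrees with every set, so all parts outside \<open>T\<close>
      are connected through it.\<close>
    case (7 g u v)
    have r: "restrict (\<lambda>_. False) (I - (T - {j})) \<in> PiE (I - (T - {j})) (\<lambda>_. UNIV)" by simp
    have "g u = g (restrict (\<lambda>_. False) (I - (T - {j})))" by (rule 7(1)[OF 7(2) r]) auto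
    also have "\<dots> = g v" by (rule 7(1)[OF r 7(3)]) auto
    finally show ?case .
  qed
  have p: "restrict (\<lambda>i. i \<in> z) I \<in> kn.pts \<and> tr (restrict (\<lambda>i. i \<in> z) I) = z"
    if "z \<subseteq> {1..n} - {j, k} \<and> card (z \<inter> T) + 1 = t + r" for z
  proof -
    have e: "tr (restrict (\<lambda>i. i \<in> z) I) = z" using that by (auto simp: tr_def I_def)
    thus ?thesis using that size[of "restrict (\<lambda>i. i \<in> z) I"] by (simp add: kn.pts_def kn.miss_def)
  qed
  have "(\<forall>z. z \<subseteq> {1..n} - {j, k} \<and> card (z \<inter> T) + 1 = t + r \<longrightarrow> insert j z \<in> G) \<or>
      (\<forall>z. z \<subseteq> {1..n} - {j, k} \<and> card (z \<inter> T) + 1 = t + r \<longrightarrow> insert j z \<notin> G)"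
    using kn.f_constant p by metis
  thus ?thesis using bd unfolding I_def by blast
qed

text \<open>The shift favours \<open>j\<close>, so \<open>T\<close> cannot contain \<open>k\<close>
  without \<open>j\<close>. If \<open>T\<close> treats both alike, its threshold family is invariant
  under the swap and contains \<open>G\<close>. In the remaining case \<open>G\<close> belongs to
  \<open>T\<close> or to its image under the swap.\<close>

lemma frankl_unshift:
  assumes G: "opt n G" and fr: "frankl n (shift j k G)" and jk: "j \<in> {1..n}" "k \<in> {1..n}" "j \<noteq> k"
  shows "frankl n G"
proof -
  obtain T r where T: "T \<subseteq> {1..n}" "card T = t + 2 * r" "2 \<le> t \<or> r = 0"
    "p = 1/2 \<longrightarrow> n \<le> t + 2 * r + 1" and sh: "shift j k G = thr n T (t + r)"
    using fr unfolding frankl_def by blast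
  have finT: "finite T" using T finite_subset by blast
  have fin: "frankl n G" if "T' \<subseteq> {1..n}" "card T' = card T" "G \<subseteq> thr n T' (t + r)" for T'
  proof -
    have "G = thr n T' (t + r)"
      by (rule opt_eq[OF G thr_intersecting]) (use that T in auto)
    thus ?thesis using that T unfolding frankl_def by metis
  qed
  have neither: "A \<in> thr n T (t + r)" if "A \<in> G" "sw j k A = A" for A
    unfolding sh[symmetric] using that by (simp add: shift_def)
  have shI: "A \<in> shift j k G" if "j \<in> A" "A \<in> G \<or> sw j k A \<in> G" for A
    using that by (simp add: shift_def)
  have shI2: "A \<in> shift j k G" if "A \<in> G" "sw j k A \<in> G" for A
    using that by (simp add: shift_def)
  have shI3: "sw j k A \<in> shift j k G" if "j \<in> sw j k A" "A \<in> G" for A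
    by (rule shI[OF that(1)]) (use that(2) in simp)
  consider "(j \<in> T) = (k \<in> T)" | "k \<in> T" "j \<notin> T" | "j \<in> T" "k \<notin> T" by blast
  thus ?thesis
  proof cases
    case 1
    hence s: "sw j k A \<in> thr n T (t + r) \<longleftrightarrow> A \<in> thr n T (t + r)" for A
      using sw_thr[OF jk(1,2)] sw_eq_self[of j T k] by simp
    have "A \<in> thr n T (t + r)" if A: "A \<in> G" for A
    proof (cases "j \<in> A")
      case True
      thus ?thesis unfolding sh[symmetric] using A by (simp add: shift_def)
    next
      case False
      show ?thesis
      proof (cases "k \<in> A")
        case True
        hence "j \<in> sw j k A" by (simp add: in_sw)
        hence "sw j k A \<in> shift j k G" using A by (simp add: shift_def)
        thus ?thesis using s sh by simp
      qed (use False A neither sw_eq_self in blast)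
    qed
    thus ?thesis using fin[of T] T by blast
  next
    case 2
    have "t + r - 1 \<le> card (T - {k})" using 2 T finT by simp
    then obtain B where B: "B \<subseteq> T - {k}" "card B = t + r - 1" by (meson obtain_subset_with_card_n)
    have fB: "finite B" using B finT finite_subset by blast
    have jB: "j \<notin> B" "k \<notin> B" using B 2 by auto
    have "insert k B \<inter> T = insert k B" "insert k B \<subseteq> {1..n}" using B 2 T by auto
    hence "insert k B \<in> shift j k G" unfolding sh using B jB fB t1 by (simp add: thr_def)
    hence "sw j k (insert k B) \<in> G" "insert k B \<in> G" using jB jk by (auto simp: shift_def)
    moreover have e: "sw j k (insert k B) = insert j B"
      using jB jk sw_insert[of k "insert k B" j] by (simp add: sw_commute[of j k])
    moreover have "sw j k (insert j B) = insert k B" using e by (metis sw_sw)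
    ultimately have "insert j B \<in> shift j k G" by (simp add: shift_def)
    moreover have "insert j B \<inter> T = B" using B 2 by auto
    ultimately have "t + r \<le> card B" unfolding sh by (simp add: thr_def)
    thus ?thesis using B(2) t1 by linarith
  next
    case 3
    have Gs: "G \<subseteq> Pow {1..n}" using opt_sub[OF G] by blast
    have "k \<in> {1..n} - T" using 3 jk by blast
    from frankl_shift_constant[OF G T(1-3) sh 3(1) this] show ?thesis
    proof (elim disjE, goal_cases)
      case 1
      have "G \<subseteq> thr n T (t + r)" by (rule unshift_subset[OF Gs sh finT 3]) (use 1 in blast)
      thus ?thesis using fin[of T] T by blast
    next
      case 2
      have "sw j k ` G \<subseteq> thr n T (t + r)"
      proof (rule unshift_subset[OF _ _ finT 3])
        show "sw j k ` G \<subseteq> Pow {1..n}" using Gs sw_subset[OF jk(1,2)] by blast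
        show "shift j k (sw j k ` G) = thr n T (t + r)" using sh by (simp add: shift_image_sw)
        fix z assume z: "z \<subseteq> {1..n} - {j, k}" "card (z \<inter> T) + 1 = t + r"
        have "sw j k (insert k z) = insert j z"
          using z(1) jk(3) sw_insert[of k "insert k z" j] by (auto simp: sw_commute[of j k])
        moreover have "insert k z \<in> G" using 2 z by blast
        ultimately show "insert j z \<in> sw j k ` G" by (metis image_eqI)
      qed
      hence "G \<subseteq> thr n (sw j k T) (t + r)" using sw_thr[OF jk(1,2)] by blast
      moreover have "sw j k T \<subseteq> {1..n}" using T sw_subset[OF jk(1,2)] by blast
      ultimately show ?thesis using fin[of "sw j k T"] by simp
    qed
  qed
qed

text \<open>Families are improved by adding some of these sets and deleting the partners of others.\<close>

definition bd :: "nat \<Rightarrow> nat set set \<Rightarrow> nat set set" where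
  "bd n G = {z. z \<subseteq> {1..n} \<and> insert (Suc n) z \<in> G \<and> z \<notin> G}"

lemma bd_finite: "finite (bd n G)"
  by (rule finite_subset[of _ "Pow {1..n}"]) (auto simp: bd_def)

lemma bd_D:
  assumes "z \<in> bd n G"
  shows "z \<subseteq> {1..n}" "finite z" "Suc n \<notin> z" "insert (Suc n) z \<in> G" "z \<notin> G" "card z \<le> n"
proof -
  show z: "z \<subseteq> {1..n}" and "insert (Suc n) z \<in> G" "z \<notin> G" using assms by (auto simp: bd_def)
  show "finite z" "Suc n \<notin> z" "card z \<le> n" using z card_mono[OF _ z] by (auto intro: finite_subset)
qed

text \<open>If some \<open>j\<close> were outside both sets, shiftedness would turn
  \<open>z + (n + 1)\<close> into the member \<open>z + j\<close>, which meets
  \<open>w + (n + 1)\<close> only in \<open>z \<inter> w\<close>. Thus conflicts pair off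
  complementary sizes.\<close>

lemma bd_conflict:
  assumes G: "opt (Suc n) G" and S: "shifted (Suc n) G"
    and z: "z \<in> bd n G" and w: "w \<in> bd n G" and c: "card (z \<inter> w) < t"
  shows "z \<union> w = {1..n}" "card z + card w + 1 = n + t"
proof -
  note zD = bd_D[OF z] and wD = bd_D[OF w]
  have "t \<le> card (insert (Suc n) z \<inter> insert (Suc n) w)"
    by (rule intersecting_D[OF opt_int[OF G] zD(4) wD(4)])
  also have "insert (Suc n) z \<inter> insert (Suc n) w = insert (Suc n) (z \<inter> w)" by blast
  also have "card \<dots> = Suc (card (z \<inter> w))" using zD by simp
  finally have t: "card (z \<inter> w) + 1 = t" using c by simp
  show u: "z \<union> w = {1..n}"
  proof (rule ccontr)
    assume "z \<union> w \<noteq> {1..n}"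
    then obtain j where j: "j \<in> {1..n}" "j \<notin> z" "j \<notin> w" using zD wD by blast
    have "insert j (insert (Suc n) z - {Suc n}) \<in> G"
      by (rule shiftedD[OF S]) (use j zD in auto)
    moreover have "insert (Suc n) z - {Suc n} = z" using zD by auto
    ultimately have "insert j z \<in> G" by simp
    hence "t \<le> card (insert j z \<inter> insert (Suc n) w)"
      by (rule intersecting_D[OF opt_int[OF G] _ wD(4)])
    also have "insert j z \<inter> insert (Suc n) w = z \<inter> w" using j zD wD by auto
    finally show False using c by simp
  qed
  have "card z + card w = card (z \<union> w) + card (z \<inter> w)" using zD wD by (intro card_Un_Int) auto
  thus "card z + card w + 1 = n + t" using u t by simp
qed

text \<open>The factors come from the last point, absent from the added sets and present in the
  deleted ones. A member meets some \<open>z\<close> of \<open>A\<close> in fewer than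
  \<open>t\<close> points only if it contains the last point and leaves \<open>G\<close> without it,
  that is, only if it comes from a boundary set.\<close>

lemma bd_swap:
  assumes G: "opt (Suc n) G" and tn: "t \<le> n"
    and A: "A \<subseteq> bd n G" and B: "B \<subseteq> bd n G"
    and AA: "\<And>z w. z \<in> A \<Longrightarrow> w \<in> A \<Longrightarrow> t \<le> card (z \<inter> w)"
    and AB: "\<And>z w. z \<in> A \<Longrightarrow> w \<in> bd n G \<Longrightarrow> card (z \<inter> w) < t \<Longrightarrow> w \<in> B"
  shows "(1 - p) * mu_p n p A \<le> p * mu_p n p B"
    "(1 - p) * mu_p n p A = p * mu_p n p B \<Longrightarrow> opt (Suc n) ((G - insert (Suc n) ` B) \<union> A)"
proof -
  have s: "{1..n} \<subseteq> {1..Suc n}" by auto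
  have An: "A \<subseteq> Pow {1..n}" and Bn: "B \<subseteq> Pow {1..n}" using A B bd_D(1) by blast+
  have No: "Suc n \<notin> z" if "z \<subseteq> {1..n}" for z using that by auto
  have R: "insert (Suc n) ` B \<subseteq> G" using B by (auto simp: bd_def)
  have D: "A \<subseteq> Pow {1..Suc n}" by (rule order_trans[OF An Pow_mono[OF s]])
  have D2: "A \<inter> G = {}" using A by (auto simp: bd_def)
  have DG: "t \<le> card (z \<inter> y)" if z: "z \<in> A" and y: "y \<in> G - insert (Suc n) ` B" for z y
  proof -
    note zD = bd_D[OF subsetD[OF A z]]
    have i: "t \<le> card (insert (Suc n) z \<inter> y)" if "y \<in> G" for y
      by (rule intersecting_D[OF opt_int[OF G] zD(4) that])
    have ys: "y \<subseteq> {1..Suc n}" using y opt_sub[OF G] by blast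
    show ?thesis
    proof (cases "Suc n \<in> y")
      case False
      hence "insert (Suc n) z \<inter> y = z \<inter> y" by blast
      thus ?thesis using i[of y] y by simp
    next
      case True
      define w where "w = y - {Suc n}"
      have w: "y = insert (Suc n) w" "Suc n \<notin> w" "w \<subseteq> {1..n}" using True ys by (auto simp: w_def subset_iff le_Suc_eq)
      have zw: "z \<inter> y = z \<inter> w" "insert (Suc n) z \<inter> w = z \<inter> w" using w zD by auto
      show ?thesis
      proof (cases "w \<in> G")
        case True
        thus ?thesis using i[of w] zw by simp
      next
        case False
        hence "w \<in> bd n G" using w y by (auto simp: bd_def)
        moreover have "w \<notin> B" using y w by blast
        ultimately show ?thesis using AB[OF z] zw by force
      qed
    qed
  qed
  have a: "mu_p (Suc n) p A = (1 - p) * mu_p n p A"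
  proof -
    have U: "A \<inter> Pow {1..n} = A" using An by blast
    have V: "{z. z \<subseteq> {1..n} \<and> insert (Suc n) z \<in> A} = {}" using An No by blast
    show ?thesis unfolding mu_p_Suc[OF D] U V by (simp add: mu_p_def)
  qed
  have b: "mu_p (Suc n) p (insert (Suc n) ` B) = p * mu_p n p B"
  proof -
    have sn: "{1..Suc n} = insert (Suc n) {1..n}" by auto
    have BB: "insert (Suc n) ` B \<subseteq> Pow {1..Suc n}" unfolding sn using Bn by blast
    have U: "insert (Suc n) ` B \<inter> Pow {1..n} = {}" using No by blast
    have V: "{z. z \<subseteq> {1..n} \<and> insert (Suc n) z \<in> insert (Suc n) ` B} = B"
    proof -
      have "z = w" if z: "z \<subseteq> {1..n}" "w \<in> B" "insert (Suc n) z = insert (Suc n) w" for z w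
      proof -
        have "w \<subseteq> {1..n}" using that(2) Bn by blast
        thus ?thesis using insert_ident[OF No[OF z(1)] No[of w]] z(3) by simp
      qed
      thus ?thesis using Bn by auto
    qed
    show ?thesis unfolding mu_p_Suc[OF BB] U V by (simp add: mu_p_def)
  qed
  show "(1 - p) * mu_p n p A \<le> p * mu_p n p B"
    using opt_compete(1)[OF G R D D2 AA DG] a b by simp
  show "opt (Suc n) ((G - insert (Suc n) ` B) \<union> A)" if "(1 - p) * mu_p n p A = p * mu_p n p B"
    using opt_compete(2)[OF G R D D2 AA DG] a b that by simp
qed

text \<open>Sizes are compared with \<open>(n + t - 1) / 2\<close>, the fixed point of the pairing
  in \<open>bd_conflict\<close>: \<open>big\<close> and \<open>small\<close> conflict only with each
  other, \<open>mid\<close> only with itself.\<close>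

definition big where "big n G = {z \<in> bd n G. n + t < 2 * card z + 1}"
definition small where "small n G = {z \<in> bd n G. 2 * card z + 1 < n + t}"
definition mid where "mid n G = {z \<in> bd n G. 2 * card z + 1 = n + t}"

lemma bd_parts: "bd n G = big n G \<union> small n G \<union> mid n G"
  by (auto simp: big_def small_def mid_def)

text \<open>Neither class conflicts with itself, so the exchange is possible in both directions. For
  \<open>p < 1/2\<close> this empties both classes; at \<open>p = 1/2\<close> both inequalities
  become equalities and both exchanged families are optimal.\<close>

lemma big_small:
  assumes G: "opt (Suc n) G" and S: "shifted (Suc n) G" and tn: "t \<le> n"
  shows "(1 - p) * mu_p n p (big n G) \<le> p * mu_p n p (small n G)" (is ?A)
    "(1 - p) * mu_p n p (small n G) \<le> p * mu_p n p (big n G)" (is ?B)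
    "(1 - p) * mu_p n p (big n G) = p * mu_p n p (small n G) \<Longrightarrow>
       opt (Suc n) ((G - insert (Suc n) ` small n G) \<union> big n G)" (is "?EA \<Longrightarrow> ?C")
    "(1 - p) * mu_p n p (small n G) = p * mu_p n p (big n G) \<Longrightarrow>
       opt (Suc n) ((G - insert (Suc n) ` big n G) \<union> small n G)" (is "?EB \<Longrightarrow> ?D")
proof -
  have b: "big n G \<subseteq> bd n G" "small n G \<subseteq> bd n G" by (auto simp: big_def small_def)
  note c = bd_conflict(2)[OF G S]
  have bb: "t \<le> card (z \<inter> w)" if "z \<in> big n G" "w \<in> big n G" for z w
    using c[of z w] that by (force simp: big_def)
  have ss: "t \<le> card (z \<inter> w)" if "z \<in> small n G" "w \<in> small n G" for z w
    using c[of z w] that by (force simp: small_def)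
  have bs: "w \<in> small n G" if "z \<in> big n G" "w \<in> bd n G" "card (z \<inter> w) < t" for z w
    using c[of z w] that by (auto simp: small_def big_def)
  have sb: "w \<in> big n G" if "z \<in> small n G" "w \<in> bd n G" "card (z \<inter> w) < t" for z w
    using c[of z w] that by (auto simp: small_def big_def)
  show ?A by (rule bd_swap(1)[OF G tn b bb bs])
  show ?B by (rule bd_swap(1)[OF G tn b(2,1) ss sb])
  show "?EA \<Longrightarrow> ?C" by (rule bd_swap(2)[OF G tn b bb bs])
  show "?EB \<Longrightarrow> ?D" by (rule bd_swap(2)[OF G tn b(2,1) ss sb])
qed

lemma big_small_empty:
  assumes G: "opt (Suc n) G" and S: "shifted (Suc n) G" and tn: "t \<le> n" and pl: "p < 1/2"
  shows "big n G = {}" "small n G = {}"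
proof -
  let ?b = "mu_p n p (big n G)" and ?s = "mu_p n p (small n G)"
  have "(1 - 2 * p) * (?b + ?s) \<le> 0" using big_small(1,2)[OF G S tn] by (simp add: algebra_simps)
  hence "?b + ?s \<le> 0" using pl by (simp add: mult_le_0_iff)
  hence "?b = 0" "?s = 0" using mu_nonneg[of n "big n G"] mu_nonneg[of n "small n G"] by auto
  moreover have "finite (big n G)" "finite (small n G)" using bd_finite[of n G] by (auto simp: big_def small_def)
  ultimately show "big n G = {}" "small n G = {}" using mu_pos by (metis less_irrefl)+
qed

text \<open>Average over \<open>j\<close> the exchange of the middle sets avoiding \<open>j\<close> for those containing \<open>j\<close>.\<close>

lemma mid_bound:
  assumes G: "opt (Suc n) G" and S: "shifted (Suc n) G" and tn: "t \<le> n"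
    and r: "Suc n = t + 2 * r" and ne: "mid n G \<noteq> {}"
  shows "real r \<le> p * (real t + 2 * real r - 1)"
proof -
  define k where "k = t + r - 1"
  have k: "card z = k" if "z \<in> mid n G" for z using that r t1 by (auto simp: mid_def k_def)
  have nk: "n = k + r" using r t1 by (simp add: k_def)
  have fin: "finite (mid n G)" using bd_finite[of n G] by (simp add: mid_def)
  define c where "c = p ^ k * (1 - p) ^ (n - k)"
  have c0: "c > 0" unfolding c_def by (rule wt_pos)
  have mu: "mu_p n p A = c * card A" if "A \<subseteq> mid n G" for A
  proof -
    have "mu_p n p A = (\<Sum>z\<in>A. c)" unfolding mu_p_def c_def using that k by (intro sum.cong) auto
    thus ?thesis by simp
  qed
  define a where "a = (\<lambda>j. {z \<in> mid n G. j \<notin> z})"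
  define b where "b = (\<lambda>j. {z \<in> mid n G. j \<in> z})"
  have j: "(1 - p) * card (a j) \<le> p * card (b j)" if j: "j \<in> {1..n}" for j
  proof -
    have s: "a j \<subseteq> bd n G" "b j \<subseteq> bd n G" "a j \<subseteq> mid n G" "b j \<subseteq> mid n G" by (auto simp: a_def b_def mid_def)
    have "(1 - p) * mu_p n p (a j) \<le> p * mu_p n p (b j)"
    \<comment> \<open>Conflicting sets cover \<open>{1..n}\<close>, so sets avoiding
      \<open>j\<close> conflict only with sets containing \<open>j\<close>.\<close>
    proof (rule bd_swap(1)[OF G tn s(1,2)])
      fix z w assume zw: "z \<in> a j" "w \<in> a j"
      thus "t \<le> card (z \<inter> w)"
        using bd_conflict(1)[OF G S, of z w] s j by (force simp: a_def)
    next
      fix z w assume zw: "z \<in> a j" "w \<in> bd n G" "card (z \<inter> w) < t"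
      have zb: "z \<in> bd n G" using s zw by blast
      have "w \<in> mid n G" using bd_conflict(2)[OF G S zb zw(2,3)] zw by (auto simp: a_def mid_def)
      moreover have "j \<in> z \<union> w" unfolding bd_conflict(1)[OF G S zb zw(2,3)] by (rule j)
      hence "j \<in> w" using zw(1) by (simp add: a_def)
      ultimately show "w \<in> b j" by (simp add: b_def)
    qed
    hence "c * ((1 - p) * card (a j)) \<le> c * (p * card (b j))" using s by (simp add: mu algebra_simps)
    thus ?thesis using c0 by simp
  qed
  have "(\<Sum>j\<in>{1..n}. card (b j)) = (\<Sum>z\<in>mid n G. card {j\<in>{1..n}. j \<in> z})"
    unfolding b_def by (rule sum_multicount_gen) (use fin in auto)
  also have "\<dots> = (\<Sum>z\<in>mid n G. k)"
  proof (rule sum.cong)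
    fix z assume z: "z \<in> mid n G"
    hence "{j\<in>{1..n}. j \<in> z} = z" using bd_D(1)[of z n G] by (auto simp: mid_def)
    thus "card {j\<in>{1..n}. j \<in> z} = k" using k z by simp
  qed simp
  finally have sb: "(\<Sum>j\<in>{1..n}. card (b j)) = card (mid n G) * k" by simp
  have "(\<Sum>j\<in>{1..n}. card (a j)) = (\<Sum>z\<in>mid n G. card {j\<in>{1..n}. j \<notin> z})"
    unfolding a_def by (rule sum_multicount_gen) (use fin in auto)
  also have "\<dots> = (\<Sum>z\<in>mid n G. r)"
  proof (rule sum.cong)
    fix z assume z: "z \<in> mid n G"
    hence zs: "z \<subseteq> {1..n}" "finite z" using bd_D(1,2)[of z n G] by (auto simp: mid_def)
    have "{j\<in>{1..n}. j \<notin> z} = {1..n} - z" by auto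
    thus "card {j\<in>{1..n}. j \<notin> z} = r" using k z zs nk by (simp add: card_Diff_subset)
  qed simp
  finally have sa: "(\<Sum>j\<in>{1..n}. card (a j)) = card (mid n G) * r" by simp
  have "(1 - p) * (\<Sum>j\<in>{1..n}. card (a j)) \<le> p * (\<Sum>j\<in>{1..n}. card (b j))"
    using sum_mono[of "{1..n}" "\<lambda>j. (1 - p) * card (a j)" "\<lambda>j. p * card (b j)"] j
    by (simp add: sum_distrib_left)
  hence "(1 - p) * (card (mid n G) * r) \<le> p * (card (mid n G) * k)" unfolding sa sb by simp
  hence "real (card (mid n G)) * ((1 - p) * r) \<le> real (card (mid n G)) * (p * k)" by (simp add: algebra_simps)
  moreover have "card (mid n G) > 0" using fin ne by (simp add: card_gt_0_iff)
  \<comment> \<open>With \<open>k = t + r - 1\<close> this says that \<open>p\<close> is at least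
    \<open>r / (t + 2 * r - 1)\<close>, the lower end of the classical range in which a set
    \<open>T\<close> of \<open>t + 2 * r\<close> points is optimal.\<close>
  ultimately have "(1 - p) * r \<le> p * k" by simp
  moreover have kk: "real k = real t + real r - 1" using t1 by (simp add: k_def of_nat_diff)
  ultimately have "(1 - p) * r \<le> p * (real t + real r - 1)" unfolding kk by simp
  thus ?thesis by (simp add: algebra_simps)
qed

text \<open>Every boundary set either is added itself or loses its partner, so the exchanged family
  has no boundary.\<close>

lemma swapped_irrelevant:
  assumes AB: "bd n G = A \<union> B" and z: "z \<subseteq> {1..n}" "insert (Suc n) z \<in> (G - insert (Suc n) ` B) \<union> A"
  shows "z \<in> (G - insert (Suc n) ` B) \<union> A"
proof -
  have "Suc n \<notin> w" if "w \<in> A" for w using that bd_D(3)[of w n G] AB by blast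
  hence i: "insert (Suc n) z \<in> G" "z \<notin> B" using z(2) by blast+
  have zN: "Suc n \<notin> z" using z by auto
  show ?thesis
  proof (cases "z \<in> G")
    case False
    hence "z \<in> bd n G" using i z by (simp add: bd_def)
    thus ?thesis using i AB by blast
  qed (use zN in blast)
qed

text \<open>By parity there is no middle size, and the other two classes can be exchanged away, so
  the new point does not raise the maximum. This supplies the coin for the pushing argument on
  \<open>t + 2 * r\<close> points.\<close>

lemma odd_irrelevant:
  assumes tn: "t \<le> n" and ev: "even (n + t)" and G: "opt n G"
  shows "opt (Suc n) (lift n G)"
proof -
  obtain H where H: "opt (Suc n) H" "shifted (Suc n) H" using shifted_opt_exists by blast
  have mid: "mid n H = {}"
  proof -
    have "False" if "2 * card z + 1 = n + t" for z :: "nat set" using ev that by presburger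
    thus ?thesis by (auto simp: mid_def)
  qed
  define K where "K = (H - insert (Suc n) ` small n H) \<union> big n H"
  have "opt (Suc n) K"
  proof (cases "p < 1/2")
    case True
    thus ?thesis using big_small_empty[OF H tn] H by (simp add: K_def)
  next
    case False
    hence ph: "p = 1/2" using p2 by simp
    have "(1 - p) * mu_p n p (big n H) = p * mu_p n p (small n H)"
      using big_small(1,2)[OF H tn] unfolding ph by simp
    thus ?thesis using big_small(3)[OF H tn] unfolding K_def by blast
  qed
  moreover have "z \<in> K" if "z \<subseteq> {1..n}" "insert (Suc n) z \<in> K" for z
    using swapped_irrelevant[of n H "big n H" "small n H" z] that bd_parts[of n H] mid unfolding K_def by simp
  ultimately have "opt n (K \<inter> Pow {1..n})" "opt (Suc n) (lift n (K \<inter> Pow {1..n}))"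
    using opt_irrelevant[of n K] by metis+
  thus ?thesis using opt_lift[OF G] by blast
qed

text \<open>The consequence of shiftedness for single members; in this form it is easily checked for
  a lift.\<close>

definition compressed :: "nat \<Rightarrow> nat set set \<Rightarrow> bool" where
  "compressed n G \<longleftrightarrow> (\<forall>j k x. 1 \<le> j \<longrightarrow> j < k \<longrightarrow> k \<le> n \<longrightarrow> x \<in> G \<longrightarrow> k \<in> x \<longrightarrow> j \<notin> x \<longrightarrow> insert j (x - {k}) \<in> G)"

definition symm :: "nat \<Rightarrow> nat set set \<Rightarrow> bool" where
  "symm a G \<longleftrightarrow> (\<forall>i j x. i \<in> {1..a} \<longrightarrow> j \<in> {1..a} \<longrightarrow> x \<in> G \<longrightarrow> i \<in> x \<longrightarrow> j \<notin> x \<longrightarrow> insert j (x - {i}) \<in> G)"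

end

text \<open>Pushing-pulling across the point \<open>a + 1\<close> of a family symmetric on \<open>{1..a}\<close>. The last point
\<open>n + 1\<close> is irrelevant for \<open>L\<close>; as a coin of bias \<open>p\<close> it splits a layer that conflicts with itself.\<close>

locale pushing = biased +
  fixes n a :: nat and L :: "nat set set"
  assumes t2: "2 \<le> t" and an: "a < n" and L: "opt (Suc n) L"
    and comp: "compressed (Suc n) L" and sym: "symm a L"
    and irr: "\<And>z. z \<subseteq> {1..n} \<Longrightarrow> insert (Suc n) z \<in> L \<longleftrightarrow> z \<in> L"
begin

abbreviation c where "c \<equiv> Suc a"

text \<open>The obstruction to extending the symmetry by \<open>c\<close>: compression already
  replaces \<open>c\<close> by smaller points, and only a push of some \<open>j\<close> to
  \<open>c\<close> can fail. \<open>D k\<close> collects the missing images, indexed by the size on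
  \<open>{1..a}\<close> before the push.\<close>

definition X :: "nat \<Rightarrow> nat set set" where
  "X k = {x\<in>L. c \<notin> x \<and> card (x \<inter> {1..a}) = k \<and> (\<exists>j\<in>x \<inter> {1..a}. insert c (x - {j}) \<notin> L)}"

definition D :: "nat \<Rightarrow> nat set set" where
  "D k = {y. y \<subseteq> {1..Suc n} \<and> y \<notin> L \<and> c \<in> y \<and> card (y \<inter> {1..a}) + 1 = k \<and>
     (\<exists>j\<in>{1..a} - y. insert j (y - {c}) \<in> L)}"

lemma compD: "1 \<le> j \<Longrightarrow> j < k \<Longrightarrow> k \<le> Suc n \<Longrightarrow> x \<in> L \<Longrightarrow> k \<in> x \<Longrightarrow> j \<notin> x \<Longrightarrow> insert j (x - {k}) \<in> L"
  using comp unfolding compressed_def by blast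

lemma symD: "i \<in> {1..a} \<Longrightarrow> j \<in> {1..a} \<Longrightarrow> x \<in> L \<Longrightarrow> i \<in> x \<Longrightarrow> j \<notin> x \<Longrightarrow> insert j (x - {i}) \<in> L"
  using sym unfolding symm_def by blast

lemma ca: "c \<notin> {1..a}" by simp

text \<open>If the push failed for \<open>i\<close> but succeeded for \<open>j\<close>, the symmetry
  on \<open>{1..a}\<close> would exchange the two in the result. With \<open>D_all\<close>, the
  pairs of a set and an admissible \<open>j\<close> then correspond one to one.\<close>

lemma X_all:
  assumes x: "x \<in> X k" and j: "j \<in> x \<inter> {1..a}"
  shows "insert c (x - {j}) \<notin> L"
proof
  assume a: "insert c (x - {j}) \<in> L"
  obtain i where i: "i \<in> x \<inter> {1..a}" "insert c (x - {i}) \<notin> L" using x by (auto simp: X_def)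
  have cx: "c \<notin> x" using x by (simp add: X_def)
  have ij: "i \<noteq> j" using a i by blast
  have "insert j (insert c (x - {j}) - {i}) \<in> L"
    by (rule symD[of i j "insert c (x - {j})"]) (use a i j ij ca in auto)
  moreover have "insert j (insert c (x - {j}) - {i}) = insert c (x - {i})" using i j ij ca by auto
  ultimately show False using i by simp
qed

lemma D_all:
  assumes y: "y \<in> D k" and j: "j \<in> {1..a} - y"
  shows "insert j (y - {c}) \<in> L"
proof -
  obtain i where i: "i \<in> {1..a} - y" "insert i (y - {c}) \<in> L" using y by (auto simp: D_def)
  show ?thesis
  proof (cases "i = j")
    case False
    have "insert j (insert i (y - {c}) - {i}) \<in> L"
      by (rule symD[of i j "insert i (y - {c})"]) (use i j False in auto)
    moreover have "insert j (insert i (y - {c}) - {i}) = insert j (y - {c})" using i by auto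
    ultimately show ?thesis by simp
  qed (use i in simp)
qed

lemma X_sub: "x \<in> X k \<Longrightarrow> x \<subseteq> {1..Suc n}"
  using opt_sub[OF L] by (simp add: X_def)

lemma X_to_D:
  assumes x: "x \<in> X k" and j: "j \<in> x \<inter> {1..a}"
  shows "insert c (x - {j}) \<in> D k"
proof -
  have cx: "c \<notin> x" "x \<in> L" "card (x \<inter> {1..a}) = k" using x by (auto simp: X_def)
  have "insert c (x - {j}) \<inter> {1..a} = x \<inter> {1..a} - {j}" using ca by blast
  hence "card (insert c (x - {j}) \<inter> {1..a}) + 1 = k"
    using cx(3) j card_Suc_Diff1[of "x \<inter> {1..a}" j] by simp
  moreover have "insert j (insert c (x - {j}) - {c}) = x" using j cx by blast
  hence "insert j (insert c (x - {j}) - {c}) \<in> L" using cx(2) by simp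
  moreover have "insert c (x - {j}) \<subseteq> {1..Suc n}" using X_sub[OF x] an by auto
  moreover have "j \<in> {1..a} - insert c (x - {j})" using j ca by blast
  ultimately show ?thesis using X_all[OF x j] unfolding D_def mem_Collect_eq by (intro conjI bexI insertI1)
qed

lemma D_to_X:
  assumes y: "y \<in> D k" and j: "j \<in> {1..a} - y"
  shows "insert j (y - {c}) \<in> X k"
proof -
  have cy: "c \<in> y" "y \<notin> L" "card (y \<inter> {1..a}) + 1 = k" using y by (auto simp: D_def)
  have jc: "j \<noteq> c" using j by auto
  have "insert j (y - {c}) \<inter> {1..a} = insert j (y \<inter> {1..a})" using ca j by blast
  hence "card (insert j (y - {c}) \<inter> {1..a}) = k" using cy(3) j by simp
  moreover have "insert c (insert j (y - {c}) - {j}) = y" using j cy by blast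
  hence "insert c (insert j (y - {c}) - {j}) \<notin> L" using cy(2) by simp
  moreover have "c \<notin> insert j (y - {c})" using jc by blast
  moreover have "j \<in> insert j (y - {c}) \<inter> {1..a}" using j by blast
  ultimately show ?thesis using D_all[OF y j] unfolding X_def mem_Collect_eq by (intro conjI bexI)
qed

lemma finite_XD: "finite (X k)" "finite (D k)"
proof -
  show "finite (X k)" using opt_finite[OF L] by (simp add: X_def)
  show "finite (D k)" by (rule finite_subset[of _ "Pow {1..Suc n}"]) (auto simp: D_def)
qed

text \<open>Count pairs of a set and an admissible \<open>j\<close>: there are \<open>k\<close> for
  a set in \<open>X k\<close> and \<open>a + 1 - k\<close> for one in \<open>D k\<close>, and
  replacing \<open>j\<close> by \<open>c\<close> keeps the size and so the weight.\<close>

lemma double_count: "real k * mu_p (Suc n) p (X k) = (real a + 1 - real k) * mu_p (Suc n) p (D k)"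
proof -
  let ?w = "\<lambda>A. p ^ card A * (1 - p) ^ (Suc n - card A) :: real"
  have cX: "card (x \<inter> {1..a}) = k" if "x \<in> X k" for x using that by (simp add: X_def)
  have cD: "real (card ({1..a} - y)) = real a + 1 - real k" if "y \<in> D k" for y
  proof -
    have "card ({1..a} - y) = a - card ({1..a} \<inter> y)" by (simp add: card_Diff_subset_Int)
    moreover have "card (y \<inter> {1..a}) + 1 = k" using that by (simp add: D_def)
    moreover have "card (y \<inter> {1..a}) \<le> card {1..a}" by (intro card_mono) auto
    ultimately show ?thesis by (simp add: Int_commute of_nat_diff)
  qed
  have "real k * mu_p (Suc n) p (X k) = (\<Sum>x\<in>X k. \<Sum>j\<in>x \<inter> {1..a}. ?w x)"
    unfolding mu_p_def sum_distrib_left by (rule sum.cong[OF refl]) (simp only: sum_constant cX)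
  also have "\<dots> = (\<Sum>(x,j)\<in>(SIGMA x:X k. x \<inter> {1..a}). ?w x)"
    by (rule sum.Sigma) (use finite_XD in auto)
  also have "\<dots> = (\<Sum>(y,j)\<in>(SIGMA y:D k. {1..a} - y). ?w y)"
  proof (rule sum.reindex_bij_witness[where j = "\<lambda>(x, j). (insert c (x - {j}), j)" and i = "\<lambda>(y, j). (insert j (y - {c}), j)"])
    fix u assume "u \<in> (SIGMA x:X k. x \<inter> {1..a})"
    then obtain x j where u: "u = (x, j)" "x \<in> X k" "j \<in> x \<inter> {1..a}" by blast
    have cx: "c \<notin> x" using u by (simp add: X_def)
    have fx: "finite x" using X_sub[OF u(2)] finite_subset by blast
    have "insert j (insert c (x - {j}) - {c}) = x" using u cx by blast
    thus "(case case u of (x, j) \<Rightarrow> (insert c (x - {j}), j) of (y, j) \<Rightarrow> (insert j (y - {c}), j)) = u"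
      using u by simp
    have "j \<notin> insert c (x - {j})" using u ca by blast
    thus "(case u of (x, j) \<Rightarrow> (insert c (x - {j}), j)) \<in> (SIGMA y:D k. {1..a} - y)"
      using u X_to_D[OF u(2,3)] by simp
    have "card (insert c (x - {j})) = card x" using u cx fx card_Suc_Diff1[of x j] by simp
    thus "(case case u of (x, j) \<Rightarrow> (insert c (x - {j}), j) of (y, j) \<Rightarrow> ?w y) = (case u of (x, j) \<Rightarrow> ?w x)"
      using u by simp
  next
    fix u assume "u \<in> (SIGMA y:D k. {1..a} - y)"
    then obtain y j where u: "u = (y, j)" "y \<in> D k" "j \<in> {1..a} - y" by blast
    have cy: "c \<in> y" using u by (simp add: D_def)
    have "insert c (insert j (y - {c}) - {j}) = y" using u cy by blast
    thus "(case case u of (y, j) \<Rightarrow> (insert j (y - {c}), j) of (x, j) \<Rightarrow> (insert c (x - {j}), j)) = u"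
      using u by simp
    show "(case u of (y, j) \<Rightarrow> (insert j (y - {c}), j)) \<in> (SIGMA x:X k. x \<inter> {1..a})"
      using u D_to_X[OF u(2,3)] by simp
  qed
  also have "\<dots> = (\<Sum>y\<in>D k. \<Sum>j\<in>{1..a} - y. ?w y)"
    by (rule sum.Sigma[symmetric]) (use finite_XD in auto)
  also have "\<dots> = (real a + 1 - real k) * mu_p (Suc n) p (D k)"
    unfolding mu_p_def sum_distrib_left by (rule sum.cong[OF refl]) (simp only: sum_constant cD)
  finally show ?thesis .
qed

text \<open>All sets \<open>y - c + j\<close> lie in \<open>L\<close>, so \<open>z\<close> contains
  every \<open>j\<close> of \<open>{1..a} - y\<close>, avoids \<open>c\<close> and meets
  \<open>y\<close> in exactly \<open>t - 1\<close> points. A successful push of \<open>z\<close> to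
  \<open>c\<close> would make an intersection in \<open>L\<close> too small, so \<open>z\<close> is
  an obstruction; compressing a common point beyond \<open>c\<close> to \<open>c\<close> would do
  the same.\<close>

lemma D_conflict:
  assumes y: "y \<in> D k" and z: "z \<in> L" and lt: "card (y \<inter> z) < t"
  shows "z \<in> X (card (z \<inter> {1..a}))" "k + card (z \<inter> {1..a}) = a + t" "y \<inter> z \<subseteq> {1..a}"
proof -
  have cy: "c \<in> y" "y \<subseteq> {1..Suc n}" "card (y \<inter> {1..a}) + 1 = k" using y by (auto simp: D_def)
  have zs: "z \<subseteq> {1..Suc n}" using opt_sub[OF L z] .
  have fin: "finite y" "finite z" using cy zs finite_subset by blast+
  obtain i where i: "i \<in> {1..a} - y" using y by (auto simp: D_def)
  define y0 where "y0 = y - {c}"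
  have y0: "c \<notin> y0" "y0 \<subseteq> y" "i \<notin> y0" "i \<noteq> c" using i by (auto simp: y0_def)
  have int: "t \<le> card (u \<inter> v)" if "u \<in> L" "v \<in> L" for u v using intersecting_D[OF opt_int[OF L]] that by blast
  have u: "insert j y0 \<in> L" if "j \<in> {1..a} - y" for j using D_all[OF y that] by (simp add: y0_def)
  have le: "card (y0 \<inter> z) \<le> card (y \<inter> z)" using y0 fin by (intro card_mono) auto
  have jz: "j \<in> z" if j: "j \<in> {1..a} - y" for j
  proof (rule ccontr)
    assume "j \<notin> z"
    hence "insert j y0 \<inter> z = y0 \<inter> z" by blast
    thus False using int[OF u[OF j] z] le lt by simp
  qed
  have "t \<le> card (insert i y0 \<inter> z)" by (rule int[OF u[OF i] z])
  also have "insert i y0 \<inter> z = insert i (y0 \<inter> z)" using jz[OF i] by blast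
  finally have ge: "t \<le> card (y0 \<inter> z) + 1" using y0 fin by simp
  have cz: "c \<notin> z"
  proof
    assume "c \<in> z"
    hence "y \<inter> z = insert c (y0 \<inter> z)" using cy by (auto simp: y0_def)
    thus False using ge lt y0 fin by simp
  qed
  have yz: "y \<inter> z = y0 \<inter> z" using cz by (auto simp: y0_def)
  have ct: "card (y0 \<inter> z) + 1 = t" using ge lt yz by simp
  have "insert c (z - {i}) \<notin> L"
  proof
    assume "insert c (z - {i}) \<in> L"
    hence "t \<le> card (insert i y0 \<inter> insert c (z - {i}))" by (rule int[OF u[OF i]])
    also have "insert i y0 \<inter> insert c (z - {i}) = y0 \<inter> z" using y0 by blast
    finally show False using ct by simp
  qed
  thus "z \<in> X (card (z \<inter> {1..a}))" using z cz jz[OF i] i unfolding X_def by blast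
  show sub: "y \<inter> z \<subseteq> {1..a}"
  proof
    fix e assume e: "e \<in> y \<inter> z"
    show "e \<in> {1..a}"
    proof (rule ccontr)
      assume "e \<notin> {1..a}"
      moreover have "e \<noteq> c" using e cz by blast
      moreover have "e \<in> {1..Suc n}" using e zs by blast
      ultimately have ce: "c < e" "e \<le> Suc n" by auto
      have "insert c (z - {e}) \<in> L" by (rule compD) (use ce z e cz in auto)
      hence "t \<le> card (insert i y0 \<inter> insert c (z - {e}))" by (rule int[OF u[OF i]])
      also have "insert i y0 \<inter> insert c (z - {e}) \<subseteq> insert i (y0 \<inter> z - {e})" using y0 by blast
      hence "card (insert i y0 \<inter> insert c (z - {e})) \<le> card (insert i (y0 \<inter> z - {e}))"
        using fin by (intro card_mono) auto
      also have "\<dots> \<le> Suc (card (y0 \<inter> z - {e}))" using fin by (simp add: card_insert_if)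
      also have "\<dots> = card (y0 \<inter> z)" using e yz fin by (intro card_Suc_Diff1) auto
      finally show False using ct by simp
    qed
  qed
  have "card (y \<inter> {1..a}) + card (z \<inter> {1..a}) = card ((y \<inter> {1..a}) \<union> (z \<inter> {1..a})) + card ((y \<inter> {1..a}) \<inter> (z \<inter> {1..a}))"
    by (intro card_Un_Int) auto
  also have "(y \<inter> {1..a}) \<union> (z \<inter> {1..a}) = {1..a}" using jz by blast
  also have "(y \<inter> {1..a}) \<inter> (z \<inter> {1..a}) = y0 \<inter> z" using sub yz by blast
  finally show "k + card (z \<inter> {1..a}) = a + t" using cy(3) ct by simp
qed

text \<open>Replace \<open>y'\<close> by a preimage in \<open>X k'\<close>. Both sets contain
  \<open>c\<close>, and its loss makes up for the possible gain of \<open>j\<close>.\<close>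

lemma DD_conflict:
  assumes y: "y \<in> D k" and y': "y' \<in> D k'" and lt: "card (y \<inter> y') < t"
  shows "k + k' = a + t" "y \<inter> y' \<subseteq> {1..Suc a}"
proof -
  obtain j where j: "j \<in> {1..a} - y'" using y' by (auto simp: D_def)
  let ?z = "insert j (y' - {c})"
  have cy: "c \<in> y" "c \<in> y'" "finite y" using y y' by (auto simp: D_def intro: finite_subset)
  have z: "?z \<in> X k'" by (rule D_to_X[OF y' j])
  hence zk: "card (?z \<inter> {1..a}) = k'" "?z \<in> L" by (simp_all add: X_def)
  have "card (y \<inter> ?z) \<le> card (insert j (y \<inter> y' - {c}))" using cy by (intro card_mono) auto
  also have "\<dots> \<le> Suc (card (y \<inter> y' - {c}))" using cy by (simp add: card_insert_if)
  also have "\<dots> = card (y \<inter> y')" using cy by (intro card_Suc_Diff1) auto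
  finally have lt': "card (y \<inter> ?z) < t" using lt by simp
  show "k + k' = a + t" using D_conflict(2)[OF y zk(2) lt'] unfolding zk(1) .
  have "y \<inter> ?z \<subseteq> {1..a}" by (rule D_conflict(3)[OF y zk(2) lt'])
  hence "y \<inter> y' - {c} \<subseteq> {1..a}" by blast
  thus "y \<inter> y' \<subseteq> {1..Suc a}" by (auto simp: atLeastAtMostSuc_conv)
qed

lemma D_basic: "D k \<subseteq> Pow {1..Suc n}" "D k \<inter> L = {}" "X k \<subseteq> L"
  by (auto simp: D_def X_def simp del: atLeastAtMost_iff)

lemma D_le_X:
  assumes "k + k' = a + t" "k \<noteq> k'"
  shows "mu_p (Suc n) p (D k) \<le> mu_p (Suc n) p (X k')"
proof (rule opt_compete(1)[OF L D_basic(3,1,2)])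
  fix x y assume xy: "x \<in> D k" "y \<in> D k"
  show "t \<le> card (x \<inter> y)"
  proof (rule ccontr)
    assume "\<not> t \<le> card (x \<inter> y)"
    thus False using DD_conflict(1)[OF xy] assms by simp
  qed
next
  fix x y assume xy: "x \<in> D k" "y \<in> L - X k'"
  show "t \<le> card (x \<inter> y)"
  proof (rule ccontr)
    assume "\<not> t \<le> card (x \<inter> y)"
    hence "y \<in> X (card (y \<inter> {1..a}))" "k + card (y \<inter> {1..a}) = a + t"
      using D_conflict(1,2)[OF xy(1), of y] xy by auto
    moreover hence "card (y \<inter> {1..a}) = k'" using assms by linarith
    ultimately show False using xy by simp
  qed
qed

lemma X_bounds: "x \<in> X k \<Longrightarrow> 1 \<le> k \<and> k \<le> a"
proof -
  assume x: "x \<in> X k"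
  then obtain j where "j \<in> x \<inter> {1..a}" by (auto simp: X_def)
  hence "card (x \<inter> {1..a}) > 0" by (auto simp: card_gt_0_iff)
  moreover have "card (x \<inter> {1..a}) \<le> card {1..a}" by (intro card_mono) auto
  moreover have "card (x \<inter> {1..a}) = k" using x by (simp add: X_def)
  ultimately show ?thesis by simp
qed

text \<open>With \<open>k' = a + t - k\<close>, the factors in \<open>double_count\<close> are
  \<open>k\<close> against \<open>k' - (t - 1)\<close> and \<open>k'\<close> against
  \<open>k - (t - 1)\<close>. Going round \<open>X k\<close>, \<open>D k\<close>,
  \<open>X k'\<close>, \<open>D k'\<close> and back is therefore a strict loss for
  \<open>2 \<le> t\<close>.\<close>

lemma X_unbalanced:
  assumes "2 * k \<noteq> a + t"
  shows "X k = {}"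
proof (rule ccontr)
  assume ne: "X k \<noteq> {}"
  let ?m = "mu_p (Suc n) p"
  have k: "1 \<le> k" "k \<le> a" using ne X_bounds by blast+
  define k' where "k' = a + t - k"
  have kk: "k + k' = a + t" "k \<noteq> k'" using k assms by (auto simp: k'_def)
  have Xk: "?m (X k) > 0" by (rule mu_pos[OF finite_XD(1) ne])
  have e: "real k * ?m (X k) = (real a + 1 - real k) * ?m (D k)" by (rule double_count)
  have "?m (D k) \<noteq> 0" using e Xk k by auto
  hence Dk: "?m (D k) > 0" using mu_nonneg[of "Suc n" "D k"] by simp
  have DX: "?m (D k) \<le> ?m (X k')" "?m (D k') \<le> ?m (X k)" using D_le_X[of k k'] D_le_X[of k' k] kk by auto
  hence Xk': "?m (X k') > 0" using Dk by linarith
  hence "X k' \<noteq> {}" by (auto simp: mu_p_def)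
  hence k': "1 \<le> k'" "k' \<le> a" using X_bounds by blast+
  have e': "real k' * ?m (X k') = (real a + 1 - real k') * ?m (D k')" by (rule double_count)
  have r: "real a + 1 - real k = real k' - (real t - 1)" "real a + 1 - real k' = real k - (real t - 1)"
    using kk(1) by linarith+
  have tt: "real t - 1 > 0" using t2 by simp
  have pos: "real a + 1 - real k > 0" "real a + 1 - real k' > 0" using k k' by auto
  have "real k * ?m (X k) \<le> (real a + 1 - real k) * ?m (X k')" unfolding e using DX pos by (intro mult_left_mono) auto
  also have "\<dots> < real k' * ?m (X k')" unfolding r using tt Xk' by (intro mult_strict_right_mono) auto
  also have "\<dots> \<le> (real a + 1 - real k') * ?m (X k)" unfolding e' using DX pos by (intro mult_left_mono) auto
  also have "\<dots> < real k * ?m (X k)" unfolding r using tt Xk by (intro mult_strict_right_mono) auto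
  finally show False .
qed

text \<open>Here \<open>D k\<close> may conflict with itself, but not its sets containing the coin
  \<open>n + 1\<close>, since these share a point beyond \<open>a + 1\<close>. They conflict only
  with the part of \<open>X k\<close> that avoids the coin, whence the factors \<open>p\<close> and
  \<open>1 - p\<close>.\<close>

lemma X_balanced:
  assumes k: "2 * k = a + t" and ne: "X k \<noteq> {}"
  shows "p * real k \<le> (1 - p) * (real a + 1 - real k)"
proof -
  let ?m = "mu_p (Suc n) p"
  define R where "R = {x \<in> X k. Suc n \<notin> x}"
  define E where "E = {y \<in> D k. Suc n \<in> y}"
  have RL: "R \<subseteq> L" and E: "E \<subseteq> Pow {1..Suc n}" "E \<inter> L = {}"
    using D_basic(1,2)[of k] D_basic(3)[of k] unfolding R_def E_def by blast+
  have nc: "Suc n \<noteq> c" "Suc n \<notin> {1..Suc a}" using an by auto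
  have le: "?m E \<le> ?m R"
  proof (rule opt_compete(1)[OF L RL E])
    fix x y assume xy: "x \<in> E" "y \<in> E"
    hence "\<not> x \<inter> y \<subseteq> {1..Suc a}" using nc unfolding E_def by blast
    thus "t \<le> card (x \<inter> y)" using DD_conflict(2)[of x k y k] xy unfolding E_def by fastforce
  next
    fix x y assume xy: "x \<in> E" "y \<in> L - R"
    hence x: "x \<in> D k" "Suc n \<in> x" by (simp_all add: E_def)
    show "t \<le> card (x \<inter> y)"
    proof (rule ccontr)
      assume "\<not> t \<le> card (x \<inter> y)"
      hence y: "y \<in> X (card (y \<inter> {1..a}))" "k + card (y \<inter> {1..a}) = a + t" "x \<inter> y \<subseteq> {1..a}"
        using D_conflict[OF x(1), of y] xy by auto
      hence "card (y \<inter> {1..a}) = k" using k by linarith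
      moreover have "Suc n \<notin> y" using y(3) x nc by auto
      ultimately show False using xy y by (simp add: R_def)
    qed
  qed
  have sn: "{1..n} \<subseteq> {1..Suc n}" "{1..Suc n} = insert (Suc n) {1..n}" by auto
  have sub: "insert (Suc n) z \<subseteq> {1..Suc n}" "z \<subseteq> {1..Suc n}" if "z \<subseteq> {1..n}" for z
    using that unfolding sn(2) by blast+
  have ia: "insert (Suc n) z \<inter> {1..a} = z \<inter> {1..a}" for z using an by auto
  have irrX: "insert (Suc n) z \<in> X k \<longleftrightarrow> z \<in> X k" if z: "z \<subseteq> {1..n}" for z
  proof -
    have "insert c (insert (Suc n) z - {j}) \<in> L \<longleftrightarrow> insert c (z - {j}) \<in> L" if j: "j \<in> {1..a}" for j
    proof -
      have "Suc n \<noteq> j" using j an by auto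
      hence "insert c (insert (Suc n) z - {j}) = insert (Suc n) (insert c (z - {j}))" by blast
      moreover have "c \<in> {1..n}" using an by simp
      hence "insert c (z - {j}) \<subseteq> {1..n}" using z by blast
      ultimately show ?thesis using irr[of "insert c (z - {j})"] by simp
    qed
    hence e: "(\<exists>j\<in>z \<inter> {1..a}. insert c (insert (Suc n) z - {j}) \<notin> L) \<longleftrightarrow> (\<exists>j\<in>z \<inter> {1..a}. insert c (z - {j}) \<notin> L)"
      by blast
    have "c \<notin> insert (Suc n) z \<longleftrightarrow> c \<notin> z" using nc(1) by blast
    thus ?thesis unfolding X_def mem_Collect_eq ia irr[OF z] e by simp
  qed
  have irrD: "insert (Suc n) z \<in> D k \<longleftrightarrow> z \<in> D k" if z: "z \<subseteq> {1..n}" for z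
  proof -
    have "insert j (insert (Suc n) z - {c}) \<in> L \<longleftrightarrow> insert j (z - {c}) \<in> L" if j: "j \<in> {1..a}" for j
    proof -
      have "insert j (insert (Suc n) z - {c}) = insert (Suc n) (insert j (z - {c}))" using nc(1) by blast
      moreover have "j \<in> {1..n}" using j an by simp
      hence "insert j (z - {c}) \<subseteq> {1..n}" using z by blast
      ultimately show ?thesis using irr[of "insert j (z - {c})"] by simp
    qed
    hence e: "(\<exists>j\<in>{1..a} - z. insert j (insert (Suc n) z - {c}) \<in> L) \<longleftrightarrow> (\<exists>j\<in>{1..a} - z. insert j (z - {c}) \<in> L)"
      by blast
    have d: "{1..a} - insert (Suc n) z = {1..a} - z" using an by auto
    have "c \<in> insert (Suc n) z \<longleftrightarrow> c \<in> z" using nc(1) by blast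
    thus ?thesis unfolding D_def mem_Collect_eq ia irr[OF z] d e using sub[OF z] by simp
  qed
  have mR: "?m R = (1 - p) * ?m (X k)"
    using irrX X_sub unfolding R_def by (intro mu_irrelevant(1)) blast+
  have mE: "?m E = p * ?m (D k)"
    using irrD unfolding E_def by (intro mu_irrelevant(2)[OF D_basic(1)])
  have k1: "1 \<le> k" "k \<le> a" using ne X_bounds by blast+
  have Xk: "?m (X k) > 0" by (rule mu_pos[OF finite_XD(1) ne])
  have e: "real k * ?m (X k) = (real a + 1 - real k) * ?m (D k)" by (rule double_count)
  have "p * ?m (D k) \<le> (1 - p) * ?m (X k)" using le unfolding mR mE .
  hence "(real a + 1 - real k) * (p * ?m (D k)) \<le> (real a + 1 - real k) * ((1 - p) * ?m (X k))"
    using k1 by (intro mult_left_mono) auto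
  hence "p * real k * ?m (X k) \<le> (1 - p) * (real a + 1 - real k) * ?m (X k)"
    using e by (simp add: algebra_simps)
  thus ?thesis using Xk by simp
qed

text \<open>A surviving obstruction is balanced, with \<open>k = t + b\<close>. The inequality
  bounds \<open>p\<close> by \<open>(b + 1) / (t + 2 * b + 1)\<close>, the upper end of the
  classical range for a set \<open>T\<close> of \<open>t + 2 * b\<close> points.\<close>

lemma push_pull: "symm (Suc a) L \<or> (\<exists>b. a = t + 2 * b \<and> p * (real t + 2 * real b + 1) \<le> real b + 1)"
proof (cases "\<exists>k. X k \<noteq> {}")
  case True
  then obtain k where ne: "X k \<noteq> {}" by blast
  hence k: "2 * k = a + t" using X_unbalanced by blast
  have ka: "k \<le> a" using ne X_bounds by blast
  define b where "b = k - t"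
  have b: "k = t + b" "a = t + 2 * b" using k ka by (auto simp: b_def)
  have "p * (real t + real b) \<le> (1 - p) * (real b + 1)" using X_balanced[OF k ne] b by simp
  hence "p * (real t + 2 * real b + 1) \<le> real b + 1" by (simp add: algebra_simps)
  thus ?thesis using b by blast
next
  case False
  have push: "insert c (x - {j}) \<in> L" if "x \<in> L" "c \<notin> x" "j \<in> x \<inter> {1..a}" for x j
  proof (rule ccontr)
    assume "insert c (x - {j}) \<notin> L"
    hence "x \<in> X (card (x \<inter> {1..a}))" using that unfolding X_def by blast
    thus False using False by blast
  qed
  have "symm (Suc a) L" unfolding symm_def
  proof (intro allI impI)
    fix i j x assume a: "i \<in> {1..Suc a}" "j \<in> {1..Suc a}" "x \<in> L" "i \<in> x" "j \<notin> x"
    hence ij: "i \<noteq> j" by blast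
    consider "i \<in> {1..a}" "j \<in> {1..a}" | "i = c" "j \<in> {1..a}" | "i \<in> {1..a}" "j = c"
      using a(1,2) ij by (auto simp: atLeastAtMostSuc_conv)
    thus "insert j (x - {i}) \<in> L"
    proof cases
      case 1 thus ?thesis using symD a by blast
    next
      case 2 thus ?thesis using compD[of j i x] a an by simp
    next
      case 3 thus ?thesis using push[of x i] a by blast
    qed
  qed
  thus ?thesis ..
qed

end

section \<open>From symmetric families to threshold families\<close>

context biased begin

text \<open>A set \<open>y\<close> of the layer that meets \<open>x\<close> least covers the
  complement of \<open>x\<close>: otherwise a common point could be swapped for one outside both.
  Hence \<open>card x + k = n + card (x \<inter> y)\<close>.\<close>

lemma overlap_bound:
  assumes G: "opt n G" and K: "K \<subseteq> G" "K \<noteq> {}" and ck: "\<And>y. y \<in> K \<Longrightarrow> card y = k"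
    and swap: "\<And>y e f. y \<in> K \<Longrightarrow> e \<in> y \<Longrightarrow> f \<in> {1..n} - y \<Longrightarrow> insert f (y - {e}) \<in> K"
    and x: "x \<in> G"
  shows "n + t \<le> card x + k"
proof -
  obtain y where y: "y \<in> K" and m: "\<And>z. z \<in> K \<Longrightarrow> card (x \<inter> y) \<le> card (x \<inter> z)"
    using K exists_least_iff[of "\<lambda>k. \<exists>z\<in>K. card (x \<inter> z) = k"] by (metis all_not_in_conv not_less)
  have ys: "y \<subseteq> {1..n}" "x \<subseteq> {1..n}" using opt_sub[OF G] y x K by blast+
  have fin: "finite x" "finite y" using ys finite_subset by blast+
  have tc: "t \<le> card (x \<inter> y)" using intersecting_D[OF opt_int[OF G] x] y K by blast
  hence "card (x \<inter> y) > 0" using t1 by linarith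
  then obtain e where e: "e \<in> x \<inter> y" by (auto simp: card_gt_0_iff)
  have "x \<union> y = {1..n}"
  proof (rule ccontr)
    assume "x \<union> y \<noteq> {1..n}"
    then obtain f where f: "f \<in> {1..n}" "f \<notin> x" "f \<notin> y" using ys by blast
    have "insert f (y - {e}) \<in> K" by (rule swap[OF y]) (use e f in auto)
    hence "card (x \<inter> y) \<le> card (x \<inter> insert f (y - {e}))" by (rule m)
    also have "x \<inter> insert f (y - {e}) = x \<inter> y - {e}" using f by blast
    also have "card (x \<inter> y - {e}) < card (x \<inter> y)" using e fin by (intro card_Diff1_less) auto
    finally show False by simp
  qed
  moreover have "card x + card y = card (x \<union> y) + card (x \<inter> y)" by (rule card_Un_Int[OF fin])
  ultimately show ?thesis using tc ck[OF y] by simp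
qed

lemma thr_full_frankl:
  assumes G: "opt n G" and n: "n = t + 2 * r" "2 \<le> t \<or> r = 0" and ge: "\<And>x. x \<in> G \<Longrightarrow> t + r \<le> card x"
  shows "frankl n G"
proof -
  have "G \<subseteq> thr n {1..n} (t + r)"
  proof
    fix x assume x: "x \<in> G"
    have xs: "x \<subseteq> {1..n}" by (rule opt_sub[OF G x])
    hence "x \<inter> {1..n} = x" by blast
    thus "x \<in> thr n {1..n} (t + r)" using ge[OF x] xs unfolding thr_def by simp
  qed
  moreover have "intersecting n t (thr n {1..n} (t + r))" by (rule thr_intersecting) (use n in auto)
  ultimately have "G = thr n {1..n} (t + r)" by (intro opt_eq[OF G]) auto
  thus ?thesis unfolding frankl_def using n by (intro exI[of _ "{1..n}"] exI[of _ r]) auto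
qed

text \<open>Exchange the \<open>(t + r)\<close>-subsets of \<open>T\<close> for the sets \<open>z + i + j\<close> with \<open>|z| = t + r - 1\<close>, where \<open>i\<close>, \<open>j\<close> are the
two points outside \<open>T\<close>.\<close>

lemma frankl_half:
  assumes p: "p = 1/2" and t2: "2 \<le> t" and T: "T \<subseteq> {1..n}" "card T = t + 2 * r" and n: "n = t + 2 * r + 2"
  shows "\<not> opt n (thr n T (t + r))"
proof
  assume G: "opt n (thr n T (t + r))" (is "opt n ?G")
  have finT: "finite T" using T finite_subset by blast
  have "card ({1..n} - T) = 2" using T n finT by (simp add: card_Diff_subset)
  then obtain i j where ij: "{1..n} - T = {i, j}" "i \<noteq> j" by (auto simp: card_2_iff)
  have ijT: "i \<notin> T" "j \<notin> T" "i \<in> {1..n}" "j \<in> {1..n}" using ij(1) by blast+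
  define R where "R = {x. x \<subseteq> T \<and> card x = t + r}"
  define Z where "Z = {z. z \<subseteq> T \<and> card z = t + r - 1}"
  define D where "D = (\<lambda>z. insert i (insert j z)) ` Z"
  have mu: "mu_p n p F = (1/2) ^ n * card F" if "F \<subseteq> Pow {1..n}" for F
  proof -
    have "mu_p n p F = (\<Sum>A\<in>F. (1/2) ^ n)" unfolding mu_p_def
    proof (rule sum.cong)
      fix A assume "A \<in> F"
      hence "card A \<le> card {1..n}" using that by (intro card_mono) auto
      thus "p ^ card A * (1 - p) ^ (n - card A) = (1/2) ^ n" unfolding p by (simp flip: power_add)
    qed simp
    thus ?thesis by simp
  qed
  have Zi: "i \<notin> z" "j \<notin> z" "finite z" "z \<subseteq> T" "card z = t + r - 1" if "z \<in> Z" for z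
    using that ijT finT by (auto simp: Z_def intro: finite_subset)
  have Rsub: "R \<subseteq> ?G"
  proof
    fix x assume "x \<in> R"
    hence x: "x \<subseteq> T" "card x = t + r" by (auto simp: R_def)
    hence "x \<inter> T = x" by blast
    thus "x \<in> ?G" using x T unfolding thr_def by auto
  qed
  have Dsub: "D \<subseteq> Pow {1..n}" using Zi(4) T(1) ijT unfolding D_def by blast
  have DT: "insert i (insert j z) \<inter> T = z" if "z \<in> Z" for z using Zi[OF that] ijT by blast
  have DG: "D \<inter> ?G = {}"
  proof -
    have "insert i (insert j z) \<notin> ?G" if z: "z \<in> Z" for z
      using Zi(5)[OF z] t1 unfolding thr_def mem_Collect_eq DT[OF z] by linarith
    thus ?thesis unfolding D_def by blast
  qed
  have zy: "card z + card (y \<inter> T) \<le> t + 2 * r + card (z \<inter> y)" if "z \<in> Z" for z y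
  proof -
    have e: "z \<inter> T = z" "z \<inter> y \<inter> T = z \<inter> y" using Zi(4)[OF that] by blast+
    show ?thesis using card_Int_ge[OF finT, of z y] unfolding e T(2) .
  qed
  have "mu_p n p D \<le> mu_p n p R"
  proof (rule opt_compete(1)[OF G Rsub Dsub DG])
    fix x y assume "x \<in> D" "y \<in> D"
    then obtain z w where zw: "z \<in> Z" "w \<in> Z" "x = insert i (insert j z)" "y = insert i (insert j w)"
      by (auto simp: D_def)
    have "w \<inter> T = w" using Zi(4)[OF zw(2)] by blast
    hence "t \<le> card (z \<inter> w) + 2" using zy[OF zw(1), of w] Zi(5)[OF zw(1)] Zi(5)[OF zw(2)] t1 by simp
    also have "\<dots> = card (insert i (insert j (z \<inter> w)))" using Zi[OF zw(1)] ij(2) by simp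
    also have "insert i (insert j (z \<inter> w)) = x \<inter> y" using zw by blast
    finally show "t \<le> card (x \<inter> y)" .
  next
    fix x y assume xy: "x \<in> D" "y \<in> ?G - R"
    then obtain z where z: "z \<in> Z" "x = insert i (insert j z)" by (auto simp: D_def)
    have y: "y \<subseteq> {1..n}" "t + r \<le> card (y \<inter> T)" using xy by (auto simp: thr_def)
    have fx: "finite x" using z Zi(3)[OF z(1)] by simp
    have zle: "card (z \<inter> y) \<le> card (x \<inter> y)" using z fx by (intro card_mono) auto
    show "t \<le> card (x \<inter> y)"
    proof (cases "card (y \<inter> T) = t + r")
      case False
      thus ?thesis using zy[OF z(1), of y] Zi(5)[OF z(1)] y(2) zle t1 by linarith
    next
      case True
      have "\<not> y \<subseteq> T"
      proof
        assume "y \<subseteq> T"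
        hence "y \<in> R" using True by (simp add: R_def Int_absorb2)
        thus False using xy by blast
      qed
      then obtain e where e: "e \<in> y" "e \<in> {i, j}" using y(1) ij(1) by blast
      have "e \<notin> z" using e Zi[OF z(1)] by blast
      hence "card (z \<inter> y) + 1 = card (insert e (z \<inter> y))" using Zi(3)[OF z(1)] by simp
      also have "\<dots> \<le> card (x \<inter> y)" using e z fx by (intro card_mono) auto
      finally show ?thesis using zy[OF z(1), of y] Zi(5)[OF z(1)] True t1 by linarith
    qed
  qed
  moreover have "R \<subseteq> Pow {1..n}" using T by (auto simp: R_def)
  ultimately have le: "card D \<le> card R" using mu[OF Dsub] mu[of R] by simp
  have "inj_on (\<lambda>z. insert i (insert j z)) Z"
    by (rule inj_on_inverseI[of _ "\<lambda>x. x - {i, j}"]) (use Zi in blast)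
  hence "card D = card Z" unfolding D_def by (rule card_image)
  also have "\<dots> = (t + 2 * r) choose (t + r - 1)" unfolding Z_def using n_subsets[OF finT] T by simp
  finally have cD: "card D = (t + 2 * r) choose (t + r - 1)" .
  have cR: "card R = (t + 2 * r) choose (t + r)" unfolding R_def using n_subsets[OF finT] T by simp
  obtain k where k: "t + r = Suc k" using t1 by (metis Suc_le_D add_leD1 le_add1 le_trans One_nat_def)
  have "Suc k * ((t + 2 * r) choose Suc k) = (t + 2 * r - k) * ((t + 2 * r) choose k)"
    by (simp only: binomial_absorb_comp binomial_absorption)
  moreover have "t + 2 * r - k = r + 1" "t + r - 1 = k" using k by linarith+
  \<comment> \<open>So \<open>D\<close> outnumbers \<open>R\<close> by the factor
    \<open>(t + r) / (r + 1)\<close>, which exceeds 1 for \<open>2 \<le> t\<close>.\<close>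
  ultimately have e: "(t + r) * card R = (r + 1) * card D" unfolding cD cR k by simp
  have "card D > 0" unfolding cD by (rule zero_less_binomial) simp
  hence "(r + 1) * card D < (t + r) * card D" using t2 by (intro mult_strict_right_mono) auto
  also have "\<dots> \<le> (t + r) * card R" using le by simp
  finally show False using e by simp
qed

lemma symm_reach:
  assumes s: "symm a G" and u: "u \<in> G" and fin: "finite x" "finite u"
    and out: "x - {1..a} = u - {1..a}" and c: "card x = card u"
  shows "x \<in> G"
  using u fin out c
proof (induction "card (x - u)" arbitrary: u rule: less_induct)
  case less
  show ?case
  proof (cases "x \<subseteq> u")
    case True
    hence "x = u" using less.prems card_subset_eq by metis
    thus ?thesis using less.prems by simp
  next
    case False
    then obtain f where f: "f \<in> x" "f \<notin> u" by blast
    have "\<not> u \<subseteq> x" using f less.prems card_subset_eq[of x u] by metis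
    then obtain e where e: "e \<in> u" "e \<notin> x" by blast
    have ef: "e \<in> {1..a}" "f \<in> {1..a}" using e f less.prems(4) by blast+
    have "insert f (u - {e}) \<in> G" using s less.prems(1) e f ef unfolding symm_def by blast
    moreover have "card (x - insert f (u - {e})) < card (x - u)"
      using less.prems e f by (intro psubset_card_mono) auto
    moreover have "x - {1..a} = insert f (u - {e}) - {1..a}" using less.prems(4) ef by blast
    moreover have "card x = card (insert f (u - {e}))" using less.prems e f card_Suc_Diff1[of u e] by simp
    ultimately show ?thesis using less.hyps[of "insert f (u - {e})"] less.prems by simp
  qed
qed

text \<open>Without a conflict, maximality would put \<open>z\<close> itself into \<open>G\<close>;
  and a conflicting member contains the last point and leaves \<open>G\<close> without it.\<close>

lemma bd_partner:
  assumes G: "opt (Suc n) G" and S: "shifted (Suc n) G" and z: "z \<in> bd n G"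
  obtains w where "w \<in> bd n G" "card (z \<inter> w) < t"
proof -
  note zD = bd_D[OF z]
  have i: "t \<le> card (insert (Suc n) z \<inter> y)" if "y \<in> G" for y
    by (rule intersecting_D[OF opt_int[OF G] zD(4) that])
  have zs: "z \<subseteq> {1..Suc n}" using zD(1) by auto
  have "\<exists>y\<in>G. card (z \<inter> y) < t"
  proof (rule ccontr)
    assume "\<not> ?thesis"
    hence a: "t \<le> card (z \<inter> y)" if "y \<in> G" for y using that by (simp add: not_less)
    have "t \<le> card z" using a[OF zD(4)] by (simp add: Int_absorb2 subset_insertI)
    thus False using opt_maximal[OF G zs _ a] zD(5) by blast
  qed
  then obtain y where y: "y \<in> G" "card (z \<inter> y) < t" by blast
  define w where "w = y - {Suc n}"
  have zw: "z \<inter> y = z \<inter> w" using zD(3) by (auto simp: w_def)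
  have Ny: "Suc n \<in> y"
  proof (rule ccontr)
    assume "Suc n \<notin> y"
    hence "insert (Suc n) z \<inter> y = z \<inter> y" by blast
    thus False using i[OF y(1)] y(2) by simp
  qed
  have "w \<notin> G"
  proof
    assume "w \<in> G"
    moreover have "insert (Suc n) z \<inter> w = z \<inter> w" by (auto simp: w_def)
    ultimately show False using i[of w] y(2) zw by simp
  qed
  moreover have "insert (Suc n) w = y" using Ny by (auto simp: w_def)
  moreover have "w \<subseteq> {1..n}" using opt_sub[OF G y(1)] by (auto simp: w_def subset_iff le_Suc_eq)
  ultimately have "w \<in> bd n G" using y by (simp add: bd_def)
  thus ?thesis using that y zw by simp
qed

lemma lift_mem: "z \<subseteq> {1..n} \<Longrightarrow> z \<in> lift n G \<longleftrightarrow> z \<in> G"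
proof -
  assume z: "z \<subseteq> {1..n}"
  hence "z \<inter> {1..n} = z" "z \<subseteq> {1..Suc n}" by auto
  thus ?thesis by (simp add: lift_def)
qed

lemma lift_irr: "z \<subseteq> {1..n} \<Longrightarrow> insert (Suc n) z \<in> lift n G \<longleftrightarrow> z \<in> lift n G"
proof -
  assume z: "z \<subseteq> {1..n}"
  hence "insert (Suc n) z \<inter> {1..n} = z \<inter> {1..n}" by auto
  moreover have "insert (Suc n) z \<subseteq> {1..Suc n}" "z \<subseteq> {1..Suc n}" using z by auto
  ultimately show ?thesis by (simp add: lift_def)
qed

lemma shifted_compressed: "shifted n G \<Longrightarrow> compressed n G"
  unfolding compressed_def using shiftedD by blast

lemma lift_compressed:
  assumes G: "opt n G" and c: "compressed n G"
  shows "compressed (Suc n) (lift n G)"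
  unfolding compressed_def
proof (intro allI impI)
  fix j k x assume a: "1 \<le> j" "j < k" "k \<le> Suc n" "x \<in> lift n G" "k \<in> x" "j \<notin> x"
  have x: "x \<subseteq> {1..Suc n}" "x \<inter> {1..n} \<in> G" using a(4) by (simp_all add: lift_def)
  have jn: "j \<in> {1..n}" using a by simp
  have sub: "insert j (x - {k}) \<subseteq> {1..Suc n}" using x jn by auto
  have "insert j (x - {k}) \<inter> {1..n} \<in> G"
  proof (cases "k \<le> n")
    case True
    have "insert j (x \<inter> {1..n} - {k}) \<in> G"
      using c a True x jn unfolding compressed_def by simp
    moreover have "insert j (x - {k}) \<inter> {1..n} = insert j (x \<inter> {1..n} - {k})" using jn by blast
    ultimately show ?thesis by simp
  next
    case False
    hence "k = Suc n" using a by simp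
    hence "x \<inter> {1..n} \<subseteq> insert j (x - {k}) \<inter> {1..n}" by auto
    thus ?thesis using opt_up[OF G x(2)] by blast
  qed
  thus "insert j (x - {k}) \<in> lift n G" using sub unfolding lift_def by blast
qed

text \<open>The symmetry grows point by point inside the lift, whose last point is the coin, until
  it reaches \<open>n\<close> or stops at some \<open>t + 2 * b\<close>. Only points up to
  \<open>n\<close> are moved, so it passes back to \<open>G\<close>.\<close>

lemma symm_push:
  assumes t2: "2 \<le> t" and G: "opt n G" and S: "shifted n G" and L: "opt (Suc n) (lift n G)"
  shows "symm n G \<or> (\<exists>b. t + 2 * b < n \<and> symm (t + 2 * b) G \<and> p * (real t + 2 * real b + 1) \<le> real b + 1)"
proof (rule ccontr)
  assume no: "\<not> ?thesis"
  have sG: "symm a G" if "symm a (lift n G)" "a \<le> n" for a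
    unfolding symm_def
  proof (intro allI impI)
    fix i j x assume a: "i \<in> {1..a}" "j \<in> {1..a}" "x \<in> G" "i \<in> x" "j \<notin> x"
    have xs: "x \<subseteq> {1..n}" by (rule opt_sub[OF G a(3)])
    have "insert j (x - {i}) \<in> lift n G"
      using that(1) a lift_mem[OF xs] unfolding symm_def by blast
    moreover have "insert j (x - {i}) \<subseteq> {1..n}" using xs a(2) that(2) by auto
    ultimately show "insert j (x - {i}) \<in> G" using lift_mem by blast
  qed
  have "a \<le> n \<Longrightarrow> symm a (lift n G)" for a
  proof (induction a)
    case 0 thus ?case by (simp add: symm_def)
  next
    case (Suc a)
    hence an: "a < n" and sa: "symm a (lift n G)" by auto
    interpret pushing t p n a "lift n G"
      using t2 an L lift_compressed[OF G shifted_compressed[OF S]] sa lift_irr by unfold_locales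
    show ?case
    proof (rule ccontr)
      assume "\<not> symm (Suc a) (lift n G)"
      then obtain b where "a = t + 2 * b" "p * (real t + 2 * real b + 1) \<le> real b + 1" using push_pull by blast
      thus False using no an sG[OF sa] by auto
    qed
  qed
  thus False using no sG by blast
qed

text \<open>Only \<open>n\<close> and \<open>n + 1\<close> lie outside the range of the symmetry, so
  it spreads \<open>u\<close> over all sets of its size containing both. Shiftedness then trades
  these two points for smaller ones.\<close>

lemma top_layer_in:
  assumes G: "opt (Suc n) G" and S: "shifted (Suc n) G" and n: "Suc n = t + 2 * Suc b"
    and sy: "symm (t + 2 * b) G" and u: "u \<in> G" "n \<in> u" "Suc n \<in> u" "card u = t + Suc b"
    and x: "x \<subseteq> {1..Suc n}" "card x = t + Suc b"
  shows "x \<in> G"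
proof -
  have a: "n = Suc (t + 2 * b)" using n by simp
  have us: "u \<subseteq> {1..Suc n}" by (rule opt_sub[OF G u(1)])
  have out: "v - {1..t + 2 * b} \<subseteq> {n, Suc n}" if "v \<subseteq> {1..Suc n}" for v
  proof
    fix i assume "i \<in> v - {1..t + 2 * b}"
    hence "1 \<le> i" "i \<le> Suc n" "\<not> i \<le> t + 2 * b" using that by auto
    thus "i \<in> {n, Suc n}" unfolding a by auto
  qed
  have both: "v \<in> G" if v: "v \<subseteq> {1..Suc n}" "card v = t + Suc b" "n \<in> v" "Suc n \<in> v" for v
  proof (rule symm_reach[OF sy u(1)])
    have nn: "n \<notin> {1..t + 2 * b}" "Suc n \<notin> {1..t + 2 * b}" unfolding a by auto
    have "w - {1..t + 2 * b} = {n, Suc n}" if w: "w \<subseteq> {1..Suc n}" "n \<in> w" "Suc n \<in> w" for w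
      using out[OF w(1)] w(2,3) nn by blast
    thus "v - {1..t + 2 * b} = u - {1..t + 2 * b}" using v us u by simp
  qed (use v us u in \<open>auto intro: finite_subset\<close>)
  have ge: "v \<in> G" if v: "v \<subseteq> {1..Suc n}" "card v = t + Suc b" for v
    using v
  proof (induction "card (v \<inter> {1..t + 2 * b})" arbitrary: v rule: less_induct)
    case less
    have fv: "finite v" using less.prems finite_subset by blast
    show ?case
    proof (cases "n \<in> v \<and> Suc n \<in> v")
      case False
      then obtain e where e: "e \<in> {n, Suc n}" "e \<notin> v" by blast
      have "v \<inter> {1..t + 2 * b} \<noteq> {}"
      proof
        assume "v \<inter> {1..t + 2 * b} = {}"
        hence "v \<subseteq> {n, Suc n} - {e}" using out[OF less.prems(1)] e by blast
        hence "card v \<le> card ({n, Suc n} - {e})" by (intro card_mono) auto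
        also have "\<dots> = 1" using e by auto
        finally show False using less.prems(2) t1 by simp
      qed
      then obtain i where i: "i \<in> v" "1 \<le> i" "i \<le> t + 2 * b" by auto
      let ?v = "insert e (v - {i})"
      have "?v \<in> G"
      proof (rule less.hyps)
        have "?v \<inter> {1..t + 2 * b} = v \<inter> {1..t + 2 * b} - {i}" using e unfolding a by auto
        thus "card (?v \<inter> {1..t + 2 * b}) < card (v \<inter> {1..t + 2 * b})"
          using fv i by (simp only:) (intro card_Diff1_less, auto)
        show "?v \<subseteq> {1..Suc n}" using less.prems e unfolding a by auto
        show "card ?v = t + Suc b" using less.prems e fv i card_Suc_Diff1[of v i] by simp
      qed
      moreover have "insert i (?v - {e}) = v" using e i by auto
      moreover have "insert i (?v - {e}) \<in> G"
        by (rule shiftedD[OF S]) (use calculation(1) i e a in auto)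
      ultimately show ?thesis by simp
    qed (use both less.prems in blast)
  qed
  show ?thesis by (rule ge[OF x])
qed

lemma franklE:
  assumes "frankl n G"
  obtains T r where "T \<subseteq> {1..n}" "card T = t + 2 * r" "2 \<le> t \<or> r = 0" "p = 1/2 \<Longrightarrow> n \<le> t + 2 * r + 1"
    "G = thr n T (t + r)"
  using assms unfolding frankl_def by blast

text \<open>With an empty boundary the last point is irrelevant and \<open>IH\<close> applies. A
  nonempty boundary is contradictory for even \<open>n + t\<close>; for odd \<open>n + t\<close> a
  lower bound on the sizes of members makes \<open>G\<close> the threshold family of all
  \<open>n + 1\<close> points.\<close>

lemma shifted_frankl:
  assumes pt: "p < 1/2 \<or> 2 \<le> t" and tn: "t \<le> n"
    and IH: "\<And>H. opt n H \<Longrightarrow> frankl n H" and G: "opt (Suc n) G" and S: "shifted (Suc n) G"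
  shows "frankl (Suc n) G"
proof (cases "bd n G = {}")
  case True
  have irr: "z \<in> G" if "z \<subseteq> {1..n}" "insert (Suc n) z \<in> G" for z using True that unfolding bd_def by blast
  have I: "opt n (G \<inter> Pow {1..n})" "G = lift n (G \<inter> Pow {1..n})"
    by (rule opt_irrelevant[OF G irr]; assumption)+
  obtain T r where T: "T \<subseteq> {1..n}" "card T = t + 2 * r" "2 \<le> t \<or> r = 0" "p = 1/2 \<Longrightarrow> n \<le> t + 2 * r + 1"
    and e: "G \<inter> Pow {1..n} = thr n T (t + r)" by (rule franklE[OF IH[OF I(1)]]) (rule that)
  have TS: "T \<subseteq> {1..Suc n}" using T(1) by auto
  have "lift n (thr n T (t + r)) = thr (Suc n) T (t + r)"
  proof -
    have "A \<inter> {1..n} \<inter> T = A \<inter> T" for A using T(1) by blast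
    thus ?thesis by (simp add: lift_def thr_def)
  qed
  hence Ge: "G = thr (Suc n) T (t + r)" using I(2) e by simp
  moreover have "p = 1/2 \<longrightarrow> Suc n \<le> t + 2 * r + 1"
  proof (intro impI, rule ccontr)
    assume "p = 1/2" "\<not> Suc n \<le> t + 2 * r + 1"
    hence "Suc n = t + 2 * r + 2" "p = 1/2" "2 \<le> t" using T(4) pt by auto
    thus False using frankl_half[of T "Suc n" r] TS T(2) G Ge by simp
  qed
  ultimately show ?thesis unfolding frankl_def using TS T by blast
next
  case ne: False
  show ?thesis
  proof (cases "even (n + t)")
    case ev: True
    have mid: "mid n G = {}"
    proof -
      have "False" if "2 * card z + 1 = n + t" for z :: "nat set" using ev that by presburger
      thus ?thesis by (auto simp: mid_def)
    qed
    have ph: "p = 1/2"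
      using big_small_empty[OF G S tn] ne bd_parts[of n G] mid p2 by fastforce
    have eq: "(1 - p) * mu_p n p (big n G) = p * mu_p n p (small n G)"
      "(1 - p) * mu_p n p (small n G) = p * mu_p n p (big n G)"
      using big_small(1,2)[OF G S tn] unfolding ph by simp_all
    \<comment> \<open>Either exchange empties the boundary, so \<open>IH\<close> applies, and parity
      leaves only \<open>T = {1..n}\<close>. Both exchanged families then have the same trace on
      \<open>{1..n}\<close>, although each boundary set is added in exactly one of them.\<close>
    have full: "((G - insert (Suc n) ` B) \<union> A) \<inter> Pow {1..n} = thr n {1..n} ((n + t) div 2)"
      if K: "opt (Suc n) ((G - insert (Suc n) ` B) \<union> A)" and A: "bd n G = A \<union> B" for A B
    proof -
      let ?K = "(G - insert (Suc n) ` B) \<union> A"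
      have I: "opt n (?K \<inter> Pow {1..n})" by (rule opt_irrelevant(1)[OF K swapped_irrelevant[OF A]])
      obtain T r where T: "T \<subseteq> {1..n}" "card T = t + 2 * r" "n \<le> t + 2 * r + 1"
        and e: "?K \<inter> Pow {1..n} = thr n T (t + r)"
        by (rule franklE[OF IH[OF I]]) (rule that, assumption, assumption, use ph in blast, assumption)
      have "card T \<le> n" using card_mono[OF _ T(1)] by simp
      hence n: "n = t + 2 * r" using T(2,3) ev by presburger
      hence "T = {1..n}" using T by (intro card_subset_eq) auto
      moreover have "(n + t) div 2 = t + r" using n by simp
      ultimately show ?thesis using e by simp
    qed
    have bp: "bd n G = big n G \<union> small n G" "bd n G = small n G \<union> big n G" using bd_parts[of n G] mid by blast+
    note f = full[OF big_small(3)[OF G S tn eq(1)] bp(1)] full[OF big_small(4)[OF G S tn eq(2)] bp(2)]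
    have d: "z \<notin> G" "z \<subseteq> {1..n}" if "z \<in> bd n G" for z using bd_D(1,5)[OF that] by auto
    have dj: "z \<notin> small n G" if "z \<in> big n G" for z using that by (simp add: big_def small_def)
    have "z \<notin> bd n G" for z
    proof
      assume z: "z \<in> bd n G"
      hence zi: "z \<in> big n G \<union> small n G" using bp(1) by simp
      hence m: "z \<in> thr n {1..n} ((n + t) div 2)"
        using d[OF z] f by (metis IntI PowI Un_iff)
      have "z \<in> (G - insert (Suc n) ` small n G) \<union> big n G" "z \<in> (G - insert (Suc n) ` big n G) \<union> small n G"
        using IntD1[OF m[folded f(1)]] IntD1[OF m[folded f(2)]] by (simp_all only:)
      thus False using d(1)[OF z] dj by blast
    qed
    thus ?thesis using ne by blast
  next
    case False
    define r where "r = (Suc n - t) div 2"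
    have r: "Suc n = t + 2 * r" using False tn unfolding r_def by presburger
    have t2: "2 \<le> t"
    proof (rule ccontr)
      assume "\<not> 2 \<le> t"
      hence t: "t = 1" "p < 1/2" using t1 pt by auto
      have "mid n G \<noteq> {}" using ne bd_parts[of n G] big_small_empty[OF G S tn t(2)] by simp
      hence "real r \<le> p * (2 * real r)" using mid_bound[OF G S tn r] t by simp
      hence "real r * (1 - 2 * p) \<le> 0" by (simp add: algebra_simps)
      hence "r = 0" using t by (simp add: mult_le_0_iff)
      thus False using r tn by simp
    qed
    have L: "opt (Suc (Suc n)) (lift (Suc n) G)" by (rule odd_irrelevant[OF _ _ G]) (use tn r in auto)
    have ge: "frankl (Suc n) G" if "\<And>x. x \<in> G \<Longrightarrow> t + r \<le> card x"
      by (rule thr_full_frankl[OF G r]) (use t2 that in auto)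
    from symm_push[OF t2 G S L] show ?thesis
    proof (elim disjE exE conjE)
      assume sy: "symm (Suc n) G"
      show ?thesis
      proof (rule ge)
        fix x assume x: "x \<in> G"
        have "Suc n + t \<le> card x + card x"
        proof (rule overlap_bound[OF G, of "{y\<in>G. card y = card x}"])
          fix y e f assume y: "y \<in> {y\<in>G. card y = card x}" and e: "e \<in> y" "f \<in> {1..Suc n} - y"
          have ys: "y \<subseteq> {1..Suc n}" using opt_sub[OF G] y by blast
          hence "insert f (y - {e}) \<in> G" using sy y e unfolding symm_def by blast
          moreover have "finite y" using ys finite_subset by blast
          hence "card (insert f (y - {e})) = card y" using e card_Suc_Diff1[of y e] by simp
          ultimately show "insert f (y - {e}) \<in> {y\<in>G. card y = card x}" using y by simp
        qed (use x in auto)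
        thus "t + r \<le> card x" using r by simp
      qed
    next
      fix b assume b: "t + 2 * b < Suc n" "symm (t + 2 * b) G" "p * (real t + 2 * real b + 1) \<le> real b + 1"
      have pl: "p < 1/2"
      proof (rule ccontr)
        assume "\<not> p < 1/2"
        hence ph: "p = 1/2" using p2 by simp
        show False using b(3) t2 unfolding ph by simp
      qed
      have mid: "bd n G = mid n G" using bd_parts[of n G] big_small_empty[OF G S tn pl] by simp
      have "real r \<le> p * (real t + 2 * real r - 1)" using mid_bound[OF G S tn r] ne mid by simp
      \<comment> \<open>Both ends of the range are compared with \<open>p * (t - 1)\<close>: the
        middle sets bound it below by \<open>r * (1 - 2 * p)\<close>, the obstruction bounds it
        above by \<open>(b + 1) * (1 - 2 * p)\<close>. So only two points lie beyond the symmetric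
        range.\<close>
      hence "real r * (1 - 2 * p) \<le> (real b + 1) * (1 - 2 * p)" using b(3) by (simp add: algebra_simps)
      hence "real r \<le> real b + 1" using pl by simp
      hence rb: "r = Suc b" using b(1) r by linarith
      obtain z0 where z0: "z0 \<in> bd n G" using ne by blast
      obtain w0 where w0: "w0 \<in> bd n G" "card (z0 \<inter> w0) < t" using bd_partner[OF G S z0] by blast
      have "n \<in> z0 \<union> w0" using bd_conflict(1)[OF G S z0 w0] tn t1 by simp
      then obtain z where z: "z \<in> bd n G" "n \<in> z" using z0 w0 by blast
      note zD = bd_D[OF z(1)]
      have "z \<in> mid n G" using z(1) unfolding mid .
      hence "2 * card z + 1 = n + t" by (simp add: mid_def)
      hence cz: "card (insert (Suc n) z) = t + Suc b" using zD r rb by simp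
      have all: "x \<in> G" if "x \<subseteq> {1..Suc n}" "card x = t + Suc b" for x
        by (rule top_layer_in[OF G S r[unfolded rb] b(2) zD(4) _ _ cz that]) (use z in auto)
      show ?thesis
      proof (rule ge)
        fix x assume x: "x \<in> G"
        let ?K = "{y. y \<subseteq> {1..Suc n} \<and> card y = t + Suc b}"
        have "Suc n + t \<le> card x + (t + Suc b)"
        proof (rule overlap_bound[OF G, of ?K])
          show "?K \<subseteq> G" using all by blast
          show "?K \<noteq> {}" using cz opt_sub[OF G zD(4)] by blast
          fix y e f assume y: "y \<in> ?K" and e: "e \<in> y" "f \<in> {1..Suc n} - y"
          have "finite y" using y finite_subset by blast
          hence "card (insert f (y - {e})) = card y" using e card_Suc_Diff1[of y e] by simp
          moreover have "insert f (y - {e}) \<subseteq> {1..Suc n}" using y e by blast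
          ultimately show "insert f (y - {e}) \<in> ?K" using y by simp
        qed (use x in auto)
        thus "t + r \<le> card x" using r rb by simp
      qed
    qed
  qed
qed

text \<open>The inner induction is there because uniqueness, unlike the maximal measure, has to be
  carried back through every single shift.\<close>

theorem opt_is_frankl:
  assumes pt: "p < 1/2 \<or> 2 \<le> t"
  shows "t \<le> n \<Longrightarrow> opt n G \<Longrightarrow> frankl n G"
proof (induction n arbitrary: G rule: less_induct)
  case (less n)
  have base: "frankl n H" if H: "opt n H" "shifted n H" for H
  proof (cases "n = t")
    case True
    have "x = {1..n}" if "x \<in> H" for x
    proof (rule card_seteq)
      show "x \<subseteq> {1..n}" by (rule opt_sub[OF H(1) that])
      show "card {1..n} \<le> card x" using intersecting_D[OF opt_int[OF H(1)] that that] True by simp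
    qed simp
    thus ?thesis using thr_full_frankl[OF H(1), of 0] True by fastforce
  next
    case False
    then obtain k where k: "n = Suc k" "t \<le> k" using less.prems(1) by (cases n) auto
    show ?thesis unfolding k(1)
      by (rule shifted_frankl[OF pt k(2)]) (use less.IH k H in auto)
  qed
  show ?case using less.prems(2)
  proof (induction "\<Sum>A\<in>G. \<Sum>A" arbitrary: G rule: less_induct)
    case (less G)
    show ?case
    proof (cases "shifted n G")
      case False
      then obtain j k where jk: "1 \<le> j" "j < k" "k \<le> n" "shift j k G \<noteq> G" unfolding shifted_def by blast
      have m: "j \<in> {1..n}" "k \<in> {1..n}" "j \<noteq> k" using jk by auto
      have "G \<subseteq> Pow {1..n}" using opt_sub[OF less.prems] by blast
      hence "frankl n (shift j k G)"
        using shift_potential[of G n j k] jk by (intro less.hyps opt_shift[OF less.prems m]) auto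
      thus ?thesis by (rule frankl_unshift[OF less.prems _ m])
    qed (rule base[OF less.prems])
  qed
qed

end

section \<open>Agreement on the circle\<close>

locale circle =
  fixes m s :: nat
  assumes s1: "1 \<le> s" and sm: "2 * s \<le> m"
begin

abbreviation Z :: "int set" where "Z \<equiv> {0..<int m}"

definition far :: "int \<Rightarrow> int \<Rightarrow> bool" where
  "far a b \<longleftrightarrow> int s \<le> (a - b) mod int m \<and> (a - b) mod int m \<le> int m - int s"

definition win :: "int \<Rightarrow> int \<Rightarrow> bool" where
  "win y a \<longleftrightarrow> (a - y) mod int m \<in> {1..int s}"

lemma m0: "0 < int m" "int s < int m" "s < m" using s1 sm by linarith+

lemma mod_eq: "0 \<le> d \<Longrightarrow> d < int m \<Longrightarrow> [a = d] (mod int m) \<longleftrightarrow> a mod int m = d"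
  by (simp add: cong_def)

lemma mod_Z [simp]: "a mod int m \<in> Z" using m0 by simp

lemma win_iff: "(\<exists>d\<in>{1..int s}. [a - y = d] (mod int m)) \<longleftrightarrow> win y a"
proof -
  have "[a - y = d] (mod int m) \<longleftrightarrow> (a - y) mod int m = d" if "d \<in> {1..int s}" for d
    using that m0 by (intro mod_eq) auto
  thus ?thesis unfolding win_def by blast
qed

lemma far_iff: "(\<exists>d\<in>{-(int s - 1)..int s - 1}. [a - b = d] (mod int m)) \<longleftrightarrow> \<not> far a b"
proof -
  define e where "e = (a - b) mod int m"
  have e: "0 \<le> e" "e < int m" using m0 by (simp_all add: e_def)
  have ce: "[a - b = d] (mod int m) \<longleftrightarrow> [e = d] (mod int m)" for d by (simp add: e_def cong_def)
  show ?thesis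
  proof
    assume "\<exists>d\<in>{-(int s - 1)..int s - 1}. [a - b = d] (mod int m)"
    then obtain d where d: "- (int s - 1) \<le> d" "d \<le> int s - 1" "[e = d] (mod int m)" by (auto simp: ce)
    show "\<not> far a b"
    proof (cases "0 \<le> d")
      case True
      hence "e = d" using d e m0 by (simp add: cong_def)
      thus ?thesis using d by (simp add: far_def flip: e_def)
    next
      case False
      have "e = (d + int m) mod int m" using d e by (simp add: cong_def)
      also have "\<dots> = d + int m" using False d m0 by (intro mod_pos_pos_trivial) auto
      finally show ?thesis using d by (simp add: far_def flip: e_def)
    qed
  next
    assume "\<not> far a b"
    then consider "e < int s" | "int m - int s < e" by (auto simp: far_def simp flip: e_def)
    thus "\<exists>d\<in>{-(int s - 1)..int s - 1}. [a - b = d] (mod int m)"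
    proof cases
      case 1
      thus ?thesis using e by (intro bexI[of _ e]) (auto simp: ce)
    next
      case 2
      thus ?thesis using e by (intro bexI[of _ "e - int m"]) (auto simp: cong_def e_def[symmetric])
    qed
  qed
qed

lemma far_sym: "far a b \<longleftrightarrow> far b a"
proof -
  have "(b - a) mod int m = (- (a - b)) mod int m" by simp
  also have "\<dots> = (if (a - b) mod int m = 0 then 0 else int m - (a - b) mod int m)"
    by (rule zmod_zminus1_eq_if)
  finally show ?thesis using s1 unfolding far_def by (auto split: if_splits)
qed

text \<open>A step by \<open>s\<close> leads out of the window, and from outside some step back of
  at least \<open>s\<close> leads into it. This is the assumption \<open>flip\<close> of the
  connectivity argument.\<close>

lemma far_flip: "\<exists>u\<in>Z. far a u \<and> win y u = (\<not> win y a)"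
proof -
  define d where "d = (a - y) mod int m"
  have d: "0 \<le> d" "d < int m" using m0 by (simp_all add: d_def)
  have *: "far a ((y + u) mod int m) \<and> win y ((y + u) mod int m) = (u \<in> {1..int s})"
    if "0 \<le> u" "u < int m" "int s \<le> (d - u) mod int m" "(d - u) mod int m \<le> int m - int s" for u
  proof -
    have "(a - (y + u) mod int m) mod int m = ((a - y) - u) mod int m" by (simp add: mod_diff_right_eq algebra_simps)
    also have "\<dots> = (d - u) mod int m" by (simp add: d_def mod_diff_left_eq)
    finally have "far a ((y + u) mod int m)" using that by (simp add: far_def)
    moreover have "((y + u) mod int m - y) mod int m = u" using that by (simp add: mod_diff_left_eq)
    ultimately show ?thesis by (simp add: win_def)
  qed
  show ?thesis
  proof (cases "win y a")
    case True
    hence dw: "1 \<le> d" "d \<le> int s" by (auto simp: win_def d_def)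
    define u where "u = (d + int s) mod int m"
    have "(d - u) mod int m = (- int s) mod int m" by (simp add: u_def mod_diff_right_eq)
    also have "\<dots> = int m - int s" using m0 s1 by (simp add: zmod_zminus1_eq_if)
    finally have e: "(d - u) mod int m = int m - int s" .
    have "u = (if d + int s = int m then 0 else d + int s)"
      using dw sm m0 by (auto simp: u_def)
    hence "u \<notin> {1..int s}" using dw by auto
    moreover have "0 \<le> u" "u < int m" using m0 by (simp_all add: u_def)
    ultimately show ?thesis using *[of u] e True sm by (intro bexI[of _ "(y + u) mod int m"]) auto
  next
    case False
    \<comment> \<open>Offset \<open>0\<close> is read as \<open>m\<close>, so that every offset
      outside the window exceeds \<open>s\<close>. Going back by \<open>s\<close> then stays
      positive, and the minimum below cuts off at the end of the window.\<close>
    define d' where "d' = (if d = 0 then int m else d)"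
    have d': "int s < d'" "d' \<le> int m" "d' mod int m = d" using False d m0 by (auto simp: d'_def win_def simp flip: d_def)
    define u where "u = min (d' - int s) (int s)"
    have u: "1 \<le> u" "u \<le> int s" "int s \<le> d' - u" "d' - u \<le> int m - int s"
      using d' s1 sm by (auto simp: u_def)
    have "(d - u) mod int m = (d' - u) mod int m" using d'(3) by (metis mod_diff_left_eq)
    also have "\<dots> = d' - u" using u d' s1 by (intro mod_pos_pos_trivial) auto
    finally show ?thesis using *[of u] u False m0 by (intro bexI[of _ "(y + u) mod int m"]) auto
  qed
qed

definition up :: "int set \<Rightarrow> int set" where "up S = S \<union> (\<lambda>a. (a + 1) mod int m) ` S"

lemma up_Z: "S \<subseteq> Z \<Longrightarrow> up S \<subseteq> Z" using m0 by (auto simp: up_def)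

lemma up_iter_Z: "S \<subseteq> Z \<Longrightarrow> (up ^^ k) S \<subseteq> Z"
  by (induction k) (auto dest: up_Z)

lemma up_closed:
  assumes "S \<subseteq> Z" "S \<noteq> {}" "up S = S" shows "S = Z"
proof -
  obtain a where a: "a \<in> S" using assms by blast
  have "(a + int j) mod int m \<in> S" for j
  proof (induction j)
    case 0
    thus ?case using a assms(1) by auto
  next
    case (Suc j)
    have "((a + int j) mod int m + 1) mod int m \<in> up S" using Suc unfolding up_def by blast
    thus ?case using assms(3) by (simp add: mod_simps algebra_simps)
  qed
  hence j: "(a + int (nat ((b - a) mod int m))) mod int m \<in> S" for b .
  have "b \<in> S" if "b \<in> Z" for b using j[of b] that m0 by (simp add: mod_add_right_eq)
  thus ?thesis using assms(1) by blast
qed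

lemma card_up:
  assumes "S \<subseteq> Z" "S \<noteq> {}" "S \<noteq> Z" shows "card S + 1 \<le> card (up S)"
proof -
  have "up S \<noteq> S" using up_closed assms by blast
  moreover have "S \<subseteq> up S" by (auto simp: up_def)
  moreover have "finite (up S)" using up_Z[OF assms(1)] finite_subset by blast
  ultimately have "card S < card (up S)" by (intro psubset_card_mono) auto
  thus ?thesis by simp
qed

text \<open>The Cauchy-Davenport bound for a sumset with an interval, valid for every modulus
  because each single step gains a point until \<open>Z\<close> is full.\<close>

lemma card_up_iter:
  assumes "S \<subseteq> Z" "S \<noteq> {}" "(up ^^ k) S \<noteq> Z" shows "card S + k \<le> card ((up ^^ k) S)"
  using assms(3)
proof (induction k)
  case (Suc k)
  have sub: "(up ^^ k) S \<subseteq> Z" "(up ^^ Suc k) S \<subseteq> Z" using up_iter_Z[OF assms(1)] by blast+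
  have "(up ^^ k) S \<subseteq> (up ^^ Suc k) S" by (auto simp: up_def)
  hence nz: "(up ^^ k) S \<noteq> Z" using Suc.prems sub by auto
  have ne: "(up ^^ k) S \<noteq> {}"
  proof -
    have "S \<subseteq> (up ^^ k) S" by (induction k) (auto simp: up_def)
    thus ?thesis using assms by blast
  qed
  show ?case using Suc.IH[OF nz] card_up[OF sub(1) ne nz] by simp
qed simp

lemma up_iter_D:
  assumes "S \<subseteq> Z" "b \<in> (up ^^ k) S" shows "\<exists>a\<in>S. \<exists>j\<le>k. b = (a + int j) mod int m"
  using assms(2)
proof (induction k arbitrary: b)
  case 0
  thus ?case using assms(1) by (intro bexI[of _ b]) auto
next
  case (Suc k)
  hence "b \<in> up ((up ^^ k) S)" by simp
  then obtain c where c: "c \<in> (up ^^ k) S" "b = c \<or> b = (c + 1) mod int m"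
    unfolding up_def[of "(up ^^ k) S"] by blast
  obtain a j where a: "a \<in> S" "j \<le> k" "c = (a + int j) mod int m" using Suc.IH[OF c(1)] by blast
  show ?case using c(2)
  proof
    assume "b = c" thus ?thesis using a le_SucI by blast
  next
    assume "b = (c + 1) mod int m"
    hence "b = (a + int (Suc j)) mod int m" using a(3) by (simp add: mod_simps algebra_simps)
    moreover have "Suc j \<le> Suc k" using a(2) by simp
    ultimately show ?thesis using a(1) by blast
  qed
qed

text \<open>The residues at distance at least \<open>s\<close> from some point of \<open>S\<close> form the sumset of \<open>S\<close> with the interval
\<open>{s..m - s}\<close>, which is the translate by \<open>s\<close> of an iterate of \<open>up\<close>.\<close>

lemma cross_shift:
  assumes S: "S \<subseteq> Z" and T: "T \<subseteq> Z" and c: "\<And>a b. a \<in> S \<Longrightarrow> b \<in> T \<Longrightarrow> \<not> far a b"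
  shows "card ((up ^^ (m - 2 * s)) S) + card T \<le> m" "T \<noteq> {} \<Longrightarrow> (up ^^ (m - 2 * s)) S \<noteq> Z"
proof -
  let ?g = "\<lambda>b. (b - int s) mod int m"
  have inj: "inj_on ?g T"
  proof (rule inj_on_inverseI[of _ "\<lambda>b. (b + int s) mod int m"])
    fix b assume "b \<in> T" thus "(?g b + int s) mod int m = b" using T by (auto simp: mod_add_left_eq)
  qed
  have d: "?g b \<notin> (up ^^ (m - 2 * s)) S" if b: "b \<in> T" for b
  proof
    assume "?g b \<in> (up ^^ (m - 2 * s)) S"
    then obtain a j where a: "a \<in> S" "j \<le> m - 2 * s" "?g b = (a + int j) mod int m" using up_iter_D[OF S] by blast
    have "(b - a) mod int m = (?g b + int s - a) mod int m" by (simp add: mod_diff_left_eq mod_add_left_eq flip: add_diff_eq)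
    also have "\<dots> = (a + int j + (int s - a)) mod int m" unfolding a(3) by (simp add: mod_add_left_eq flip: add_diff_eq)
    also have "\<dots> = int (j + s)" using a(2) sm m0 s1 by simp
    finally have "far b a" using a(2) sm unfolding far_def by simp
    thus False using c[OF a(1) b] far_sym by blast
  qed
  have U: "(up ^^ (m - 2 * s)) S \<subseteq> Z" by (rule up_iter_Z[OF S])
  show "T \<noteq> {} \<Longrightarrow> (up ^^ (m - 2 * s)) S \<noteq> Z" using d mod_Z by blast
  have "card ((up ^^ (m - 2 * s)) S) + card (?g ` T) = card ((up ^^ (m - 2 * s)) S \<union> ?g ` T)"
    using d finite_subset[OF U] finite_subset[OF T] by (intro card_Un_disjoint[symmetric]) auto
  also have "\<dots> \<le> card Z" using U mod_Z by (intro card_mono) blast+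
  finally show "card ((up ^^ (m - 2 * s)) S) + card T \<le> m" using card_image[OF inj] by simp
qed

text \<open>\<open>S\<close> gains at least \<open>m - 2 * s\<close> points in the iteration, and
  the result is disjoint from a translate of \<open>T\<close>.\<close>

lemma cross_bound:
  assumes "S \<subseteq> Z" "T \<subseteq> Z" "S \<noteq> {}" "T \<noteq> {}" "\<And>a b. a \<in> S \<Longrightarrow> b \<in> T \<Longrightarrow> \<not> far a b"
  shows "card S + card T \<le> 2 * s"
  using card_up_iter[OF assms(1,3) cross_shift(2)[OF assms(1,2,5) assms(4)]] cross_shift(1)[OF assms(1,2,5)] sm
  by linarith

text \<open>A single new point \<open>e\<close> means a single upper end. From any point of
  \<open>S\<close>, going upwards stays in \<open>S\<close> until \<open>e\<close>, so
  \<open>S\<close> is the run between the first gap below \<open>e\<close> and \<open>e\<close>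
  itself.\<close>

lemma interval_of_card_up:
  assumes S: "S \<subseteq> Z" "card (up S) = card S + 1"
  shows "\<exists>y\<in>Z. S = {a\<in>Z. (a - y) mod int m \<in> {1..int (card S)}}"
proof -
  have fin: "finite S" "finite (up S)" using S up_Z finite_subset by blast+
  have "card (up S - S) = 1" using S fin by (subst card_Diff_subset) (auto simp: up_def)
  then obtain e where e: "up S - S = {e}" by (auto simp: card_1_singleton_iff)
  have eZ: "e \<in> Z" "e \<notin> S" using e up_Z[OF S(1)] by blast+
  define f where "f = (\<lambda>j. (e - 1 - j) mod int m)"
  have nxt: "f (int j) \<in> S" if "f (int (Suc j)) \<in> S" "Suc j < m" for j
  proof -
    have "(f (int (Suc j)) + 1) mod int m \<in> up S" using that(1) unfolding up_def by blast
    moreover have "(f (int (Suc j)) + 1) mod int m = f (int j)" by (simp add: f_def mod_simps algebra_simps)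
    ultimately have u: "f (int j) \<in> up S" by simp
    have "f (int j) \<noteq> e"
    proof
      assume "f (int j) = e"
      hence "(e - (1 + int j)) mod int m = e mod int m" using eZ by (simp add: f_def algebra_simps)
      hence "int m dvd 1 + int j" by (metis mod_eq_dvd_iff diff_diff_eq2 add_diff_cancel_left' dvd_minus_iff minus_diff_eq add.commute diff_add_cancel)
      thus False using that(2) zdvd_imp_le[of "int m" "1 + int j"] by simp
    qed
    thus ?thesis using u e by blast
  qed
  have down: "f (int i) \<in> S" if "i \<le> j" "f (int j) \<in> S" "j < m" for i j
    using that
  proof (induction rule: inc_induct)
    case (step k)
    thus ?case using nxt[of k] by simp
  qed
  define J where "J = (LEAST j. f (int j) \<notin> S)"
  have "(e - 1 - int (m - 1)) mod int m = (e - int m) mod int m" using m0 s1 sm by (simp add: of_nat_diff)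
  hence "f (int (m - 1)) = e" using eZ by (simp add: f_def)
  hence last: "f (int (m - 1)) \<notin> S" using eZ by simp
  have J: "f (int J) \<notin> S" "J \<le> m - 1" and J': "\<And>j. j < J \<Longrightarrow> f (int j) \<in> S"
    using LeastI[of "\<lambda>j. f (int j) \<notin> S", OF last] Least_le[of "\<lambda>j. f (int j) \<notin> S", OF last]
      not_less_Least[of _ "\<lambda>j. f (int j) \<notin> S"] by (auto simp: J_def)
  have fS: "f (int j) \<in> S \<longleftrightarrow> j < J" if "j < m" for j
    using J' J(1) down[of J j] that by (meson not_le)
  have idx: "f ((e - 1 - a) mod int m) = a" if "a \<in> Z" for a
    using that by (simp add: f_def mod_diff_right_eq)
  have ix: "nat ((e - 1 - a) mod int m) < m" for a using m0 by (simp add: nat_less_iff)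
  have aS: "a \<in> S \<longleftrightarrow> (e - 1 - a) mod int m < int J" if "a \<in> Z" for a
    using fS[OF ix[of a]] idx[OF that] m0 by (simp add: nat_less_iff)
  have "bij_betw (\<lambda>j. f (int j)) {..<J} S"
  proof (rule bij_betwI[where g = "\<lambda>a. nat ((e - 1 - a) mod int m)"])
    show "(\<lambda>j. f (int j)) \<in> {..<J} \<rightarrow> S" using J' by auto
    show "(\<lambda>a. nat ((e - 1 - a) mod int m)) \<in> S \<rightarrow> {..<J}"
      using aS S(1) m0 by (auto simp: nat_less_iff)
    show "nat ((e - 1 - f (int j)) mod int m) = j" if "j \<in> {..<J}" for j
      using that J(2) m0 by (simp add: f_def mod_diff_right_eq)
    show "f (int (nat ((e - 1 - a) mod int m))) = a" if "a \<in> S" for a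
      using idx[of a] that S(1) m0 by auto
  qed
  hence cJ: "card S = J" using bij_betw_same_card by fastforce
  \<comment> \<open>The first residue below \<open>e\<close> outside \<open>S\<close>; windows start
    at offset 1 from their base.\<close>
  let ?y = "(e - 1 - int J) mod int m"
  have "(a - ?y) mod int m \<in> {1..int J} \<longleftrightarrow> a \<in> S" if a: "a \<in> Z" for a
  proof -
    define j where "j = (e - 1 - a) mod int m"
    have j: "0 \<le> j" "j < int m" using m0 by (simp_all add: j_def)
    have "(a - ?y) mod int m = (int J - (e - 1 - a)) mod int m" by (simp add: mod_diff_right_eq algebra_simps)
    also have "\<dots> = (int J - j) mod int m" by (simp add: j_def mod_diff_right_eq)
    finally have eq: "(a - ?y) mod int m = (int J - j) mod int m" .
    show ?thesis
    proof (cases "j \<le> int J")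
      case True
      hence "(int J - j) mod int m = int J - j" using j J(2) m0 by (intro mod_pos_pos_trivial) auto
      thus ?thesis unfolding eq aS[OF a] j_def[symmetric] using True j by auto
    next
      case False
      have "(int J - j) mod int m = (int J - j + int m) mod int m" by simp
      also have "\<dots> = int J - j + int m" using False j by (intro mod_pos_pos_trivial) auto
      finally show ?thesis unfolding eq aS[OF a] j_def[symmetric] using False j by auto
    qed
  qed
  hence "S = {a\<in>Z. (a - ?y) mod int m \<in> {1..int J}}" using S(1) by blast
  thus ?thesis using mod_Z unfolding cJ by blast
qed

text \<open>Equality in \<open>cross_bound\<close> leaves no slack in the first \<open>up\<close>
  step, so \<open>S\<close> is an interval. For \<open>m = 2 * s\<close> there is no such step, but
  then \<open>s = 1\<close> and singletons are windows. A point of \<open>T\<close> outside the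
  window would be far from a point inside it.\<close>

lemma cross_eq:
  assumes ms: "2 * s < m \<or> s = 1" and S: "S \<subseteq> Z" "card S = s" and T: "T \<subseteq> Z" "card T = s"
    and c: "\<And>a b. a \<in> S \<Longrightarrow> b \<in> T \<Longrightarrow> \<not> far a b"
  shows "T = S" "\<exists>y\<in>Z. S = {a\<in>Z. win y a}"
proof -
  have fin: "finite S" "finite T" using S T finite_subset by blast+
  have ne: "S \<noteq> {}" "T \<noteq> {}" using S T s1 by auto
  show iv: "\<exists>y\<in>Z. S = {a\<in>Z. win y a}"
  proof (cases "2 * s < m")
    case True
    define k where "k = m - 2 * s - 1"
    have k: "m - 2 * s = Suc k" "Suc k + 2 * s = m" using True by (auto simp: k_def)
    have it: "(up ^^ (m - 2 * s)) S = (up ^^ k) (up S)" unfolding k(1) by (simp add: funpow_swap1)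
    note U = up_Z[OF S(1)]
    have Une: "up S \<noteq> {}" using ne by (auto simp: up_def)
    have nZ: "(up ^^ k) (up S) \<noteq> Z" using cross_shift(2)[OF S(1) T(1) c ne(2)] it by simp
    have "card (up S) + k + card T \<le> m"
      using card_up_iter[OF U Une nZ] cross_shift(1)[OF S(1) T(1) c] it by simp
    hence le: "card (up S) \<le> card S + 1" using S T k by simp
    have "S \<noteq> Z" using S(2) m0 by auto
    hence "card (up S) = card S + 1" using card_up[OF S(1) ne(1)] le by simp
    thus ?thesis using interval_of_card_up[OF S(1)] S(2) by (simp add: win_def)
  next
    case False
    hence "s = 1" using ms by simp
    then obtain a where a: "S = {a}" "0 \<le> a" "a < int m" using S by (auto simp: card_1_singleton_iff)
    have "(b - (a - 1) mod int m) mod int m = 1 \<longleftrightarrow> b = a" if b: "0 \<le> b" "b < int m" for b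
    proof -
      have e: "(b - (a - 1) mod int m) mod int m = (b - a + 1) mod int m" by (simp add: mod_diff_right_eq algebra_simps)
      consider "b - a + 1 < 0" | "0 \<le> b - a + 1" "b - a + 1 < int m" | "b - a + 1 = int m" using a b by linarith
      thus ?thesis
      proof cases
        case 1
        have "(b - a + 1) mod int m = (b - a + 1 + int m) mod int m" by simp
        also have "\<dots> = b - a + 1 + int m" using 1 a b by (intro mod_pos_pos_trivial) auto
        finally show ?thesis unfolding e using 1 a b m0 by auto
      next
        case 2
        thus ?thesis unfolding e by auto
      next
        case 3
        thus ?thesis unfolding e using sm s1 a b by auto
      qed
    qed
    hence "S = {b\<in>Z. win ((a - 1) mod int m) b}" using a \<open>s = 1\<close> unfolding win_def by auto
    thus ?thesis using mod_Z by blast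
  qed
  then obtain y where y: "S = {a\<in>Z. win y a}" by blast
  have "T \<subseteq> S"
  proof
    fix b assume b: "b \<in> T"
    show "b \<in> S"
    proof (rule ccontr)
      assume "b \<notin> S"
      hence "\<not> win y b" using b T y by blast
      then obtain u where "u \<in> Z" "far b u" "win y u" using far_flip[of b y] by blast
      thus False using c[of u b] b y far_sym by blast
    qed
  qed
  thus "T = S" using fin S T by (intro card_subset_eq) auto
qed

end

section \<open>Hybrid families\<close>

locale hybrid = circle +
  fixes n t :: nat
  assumes tpos: "1 \<le> t"
begin

abbreviation P :: "(nat \<Rightarrow> int) set" where "P \<equiv> {1..n} \<rightarrow>\<^sub>E Z"

abbreviation p :: real where "p \<equiv> real s / real m"

text \<open>At a converted coordinate agreement is not reflexive: a value outside the window agrees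
  with nothing, as a point missing from a set never counts for an intersection.\<close>

definition agr :: "nat set \<Rightarrow> nat \<Rightarrow> int \<Rightarrow> int \<Rightarrow> bool" where
  "agr C i a b \<longleftrightarrow> (if i \<in> C then win 0 a \<and> win 0 b else \<not> far a b)"

abbreviation lines :: "nat \<Rightarrow> (nat \<Rightarrow> int) set" where "lines i \<equiv> ({1..n} - {i}) \<rightarrow>\<^sub>E Z"

definition hyb :: "nat set \<Rightarrow> (nat \<Rightarrow> int) set \<Rightarrow> bool" where
  "hyb C F \<longleftrightarrow> F \<subseteq> P \<and> (\<forall>x\<in>F. \<forall>y\<in>F. t \<le> card {i\<in>{1..n}. agr C i (x i) (y i)})"

definition fib :: "nat \<Rightarrow> (nat \<Rightarrow> int) \<Rightarrow> (nat \<Rightarrow> int) set \<Rightarrow> int set" where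
  "fib i x F = {a\<in>Z. x(i := a) \<in> F}"

text \<open>The thresholds \<open>s - c\<close> and \<open>s + c + 1\<close> add up to
  \<open>2 * s + 1\<close>, one more than \<open>cross_bound\<close> admits.\<close>

definition conv :: "nat \<Rightarrow> nat \<Rightarrow> (nat \<Rightarrow> int) set \<Rightarrow> (nat \<Rightarrow> int) set" where
  "conv c i F = {x\<in>P. if win 0 (x i) then s - c \<le> card (fib i x F) else s + c + 1 \<le> card (fib i x F)}"

definition sig :: "(nat \<Rightarrow> int) \<Rightarrow> (nat \<Rightarrow> int) \<Rightarrow> nat set" where
  "sig y x = {i\<in>{1..n}. win (y i) (x i)}"

definition pull :: "(nat \<Rightarrow> int) \<Rightarrow> nat set set \<Rightarrow> (nat \<Rightarrow> int) set" where
  "pull y G = {x\<in>P. sig y x \<in> G}"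

lemma p_bounds: "0 < p" "p \<le> 1/2" using s1 sm by (simp_all add: divide_simps)

lemma finite_P: "finite P" by (intro finite_PiE) auto

lemma card_P: "card P = m ^ n" by (simp add: card_PiE)

lemma fib_upd [simp]: "fib i (x(i := a)) F = fib i x F" by (simp add: fib_def)

lemma fib_Z: "fib i x F \<subseteq> Z" "card (fib i x F) \<le> m"
proof -
  show "fib i x F \<subseteq> Z" by (auto simp: fib_def)
  hence "card (fib i x F) \<le> card Z" by (intro card_mono) auto
  thus "card (fib i x F) \<le> m" by simp
qed

lemma fib_full: "card (fib i x F) = m \<Longrightarrow> fib i x F = Z"
  using fib_Z(1) by (intro card_subset_eq) auto

lemma finite_Z: "finite {a\<in>Z. Q a}"
  by (rule finite_subset[of _ Z]) auto

lemma card_win: "card {a\<in>Z. win y a} = s" "card {a\<in>Z. \<not> win y a} = m - s"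
proof -
  have "bij_betw (\<lambda>u. (y + u) mod int m) {1..int s} {a\<in>Z. win y a}"
  proof (rule bij_betwI[where g = "\<lambda>a. (a - y) mod int m"])
    show "(\<lambda>u. (y + u) mod int m) \<in> {1..int s} \<rightarrow> {a\<in>Z. win y a}"
      using m0 by (auto simp: win_def mod_diff_left_eq)
    show "(\<lambda>a. (a - y) mod int m) \<in> {a\<in>Z. win y a} \<rightarrow> {1..int s}" by (auto simp: win_def)
  qed (use m0 in \<open>auto simp: mod_simps\<close>)
  thus c: "card {a\<in>Z. win y a} = s" by (simp flip: bij_betw_same_card)
  have "{a\<in>Z. \<not> win y a} = Z - {a\<in>Z. win y a}" by blast
  also have "card \<dots> = card Z - card {a\<in>Z. win y a}" by (intro card_Diff_subset finite_Z) auto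
  finally show "card {a\<in>Z. \<not> win y a} = m - s" using c by simp
qed

lemma ex_win: "\<exists>a\<in>Z. win y a" "\<exists>a\<in>Z. \<not> win y a"
proof -
  have "{a\<in>Z. win y a} \<noteq> {}" "{a\<in>Z. \<not> win y a} \<noteq> {}" using card_win[of y] s1 m0 by (metis card.empty not_one_le_zero, metis card.empty zero_less_diff less_irrefl)
  thus "\<exists>a\<in>Z. win y a" "\<exists>a\<in>Z. \<not> win y a" by blast+
qed

lemma upd_P: "x \<in> P \<Longrightarrow> i \<in> {1..n} \<Longrightarrow> a \<in> Z \<Longrightarrow> x(i := a) \<in> P"
  by (auto simp: PiE_def extensional_def)

lemma hyb_fib:
  assumes F: "hyb C F" and i: "i \<in> {1..n}" and a: "a \<in> fib i x F" and b: "b \<in> fib i y F"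
  shows "t \<le> card {j\<in>{1..n} - {i}. agr C j (x j) (y j)} + (if agr C i a b then 1 else 0)"
proof -
  have "t \<le> card {j\<in>{1..n}. agr C j ((x(i := a)) j) ((y(i := b)) j)}"
    using F a b unfolding hyb_def fib_def by blast
  also have "{j\<in>{1..n}. agr C j ((x(i := a)) j) ((y(i := b)) j)} =
    {j\<in>{1..n} - {i}. agr C j (x j) (y j)} \<union> (if agr C i a b then {i} else {})"
    using i by auto
  also have "card \<dots> \<le> card {j\<in>{1..n} - {i}. agr C j (x j) (y j)} + card (if agr C i a b then {i} else {})"
    by (rule card_Un_le)
  finally show ?thesis by (auto split: if_splits)
qed

text \<open>If both values lie in the window, \<open>i\<close> is an agreement after the conversion
  and makes up for one used at \<open>i\<close> before. Otherwise the fibres are too large to agree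
  elementwise, and a far pair shows that the other coordinates already give \<open>t\<close>
  agreements.\<close>

lemma hyb_conv:
  assumes F: "hyb C F" and i: "i \<in> {1..n}" "i \<notin> C" and c: "c < s"
  shows "hyb (insert i C) (conv c i F)"
  unfolding hyb_def
proof (intro conjI ballI)
  show "conv c i F \<subseteq> P" by (auto simp: conv_def)
  fix x y assume xy: "x \<in> conv c i F" "y \<in> conv c i F"
  let ?A = "{j\<in>{1..n} - {i}. agr C j (x j) (y j)}"
  let ?B = "{j\<in>{1..n}. agr (insert i C) j (x j) (y j)}"
  have A: "?A \<subseteq> ?B" by (auto simp: agr_def)
  have g: "1 \<le> card (fib i z F)" "\<not> win 0 (z i) \<Longrightarrow> s + c + 1 \<le> card (fib i z F)"
    "s - c \<le> card (fib i z F)" if "z \<in> conv c i F" for z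
    using that c by (auto simp: conv_def split: if_splits)
  have ne: "fib i z F \<noteq> {}" if "z \<in> conv c i F" for z using g(1)[OF that] by auto
  show "t \<le> card ?B"
  proof (cases "win 0 (x i) \<and> win 0 (y i)")
    case True
    obtain a b where ab: "a \<in> fib i x F" "b \<in> fib i y F" using ne xy by blast
    have "t \<le> card ?A + (if agr C i a b then 1 else 0)" by (rule hyb_fib[OF F i(1) ab])
    also have "\<dots> \<le> card ?A + 1" by simp
    also have "\<dots> = card (insert i ?A)" by simp
    also have "\<dots> \<le> card ?B" using A i True by (intro card_mono) (auto simp: agr_def)
    finally show ?thesis .
  next
    case False
    hence "2 * s < card (fib i x F) + card (fib i y F)"
      using g(2,3)[OF xy(1)] g(2,3)[OF xy(2)] c by linarith
    then obtain a b where ab: "a \<in> fib i x F" "b \<in> fib i y F" "far a b"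
      using cross_bound[OF fib_Z(1) fib_Z(1) ne[OF xy(1)] ne[OF xy(2)]] by force
    hence "t \<le> card ?A" using hyb_fib[OF F i(1) ab(1,2)] i(2) by (simp add: agr_def)
    also have "\<dots> \<le> card ?B" using A by (intro card_mono) auto
    finally show ?thesis .
  qed
qed

lemma card_fibres:
  assumes F: "F \<subseteq> P" and i: "i \<in> {1..n}"
  shows "card F = (\<Sum>u\<in>lines i. card {a\<in>Z. u(i := a) \<in> F})"
proof -
  let ?B = "lines i"
  have "bij_betw (\<lambda>(u, a). u(i := a)) (SIGMA u:?B. {a\<in>Z. u(i := a) \<in> F}) F"
  proof (rule bij_betwI[where g = "\<lambda>x. (restrict x ({1..n} - {i}), x i)"])
    show "(\<lambda>(u, a). u(i := a)) \<in> (SIGMA u:?B. {a\<in>Z. u(i := a) \<in> F}) \<rightarrow> F" by auto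
    have r: "(restrict x ({1..n} - {i}))(i := x i) = x" if "x \<in> P" for x
      using that i by (auto simp: PiE_def extensional_def)
    show "(\<lambda>x. (restrict x ({1..n} - {i}), x i)) \<in> F \<rightarrow> (SIGMA u:?B. {a\<in>Z. u(i := a) \<in> F})"
    proof
      fix x assume x: "x \<in> F"
      hence "x \<in> P" using F by blast
      hence "restrict x ({1..n} - {i}) \<in> ?B" "x i \<in> Z" using i by (auto simp del: atLeastLessThan_iff)
      thus "(restrict x ({1..n} - {i}), x i) \<in> (SIGMA u:?B. {a\<in>Z. u(i := a) \<in> F})"
        using r[OF \<open>x \<in> P\<close>] x by simp
    qed
    show "(\<lambda>(u, a). u(i := a)) (restrict x ({1..n} - {i}), x i) = x" if "x \<in> F" for x
      using r[of x] that F by auto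
    fix ua assume "ua \<in> (SIGMA u:?B. {a\<in>Z. u(i := a) \<in> F})"
    then obtain u a where ua: "ua = (u, a)" "u \<in> ?B" by blast
    hence "restrict (u(i := a)) ({1..n} - {i}) = u" by (auto simp: PiE_def extensional_def)
    thus "(restrict ((\<lambda>(u, a). u(i := a)) ua) ({1..n} - {i}), (\<lambda>(u, a). u(i := a)) ua i) = ua"
      using ua by simp
  qed
  hence "card F = card (SIGMA u:?B. {a\<in>Z. u(i := a) \<in> F})" by (simp add: bij_betw_same_card)
  also have "\<dots> = (\<Sum>u\<in>?B. card {a\<in>Z. u(i := a) \<in> F})"
    by (rule card_SigmaI) (use finite_Z in \<open>auto intro!: finite_PiE simp del: atLeastLessThan_iff\<close>)
  finally show ?thesis .
qed

text \<open>The number of points of the \<open>c\<close>-th conversion on a line with \<open>k\<close> points in \<open>F\<close>.\<close>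

definition line :: "nat \<Rightarrow> nat \<Rightarrow> nat" where
  "line c k = (if s - c \<le> k then s else 0) + (if s + c + 1 \<le> k then m - s else 0)"

lemma card_conv:
  assumes i: "i \<in> {1..n}" and c: "c < s"
  shows "card (conv c i F) = (\<Sum>u\<in>lines i. line c (card (fib i u F)))"
proof -
  have "card {a\<in>Z. u(i := a) \<in> conv c i F} = line c (card (fib i u F))"
    if u: "u \<in> lines i" for u
  proof -
    have "u(i := a) \<in> P" if "a \<in> Z" for a
      using u that i by (auto simp: PiE_def extensional_def)
    hence e: "{a\<in>Z. u(i := a) \<in> conv c i F} = {a\<in>Z. if win 0 a then s - c \<le> card (fib i u F) else s + c + 1 \<le> card (fib i u F)}"
      by (auto simp: conv_def simp del: atLeastLessThan_iff split: if_splits)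
    consider "s + c + 1 \<le> card (fib i u F)" | "s - c \<le> card (fib i u F)" "\<not> s + c + 1 \<le> card (fib i u F)"
      | "\<not> s - c \<le> card (fib i u F)" "\<not> s + c + 1 \<le> card (fib i u F)" by blast
    thus ?thesis
    proof cases
      case 1
      hence "{a\<in>Z. u(i := a) \<in> conv c i F} = Z" unfolding e by auto
      thus ?thesis using 1 m0 by (simp add: line_def)
    next
      case 2
      hence "{a\<in>Z. u(i := a) \<in> conv c i F} = {a\<in>Z. win 0 a}" unfolding e by auto
      thus ?thesis using 2 card_win by (simp add: line_def)
    next
      case 3
      hence "{a\<in>Z. u(i := a) \<in> conv c i F} = {}" unfolding e by auto
      moreover have "line c (card (fib i u F)) = 0" using 3 by (simp add: line_def)
      ultimately show ?thesis by (simp only: card.empty)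
    qed
  qed
  moreover have "conv c i F \<subseteq> P" by (auto simp: conv_def)
  ultimately show ?thesis using card_fibres[OF _ i, of "conv c i F"] by simp
qed

lemma sum_line: "(\<Sum>c<s. line c k) = s * min k s + (m - s) * min (k - s) s"
proof -
  have "(\<Sum>c<s. if s - c \<le> k then s else 0) = s * card {c\<in>{..<s}. s - c \<le> k}"
    by (simp add: sum.inter_filter[symmetric])
  also have "{c\<in>{..<s}. s - c \<le> k} = {s - k..<s}" by auto
  also have "card {s - k..<s} = min k s" by auto
  finally have 1: "(\<Sum>c<s. if s - c \<le> k then s else 0) = s * min k s" .
  have "(\<Sum>c<s. if s + c + 1 \<le> k then m - s else 0) = (m - s) * card {c\<in>{..<s}. s + c + 1 \<le> k}"
    by (simp add: sum.inter_filter[symmetric])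
  also have "{c\<in>{..<s}. s + c + 1 \<le> k} = {..<min (k - s) s}" by auto
  finally have 2: "(\<Sum>c<s. if s + c + 1 \<le> k then m - s else 0) = (m - s) * min (k - s) s" by simp
  show ?thesis unfolding line_def sum.distrib 1 2 ..
qed

text \<open>Over all conversions, each of the first \<open>s\<close> points of a line is worth
  \<open>s\<close> and each of the next \<open>s\<close> is worth \<open>m - s \<ge> s\<close>; the
  sum has then reached \<open>s * m\<close>.\<close>

lemma sum_line_ge:
  assumes "k \<le> m"
  shows "s * k \<le> (\<Sum>c<s. line c k)"
    "2 * s < m \<or> s = 1 \<Longrightarrow> s * k = (\<Sum>c<s. line c k) \<Longrightarrow> k \<le> s \<or> k = m"
proof -
  obtain q where q: "m = s + q" "s \<le> q" using sm by (metis le_Suc_ex mult_2 add_leD1 nat_add_left_cancel_le)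
  consider (a) "k \<le> s" | (b) j where "k = s + j" "0 < j" "j \<le> s" | (c) j where "k = s + j" "s < j"
    by (metis le_add_diff_inverse nat_le_linear not_less zero_less_iff_neq_zero add.right_neutral)
  note cs = this
  show "s * k \<le> (\<Sum>c<s. line c k)"
    unfolding sum_line using cs
  proof cases
    case b
    have "s * j \<le> q * j" using q by simp
    thus "s * k \<le> s * min k s + (m - s) * min (k - s) s" using b q by (simp add: algebra_simps)
  next
    case c
    have "s * j \<le> q * s" using assms q c by (simp add: algebra_simps)
    thus "s * k \<le> s * min k s + (m - s) * min (k - s) s" using c q by (simp add: algebra_simps)
  qed simp
  assume ms: "2 * s < m \<or> s = 1" and "s * k = (\<Sum>c<s. line c k)"
  hence e: "s * k = s * min k s + (m - s) * min (k - s) s" by (simp only: sum_line)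
  show "k \<le> s \<or> k = m"
    using cs
  proof cases
    case b
    hence "s * j = q * j" using e q by (simp add: algebra_simps)
    hence "s = q" using b by simp
    thus ?thesis using ms q b by auto
  next
    case c
    hence "s * j = s * q" using e q by (simp add: algebra_simps)
    thus ?thesis using s1 c q by simp
  qed simp
qed

end

section \<open>Induction over the set of converted coordinates\<close>

lemma compl_induct:
  assumes S: "finite S" and C: "C \<subseteq> S" and base: "Q S"
    and step: "\<And>C i. C \<subseteq> S \<Longrightarrow> i \<in> S \<Longrightarrow> i \<notin> C \<Longrightarrow> Q (insert i C) \<Longrightarrow> Q C"
  shows "Q C"
  using C
proof (induction "card (S - C)" arbitrary: C rule: less_induct)
  case less
  show ?case
  proof (cases "C = S")
    case False
    then obtain i where i: "i \<in> S" "i \<notin> C" using less.prems by blast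
    have "S - insert i C \<subset> S - C" using i by blast
    hence "card (S - insert i C) < card (S - C)" using S by (intro psubset_card_mono) auto
    moreover have "insert i C \<subseteq> S" using less.prems i(1) by blast
    ultimately have "Q (insert i C)" by (rule less.hyps)
    thus ?thesis by (rule step[OF less.prems i])
  qed (use base in simp)
qed

lemma sum_eq_imp_eq:
  fixes f g :: "'a \<Rightarrow> 'b::ordered_cancel_comm_monoid_add"
  assumes "finite A" "\<And>x. x \<in> A \<Longrightarrow> f x \<le> g x" "sum g A \<le> sum f A" "x \<in> A"
  shows "f x = g x"
proof (rule ccontr)
  assume "f x \<noteq> g x"
  hence "f x < g x" using assms(2,4) by (simp add: less_le)
  hence "sum f A < sum g A" using assms by (intro sum_strict_mono_ex1) auto
  thus False using assms(3) by auto
qed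

context hybrid begin

sublocale biased t p using tpos p_bounds by unfold_locales

abbreviation M :: real where "M \<equiv> real m ^ n * w_p n t p"

lemma card_sig:
  assumes A: "A \<subseteq> {1..n}"
  shows "card {x\<in>P. sig y x = A} = s ^ card A * (m - s) ^ (n - card A)"
proof -
  have "{x\<in>P. sig y x = A} = (\<Pi>\<^sub>E i\<in>{1..n}. {a\<in>Z. win (y i) a = (i \<in> A)})"
  proof (intro equalityI subsetI)
    fix x assume x: "x \<in> {x\<in>P. sig y x = A}"
    hence "win (y i) (x i) = (i \<in> A)" if "i \<in> {1..n}" for i using that by (auto simp: sig_def)
    thus "x \<in> (\<Pi>\<^sub>E i\<in>{1..n}. {a\<in>Z. win (y i) a = (i \<in> A)})" using x by (auto simp: PiE_iff)
  next
    fix x assume x: "x \<in> (\<Pi>\<^sub>E i\<in>{1..n}. {a\<in>Z. win (y i) a = (i \<in> A)})"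
    hence "x \<in> P" by (auto simp: PiE_iff)
    moreover have "sig y x = A" using x A by (auto simp: sig_def PiE_iff)
    ultimately show "x \<in> {x\<in>P. sig y x = A}" by simp
  qed
  hence "card {x\<in>P. sig y x = A} = (\<Prod>i\<in>{1..n}. card {a\<in>Z. win (y i) a = (i \<in> A)})"
    by (simp add: card_PiE)
  also have "\<dots> = (\<Prod>i\<in>{1..n}. if i \<in> A then s else m - s)"
    by (rule prod.cong) (auto simp: card_win simp del: atLeastLessThan_iff)
  finally have "card {x\<in>P. sig y x = A} = (\<Prod>i\<in>{1..n}. if i \<in> A then s else m - s)" .
  moreover have "\<dots> = (\<Prod>i\<in>{1..n} \<inter> A. s) * (\<Prod>i\<in>{1..n} - A. m - s)"
    by (subst prod.If_cases) (auto simp: Diff_eq)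
  moreover have "{1..n} \<inter> A = A" using A by blast
  moreover have "card ({1..n} - A) = n - card A" using A finite_subset[OF A] by (simp add: card_Diff_subset)
  ultimately show ?thesis by simp
qed

lemma card_pull:
  assumes G: "G \<subseteq> Pow {1..n}"
  shows "real (card (pull y G)) = real m ^ n * mu_p n p G"
proof -
  have fin: "finite G" using G finite_subset by blast
  have "pull y G = (\<Union>A\<in>G. {x\<in>P. sig y x = A})" by (auto simp: pull_def)
  also have "card \<dots> = (\<Sum>A\<in>G. card {x\<in>P. sig y x = A})"
    by (rule card_UN_disjoint) (use fin finite_P in auto)
  also have "\<dots> = (\<Sum>A\<in>G. s ^ card A * (m - s) ^ (n - card A))"
    by (rule sum.cong[OF refl], rule card_sig) (use G in blast)
  finally have "real (card (pull y G)) = (\<Sum>A\<in>G. real s ^ card A * real (m - s) ^ (n - card A))" by simp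
  also have "\<dots> = (\<Sum>A\<in>G. real m ^ n * (p ^ card A * (1 - p) ^ (n - card A)))"
  proof (rule sum.cong[OF refl])
    fix A assume "A \<in> G"
    hence "card A \<le> card {1..n}" using G by (intro card_mono) auto
    hence "real m ^ n = real m ^ card A * real m ^ (n - card A)" by (simp flip: power_add)
    moreover have "1 - p = real (m - s) / real m" using m0 by (simp add: field_simps of_nat_diff)
    ultimately show "real s ^ card A * real (m - s) ^ (n - card A) = real m ^ n * (p ^ card A * (1 - p) ^ (n - card A))"
      using m0 by (simp add: power_divide)
  qed
  finally show ?thesis by (simp add: mu_p_def sum_distrib_left)
qed

lemma int_le_w:
  assumes "intersecting n t G" shows "mu_p n p G \<le> w_p n t p"
proof -
  obtain H where H: "opt n H" using opt_exists by blast
  hence "mu_p n p G \<le> mu_p n p H" using assms unfolding opt_def by blast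
  thus ?thesis using H opt_iff by simp
qed

lemma hyb_all:
  assumes "hyb {1..n} F"
  shows "intersecting n t (sig (\<lambda>_. 0) ` F)" "F \<subseteq> pull (\<lambda>_. 0) (sig (\<lambda>_. 0) ` F)"
proof -
  show "F \<subseteq> pull (\<lambda>_. 0) (sig (\<lambda>_. 0) ` F)" using assms by (auto simp: hyb_def pull_def)
  have "{i\<in>{1..n}. agr {1..n} i (x i) (y i)} = sig (\<lambda>_. 0) x \<inter> sig (\<lambda>_. 0) y" for x y
    by (auto simp: agr_def sig_def)
  thus "intersecting n t (sig (\<lambda>_. 0) ` F)" using assms unfolding intersecting_def hyb_def by (auto simp: sig_def)
qed

lemma count_conv:
  assumes F: "F \<subseteq> P" and i: "i \<in> {1..n}"
  shows "s * card F = (\<Sum>u\<in>lines i. s * card (fib i u F))"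
    "(\<Sum>c<s. card (conv c i F)) = (\<Sum>u\<in>lines i. \<Sum>c<s. line c (card (fib i u F)))"
    "s * card F \<le> (\<Sum>c<s. card (conv c i F))"
proof -
  show 1: "s * card F = (\<Sum>u\<in>lines i. s * card (fib i u F))"
    unfolding card_fibres[OF F i] fib_def by (simp add: sum_distrib_left)
  have "(\<Sum>c<s. card (conv c i F)) = (\<Sum>c<s. \<Sum>u\<in>lines i. line c (card (fib i u F)))"
    by (rule sum.cong) (use card_conv[OF i] in auto)
  also have "\<dots> = (\<Sum>u\<in>lines i. \<Sum>c<s. line c (card (fib i u F)))" by (rule sum.swap)
  finally show 2: "(\<Sum>c<s. card (conv c i F)) = (\<Sum>u\<in>lines i. \<Sum>c<s. line c (card (fib i u F)))" .
  show "s * card F \<le> (\<Sum>c<s. card (conv c i F))" unfolding 1 2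
    by (intro sum_mono sum_line_ge(1) fib_Z)
qed

lemma hyb_bound:
  assumes "C \<subseteq> {1..n}" shows "\<forall>F. hyb C F \<longrightarrow> real (card F) \<le> M"
proof (rule compl_induct[OF finite_atLeastAtMost assms], goal_cases)
  case 1
  show ?case
  proof (intro allI impI)
    fix F assume F: "hyb {1..n} F"
    let ?G = "sig (\<lambda>_. 0) ` F"
    note h = hyb_all[OF F]
    have "card F \<le> card (pull (\<lambda>_. 0) ?G)"
      using h(2) finite_P by (intro card_mono) (auto simp: pull_def)
    hence "real (card F) \<le> real (card (pull (\<lambda>_. 0) ?G))" by simp
    also have "\<dots> = real m ^ n * mu_p n p ?G" by (rule card_pull) (use h(1) in \<open>simp add: intersecting_def\<close>)
    also have "\<dots> \<le> M" using int_le_w[OF h(1)] by (intro mult_left_mono) auto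
    finally show "real (card F) \<le> M" .
  qed
next
  case (2 C i)
  show ?case
  proof (intro allI impI)
    fix F assume F: "hyb C F"
    have "F \<subseteq> P" using F by (simp add: hyb_def)
    hence "real (s * card F) \<le> real (\<Sum>c<s. card (conv c i F))"
      using count_conv(3)[OF _ 2(2)] by (simp only: of_nat_le_iff)
    also have "\<dots> = (\<Sum>c<s. real (card (conv c i F)))" by simp
    also have "\<dots> \<le> (\<Sum>c<s. M)"
      using hyb_conv[OF F 2(2,3)] 2(4) by (intro sum_mono) auto
    finally have "real s * real (card F) \<le> real s * M" by simp
    thus "real (card F) \<le> M" using s1 by simp
  qed
qed

text \<open>Equality in the average makes all conversions extremal and leaves lines with at most
  \<open>s\<close> or with \<open>m\<close> points. A line with more than \<open>0\<close> but fewer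
  than \<open>s\<close> points would be empty in conversion \<open>0\<close> and fill the window in
  conversion \<open>s - 1\<close>, although the two have equal size.\<close>

lemma extremal_lines:
  assumes ms: "2 * s < m \<or> s = 1" and C: "C \<subseteq> {1..n}" and i: "i \<in> {1..n}" "i \<notin> C"
    and F: "hyb C F" and e: "real (card F) = M"
  shows "real (card (conv 0 i F)) = M"
    "u \<in> lines i \<Longrightarrow> card (fib i u F) = 0 \<or> card (fib i u F) = s \<or> card (fib i u F) = m"
proof -
  let ?B = "lines i"
  have finB: "finite ?B" by (intro finite_PiE) auto
  have FP: "F \<subseteq> P" using F by (simp add: hyb_def)
  have iC: "insert i C \<subseteq> {1..n}" using C i by blast
  have le: "real (card (conv c i F)) \<le> M" if "c < s" for c
    using hyb_bound[OF iC] hyb_conv[OF F i that] by blast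
  note cc = count_conv[OF FP i(1)]
  have "real s * M \<le> real (\<Sum>c<s. card (conv c i F))" using cc(3) unfolding e[symmetric] by (simp only: of_nat_mult[symmetric] of_nat_le_iff)
  hence "(\<Sum>c<s. M) \<le> (\<Sum>c<s. real (card (conv c i F)))" by simp
  hence eM: "real (card (conv c i F)) = M" if "c < s" for c
    using sum_eq_imp_eq[of "{..<s}" "\<lambda>c. real (card (conv c i F))" "\<lambda>_. M" c] le that by auto
  show "real (card (conv 0 i F)) = M" using eM s1 by simp
  have "real (\<Sum>c<s. card (conv c i F)) = real (s * card F)" using eM e by simp
  hence "(\<Sum>c<s. card (conv c i F)) = s * card F" by (simp only: of_nat_eq_iff)
  hence le2: "(\<Sum>u\<in>?B. \<Sum>c<s. line c (card (fib i u F))) \<le> (\<Sum>u\<in>?B. s * card (fib i u F))"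
    unfolding cc(2)[symmetric] cc(1)[symmetric] by simp
  have k: "card (fib i u F) \<le> s \<or> card (fib i u F) = m" if u: "u \<in> ?B" for u
  proof (rule sum_line_ge(2)[OF fib_Z(2) ms])
    show "s * card (fib i u F) = (\<Sum>c<s. line c (card (fib i u F)))"
      by (rule sum_eq_imp_eq[OF finB _ le2 u]) (rule sum_line_ge(1)[OF fib_Z(2)])
  qed
  have mono: "line 0 (card (fib i u F)) \<le> line (s - 1) (card (fib i u F))" if u: "u \<in> ?B" for u
    using k[OF u] s1 sm by (auto simp: line_def)
  have "real (card (conv 0 i F)) = real (card (conv (s - 1) i F))" using eM s1 by simp
  hence "card (conv 0 i F) = card (conv (s - 1) i F)" by (simp only: of_nat_eq_iff)
  hence le3: "(\<Sum>u\<in>?B. line (s - 1) (card (fib i u F))) \<le> (\<Sum>u\<in>?B. line 0 (card (fib i u F)))"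
    using card_conv[OF i(1), of 0 F] card_conv[OF i(1), of "s - 1" F] s1 by simp
  assume u: "u \<in> ?B"
  have "line 0 (card (fib i u F)) = line (s - 1) (card (fib i u F))"
    by (rule sum_eq_imp_eq[OF finB mono le3 u])
  thus "card (fib i u F) = 0 \<or> card (fib i u F) = s \<or> card (fib i u F) = m"
    using k[OF u] s1 sm by (auto simp: line_def split: if_splits)
qed


text \<open>Two disagreement steps can either return a coordinate to its value or decrease it by one, so
coordinates can be changed one at a time. For \<open>m = 2\<close> the graph of each coordinate is bipartite, which
is why only one coordinate is allowed then.\<close>

lemma disagree_connected:
  fixes g :: "(nat \<Rightarrow> int) \<Rightarrow> 'b"
  assumes J: "finite J" and ms: "2 * s < m \<or> m = 2 \<and> s = 1 \<and> card J \<le> 1"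
    and g: "\<And>u v. u \<in> J \<rightarrow>\<^sub>E Z \<Longrightarrow> v \<in> J \<rightarrow>\<^sub>E Z \<Longrightarrow> (\<And>i. i \<in> J \<Longrightarrow> \<not> agr C i (u i) (v i)) \<Longrightarrow> g u = g v"
    and u: "u \<in> J \<rightarrow>\<^sub>E Z" and v: "v \<in> J \<rightarrow>\<^sub>E Z"
  shows "g u = g v"
proof (cases "2 * s < m")
  case False
  hence m2: "m = 2" "s = 1" "card J \<le> 1" using ms by auto
  show ?thesis
  proof (cases "u = v")
    case False
    then obtain j where j: "j \<in> J" "u j \<noteq> v j" using PiE_ext[OF u v] by blast
    have J1: "J = {j}" using m2(3) J j(1) by (metis card_le_Suc0_iff_eq One_nat_def singletonD singletonI subsetI subset_antisym)
    have uv: "0 \<le> u j" "u j < 2" "0 \<le> v j" "v j < 2" using u v j(1) m2 by (auto dest: PiE_mem)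
    hence "u j = 0 \<and> v j = 1 \<or> u j = 1 \<and> v j = 0" using j(2) by linarith
    hence "\<not> agr C j (u j) (v j)" unfolding agr_def far_def win_def unfolding m2 by auto
    thus ?thesis using g[OF u v] J1 by simp
  qed simp
next
  case True
  let ?dec = "\<lambda>a. (a - 1) mod int m"
  have two: "\<exists>w\<in>Z. \<not> agr C j a w \<and> \<not> agr C j w b" if "b = a \<or> b = ?dec a" for j a b
  proof (cases "j \<in> C")
    case True
    thus ?thesis using s1 m0 by (intro bexI[of _ 0]) (auto simp: agr_def win_def)
  next
    case False
    \<comment> \<open>\<open>a + s\<close> has offset \<open>s\<close> from \<open>a\<close> and
      \<open>s + 1\<close> from \<open>a - 1\<close>; the latter is far because
      \<open>2 * s < m\<close>.\<close>
    let ?w = "(a + int s) mod int m"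
    have "(?w - a) mod int m = int s mod int m" by (simp add: mod_diff_left_eq)
    also have "\<dots> = int s" using m0 by simp
    finally have 1: "far ?w a" using sm by (simp add: far_def)
    have "(?w - ?dec a) mod int m = (int s + 1) mod int m" by (simp add: mod_simps)
    also have "\<dots> = int s + 1" using \<open>2 * s < m\<close> s1 by (intro mod_pos_pos_trivial) auto
    finally have "far ?w (?dec a)" using \<open>2 * s < m\<close> by (simp add: far_def)
    thus ?thesis using 1 that far_sym[of a ?w] False by (intro bexI[of _ ?w]) (auto simp: agr_def simp del: atLeastLessThan_iff)
  qed
  have walk: "g x = g y" if x: "x \<in> J \<rightarrow>\<^sub>E Z" and y: "y \<in> J \<rightarrow>\<^sub>E Z" and d: "\<And>j. j \<in> J \<Longrightarrow> y j = x j \<or> y j = ?dec (x j)" for x y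
  proof -
    have "\<forall>j\<in>J. \<exists>w. w \<in> Z \<and> \<not> agr C j (x j) w \<and> \<not> agr C j w (y j)" using two d by blast
    then obtain w where w: "\<And>j. j \<in> J \<Longrightarrow> w j \<in> Z \<and> \<not> agr C j (x j) (w j) \<and> \<not> agr C j (w j) (y j)"
      by metis
    have "restrict w J \<in> J \<rightarrow>\<^sub>E Z" using w by (simp add: restrict_PiE_iff)
    hence "g x = g (restrict w J)" "g (restrict w J) = g y" using w by (auto intro!: g x y)
    thus ?thesis by simp
  qed
  have upd: "x(j := a) \<in> J \<rightarrow>\<^sub>E Z" if "x \<in> J \<rightarrow>\<^sub>E Z" "j \<in> J" "a \<in> Z" for x j a
    using that by (auto simp: PiE_def extensional_def)
  have dec: "g x = g (x(j := (x j - int k) mod int m))" if x: "x \<in> J \<rightarrow>\<^sub>E Z" "j \<in> J" for x j k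
  proof (induction k)
    case 0
    have "x j \<in> Z" using x by blast
    hence "x(j := (x j - int 0) mod int m) = x" by auto
    thus ?case by simp
  next
    case (Suc k)
    let ?x = "x(j := (x j - int k) mod int m)"
    have "g ?x = g (x(j := (x j - int (Suc k)) mod int m))"
    proof (rule walk[OF upd[OF x mod_Z] upd[OF x mod_Z]])
      have "?dec ((x j - int k) mod int m) = (x j - int (Suc k)) mod int m" by (simp add: mod_simps algebra_simps)
      thus "(x(j := (x j - int (Suc k)) mod int m)) l = ?x l \<or> (x(j := (x j - int (Suc k)) mod int m)) l = ?dec (?x l)" for l
        by simp
    qed
    with Suc show ?case by (rule trans)
  qed
  have any: "g x = g (x(j := a))" if x: "x \<in> J \<rightarrow>\<^sub>E Z" "j \<in> J" and a: "a \<in> Z" for x j a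
  proof -
    have "(x j - int (nat ((x j - a) mod int m))) mod int m = a"
      using a m0 by (simp add: mod_simps)
    thus ?thesis using dec[OF x, of "nat ((x j - a) mod int m)"] by simp
  qed
  show ?thesis using u
  proof (induction "card {j\<in>J. u j \<noteq> v j}" arbitrary: u rule: less_induct)
    case less
    show ?case
    proof (cases "u = v")
      case False
      then obtain j where j: "j \<in> J" "u j \<noteq> v j" using PiE_ext[OF less.prems v] by blast
      have vj: "v j \<in> Z" using v j by blast
      have "{l\<in>J. (u(j := v j)) l \<noteq> v l} \<subset> {l\<in>J. u l \<noteq> v l}" using j by auto
      hence "card {l\<in>J. (u(j := v j)) l \<noteq> v l} < card {l\<in>J. u l \<noteq> v l}" using J by (intro psubset_card_mono) auto
      hence "g (u(j := v j)) = g v" by (rule less.hyps) (rule upd[OF less.prems j(1) vj])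
      thus ?thesis using any[OF less.prems j(1) vj] by simp
    qed simp
  qed
qed

section \<open>Recovering the window of a coordinate\<close>

lemma sig_cong: "(\<And>i. i \<in> {1..n} \<Longrightarrow> y i = y' i) \<Longrightarrow> sig y x = sig y' x"
  by (auto simp: sig_def)

lemma fib_restrict:
  assumes "x \<in> P" "i \<in> {1..n}" shows "fib i (restrict x ({1..n} - {i})) F = fib i x F"
proof -
  have "(restrict x ({1..n} - {i}))(i := a) = x(i := a)" for a
    using assms by (auto simp: PiE_def extensional_def)
  thus ?thesis by (simp add: fib_def)
qed

lemma card_sig_upd:
  assumes "i \<in> {1..n}" "finite T"
  shows "card (sig y (x(i := a)) \<inter> T) =
    card (sig y x \<inter> (T - {i})) + (if i \<in> T \<and> win (y i) a then 1 else 0)"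
proof -
  have "sig y (x(i := a)) \<inter> T = (sig y x \<inter> (T - {i})) \<union> (if i \<in> T \<and> win (y i) a then {i} else {})"
    using assms by (auto simp: sig_def)
  thus ?thesis using assms by auto
qed

lemma pull_thr:
  assumes "x \<in> P" "i \<in> {1..n}" "a \<in> Z" "finite T"
  shows "x(i := a) \<in> pull y (thr n T h) \<longleftrightarrow>
    h \<le> card (sig y x \<inter> (T - {i})) + (if i \<in> T \<and> win (y i) a then 1 else 0)"
proof -
  have "sig y (x(i := a)) \<subseteq> {1..n}" by (auto simp: sig_def)
  thus ?thesis using upd_P[OF assms(1-3)] unfolding pull_def thr_def
    by (simp add: card_sig_upd[OF assms(2,4)])
qed

lemma conv_iff:
  assumes "x \<in> P" "i \<in> {1..n}" "a \<in> Z"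
  shows "x(i := a) \<in> conv c i F \<longleftrightarrow>
    (if win 0 a then s - c \<le> card (fib i x F) else s + c + 1 \<le> card (fib i x F))"
  using upd_P[OF assms] by (simp add: conv_def)

text \<open>\<open>q\<close> counts the hits on \<open>T - {i}\<close>. Where it reaches the
  threshold the line is full, and where \<open>i\<close> cannot lift it to the threshold the line is
  empty. Only lines with \<open>i \<in> T\<close> and \<open>q x + 1 = t + r\<close> carry
  information, and one window \<open>y0\<close> has to serve all of them.\<close>

lemma extend_window:
  assumes ms: "2 * s < m \<or> m = 2 \<and> s = 1" and C: "C \<subseteq> {1..n}" and i: "i \<in> {1..n}" "i \<notin> C"
    and F: "hyb C F" and e: "real (card F) = M"
    and y: "y \<in> P" "\<And>j. j \<in> insert i C \<Longrightarrow> y j = 0" and K: "conv 0 i F = pull y (thr n T (t + r))"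
    and T: "T \<subseteq> {1..n}" "card T = t + 2 * r" "2 \<le> t \<or> r = 0" and half: "m = 2 * s \<Longrightarrow> n \<le> t + 2 * r + 1"
  shows "\<exists>y'\<in>P. (\<forall>j\<in>C. y' j = 0) \<and> F = pull y' (thr n T (t + r))"
proof -
  define I where "I = {1..n} - {i}"
  define q where "q = (\<lambda>x. card (sig y x \<inter> (T - {i})))"
  have finT: "finite T" using T finite_subset by blast
  have yi: "y i = 0" using y by simp
  have FP: "F \<subseteq> P" using F by (simp add: hyb_def)
  have k: "card (fib i x F) = 0 \<or> card (fib i x F) = s \<or> card (fib i x F) = m" if x: "x \<in> P" for x
  proof -
    have "restrict x ({1..n} - {i}) \<in> lines i" using x by (auto simp: PiE_iff)
    thus ?thesis using extremal_lines(2)[OF _ C i F e] fib_restrict[OF x i(1)] ms by metis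
  qed
  have mem: "(if win 0 a then s \<le> card (fib i x F) else s + 1 \<le> card (fib i x F)) \<longleftrightarrow>
      t + r \<le> q x + (if i \<in> T \<and> win 0 a then 1 else 0)" if x: "x \<in> P" "a \<in> Z" for x a
    using conv_iff[OF x(1) i(1) x(2), of 0 F] pull_thr[OF x(1) i(1) x(2) finT, of y "t + r"] K yi by (simp add: q_def)
  obtain a1 a2 where a: "a1 \<in> Z" "win 0 a1" "a2 \<in> Z" "\<not> win 0 a2" using ex_win[of 0] by blast
  have full: "fib i x F = Z" if x: "x \<in> P" "t + r \<le> q x" for x
  proof (rule fib_full)
    show "card (fib i x F) = m" using mem[OF x(1) a(3)] k[OF x(1)] a x(2) by simp
  qed
  have low: "fib i x F = {}" if x: "x \<in> P" "q x + (if i \<in> T then 1 else 0) < t + r" for x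
  proof -
    have "\<not> s \<le> card (fib i x F)" using mem[OF x(1) a(1)] a x(2) by simp
    hence "card (fib i x F) = 0" using k[OF x(1)] m0 by auto
    thus ?thesis using finite_subset[OF fib_Z(1)] by simp
  qed
  have mid: "card (fib i x F) = s" if x: "x \<in> P" "i \<in> T" "q x + 1 = t + r" for x
    using mem[OF x(1) a(1)] mem[OF x(1) a(3)] k[OF x(1)] a x(2,3) s1 m0 by auto
  have xF: "x \<in> F \<longleftrightarrow> x i \<in> fib i x F" if "x \<in> P" for x using that i(1) by (auto simp: fib_def)
  have fin: ?thesis if y': "y' = y(i := y0)" "y0 \<in> Z"
    and bd: "\<And>x. x \<in> P \<Longrightarrow> i \<in> T \<Longrightarrow> q x + 1 = t + r \<Longrightarrow> fib i x F = {a\<in>Z. win y0 a}" for y' y0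
  proof (intro bexI conjI ballI)
    show "y' \<in> P" using upd_P[OF y(1) i(1)] y' by simp
    show "y' j = 0" if "j \<in> C" for j using that y(2)[of j] y' i by auto
    have eq: "x \<in> F \<longleftrightarrow> x \<in> pull y' (thr n T (t + r))" if x: "x \<in> P" for x
    proof -
      have xi: "x i \<in> Z" using x i(1) by blast
      have "sig y' x \<inter> (T - {i}) = sig y x \<inter> (T - {i})" by (auto simp: sig_def y')
      hence p: "x \<in> pull y' (thr n T (t + r)) \<longleftrightarrow> t + r \<le> q x + (if i \<in> T \<and> win y0 (x i) then 1 else 0)"
        using pull_thr[OF x i(1) xi finT, of y' "t + r"] y' by (simp add: q_def)
      have "t + r \<le> q x \<or> q x + (if i \<in> T then 1 else 0) < t + r \<or> i \<in> T \<and> q x + 1 = t + r" by auto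
      then consider "t + r \<le> q x" | "q x + (if i \<in> T then 1 else 0) < t + r" | "i \<in> T" "q x + 1 = t + r"
        by blast
      thus ?thesis
      proof cases
        case 1 thus ?thesis unfolding p xF[OF x] full[OF x 1] using xi by simp
      next
        case 2 thus ?thesis unfolding p xF[OF x] low[OF x 2] by (auto split: if_splits)
      next
        case 3 thus ?thesis unfolding p xF[OF x] bd[OF x 3] using xi by auto
      qed
    qed
    show "F = pull y' (thr n T (t + r))" using eq FP by (auto simp: pull_def)
  qed
  show ?thesis
  proof (cases "i \<in> T")
    case False
    show ?thesis by (rule fin[of "y(i := 0)" 0]) (use False m0 in auto)
  next
    case iT: True
    have TI: "T - {i} \<subseteq> I" using T by (auto simp: I_def)
    have cT: "card (T - {i}) + 1 = t + 2 * r" using T iT finT tpos by simp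
    have uP: "u(i := 0) \<in> P" if "u \<in> I \<rightarrow>\<^sub>E Z" for u
      using that i m0 by (auto simp: I_def PiE_def extensional_def)
    have qu: "q (u(i := b)) = q u" for u b
    proof -
      have "sig y (u(i := b)) \<inter> (T - {i}) = sig y u \<inter> (T - {i})" by (auto simp: sig_def)
      thus ?thesis by (simp add: q_def)
    qed
    have miss: "card {j\<in>T - {i}. \<not> win (y j) (u j)} = r \<longleftrightarrow> q u + 1 = t + r" for u
    proof -
      have "{j\<in>T - {i}. \<not> win (y j) (u j)} = (T - {i}) - sig y u" using T(1) by (auto simp: sig_def)
      moreover have "card (T - {i}) = card ((T - {i}) \<inter> sig y u) + card ((T - {i}) - sig y u)"
        using finT by (metis card_Int_Diff finite_Diff)
      moreover have "(T - {i}) \<inter> sig y u = sig y u \<inter> (T - {i})" by blast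
      ultimately show ?thesis using cT unfolding q_def by arith
    qed
    have cards: "card (fib i u F) = s" if "u \<in> I \<rightarrow>\<^sub>E Z" "card {j\<in>T - {i}. \<not> win (y j) (u j)} = r" for u
      using mid[OF uP[OF that(1)] iT] that(2) miss qu by simp
    have cross: "fib i v F = fib i u F" "\<exists>y0\<in>Z. fib i u F = {a\<in>Z. win y0 a}"
      if "u \<in> I \<rightarrow>\<^sub>E Z" "v \<in> I \<rightarrow>\<^sub>E Z" "card {j\<in>T - {i}. \<not> win (y j) (u j)} = r"
        "card {j\<in>T - {i}. \<not> win (y j) (v j)} = r" "card {j\<in>I. agr C j (u j) (v j)} < t" for u v
    proof -
      \<comment> \<open>With fewer than \<open>t\<close> agreements elsewhere, \<open>i\<close> has
        to be an agreement for every choice of points on the two lines.\<close>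
      have nf: "\<not> far a b" if "a \<in> fib i u F" "b \<in> fib i v F" for a b
        using hyb_fib[OF F i(1) that] \<open>card _ < t\<close> i(2) by (auto simp: I_def agr_def split: if_splits)
      have ms': "2 * s < m \<or> s = 1" using ms by auto
      show "fib i v F = fib i u F" "\<exists>y0\<in>Z. fib i u F = {a\<in>Z. win y0 a}"
        using cross_eq[OF ms' fib_Z(1) cards[OF that(1,3)] fib_Z(1) cards[OF that(2,4)] nf] by blast+
    qed
    have flip: "\<exists>w\<in>Z. \<not> agr C j b w \<and> win (y j) w = (\<not> win (y j) b)" for j b
      using far_flip[of b "y j"] y(2)[of j] by (cases "j \<in> C") (auto simp: agr_def)
    interpret kn: kneser I "T - {i}" "\<lambda>_. Z" "\<lambda>j. win (y j)" "\<lambda>j a b. \<not> agr C j a b" t r "\<lambda>u. fib i u F"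
    proof (unfold_locales, goal_cases)
      case 1 thus ?case by (simp add: I_def)
    next
      case 2 thus ?case by (rule TI)
    next
      case 3 thus ?case by (rule cT)
    next
      case 4 thus ?case by (rule T(3))
    next
      case (5 j b) thus ?case using flip by blast
    next
      case (6 u v)
      thus ?case using cross(1)[of u v] by simp
    next
      case (7 g u v)
      \<comment> \<open>There are \<open>n - t - 2 * r\<close> coordinates outside, and
        \<open>half\<close> bounds this by one.\<close>
      have "card (I - (T - {i})) \<le> 1" if "m = 2" "s = 1"
      proof -
        have "card (I - (T - {i})) = card I - card (T - {i})" using finT TI by (intro card_Diff_subset) auto
        moreover have "card I = n - 1" using i by (simp add: I_def)
        ultimately show ?thesis using half cT that by simp
      qed
      hence "2 * s < m \<or> m = 2 \<and> s = 1 \<and> card (I - (T - {i})) \<le> 1" using ms by blast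
      thus ?case
        by (rule disagree_connected[rotated, of _ C g]) (use 7 in \<open>auto simp: I_def simp del: atLeastLessThan_iff\<close>)
    qed
    have "\<exists>y0\<in>Z. \<forall>u\<in>kn.pts. fib i u F = {a\<in>Z. win y0 a}"
    proof (cases "kn.pts = {}")
      case True
      thus ?thesis using a(1) by blast
    next
      case False
      then obtain u where u: "u \<in> kn.pts" by blast
      obtain w where w: "\<And>j b. w j b \<in> Z \<and> \<not> agr C j b (w j b)" using flip by metis
      \<comment> \<open>Connectivity only shows that these lines share their fibre; an actual
        conflict with \<open>v\<close> shows that the fibre is a window.\<close>
      obtain v where v: "v \<in> kn.pts" "card {j\<in>I. \<not> \<not> agr C j (u j) (v j)} < t"
        using kn.partner[OF u, of "restrict (\<lambda>j. w j (u j)) (I - (T - {i}))"] w by (auto simp: restrict_PiE_iff)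
      obtain y0 where y0: "y0 \<in> Z" "fib i u F = {a\<in>Z. win y0 a}"
        using cross(2)[of u v] u v by (auto simp: kn.pts_def kn.miss_def simp del: atLeastLessThan_iff)
      thus ?thesis using kn.f_constant[OF u] by metis
    qed
    then obtain y0 where y0: "y0 \<in> Z" "\<And>u. u \<in> kn.pts \<Longrightarrow> fib i u F = {a\<in>Z. win y0 a}" by blast
    have "fib i x F = {a\<in>Z. win y0 a}" if x: "x \<in> P" "q x + 1 = t + r" for x
    proof -
      let ?u = "restrict x I"
      have "sig y ?u \<inter> (T - {i}) = sig y x \<inter> (T - {i})" using TI by (auto simp: sig_def)
      hence "q ?u + 1 = t + r" using x by (simp add: q_def)
      moreover have "?u \<in> I \<rightarrow>\<^sub>E Z" using x by (auto simp: PiE_iff I_def)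
      ultimately have "?u \<in> kn.pts" using miss[of ?u] by (simp add: kn.pts_def kn.miss_def)
      thus ?thesis using y0(2) fib_restrict[OF x(1) i(1)] by (metis I_def)
    qed
    thus ?thesis using fin[OF refl y0(1)] by blast
  qed
qed

text \<open>The clause \<open>y j = 0\<close> records that converted coordinates still use the
  window of the conversion. At \<open>i\<close> the pullback found for \<open>conv 0 i F\<close>
  thus has base \<open>0\<close>, which undoing the conversion replaces by the true base.\<close>

theorem hyb_unique:
  assumes ms: "2 * s < m \<or> m = 2 \<and> s = 1 \<and> 2 \<le> t" and tn: "t \<le> n" and C: "C \<subseteq> {1..n}"
  shows "\<forall>F. hyb C F \<longrightarrow> real (card F) = M \<longrightarrow>
    (\<exists>y\<in>P. (\<forall>j\<in>C. y j = 0) \<and> (\<exists>G. opt n G \<and> F = pull y G))"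
proof (rule compl_induct[OF finite_atLeastAtMost C], goal_cases)
  case 1
  show ?case
  proof (intro allI impI)
    fix F assume F: "hyb {1..n} F" "real (card F) = M"
    let ?G = "sig (\<lambda>_. 0) ` F"
    note h = hyb_all[OF F(1)]
    have cp: "real (card (pull (\<lambda>_. 0) ?G)) = real m ^ n * mu_p n p ?G"
      by (rule card_pull) (use h(1) in \<open>simp add: intersecting_def\<close>)
    have fp: "finite (pull (\<lambda>_. 0) ?G)" using finite_P by (auto simp: pull_def)
    have le: "mu_p n p ?G \<le> w_p n t p" by (rule int_le_w[OF h(1)])
    have "real (card F) \<le> real (card (pull (\<lambda>_. 0) ?G))" using card_mono[OF fp h(2)] by simp
    hence "mu_p n p ?G = w_p n t p" using le m0 unfolding F(2) cp by simp
    hence o: "opt n ?G" using h(1) opt_iff by simp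
    have "card F = card (pull (\<lambda>_. 0) ?G)" using F(2) cp \<open>mu_p n p ?G = _\<close> by (metis of_nat_eq_iff)
    hence "F = pull (\<lambda>_. 0) ?G" by (intro card_subset_eq[OF fp h(2)])
    moreover have "pull (\<lambda>_. 0) ?G = pull (\<lambda>j\<in>{1..n}. 0) ?G"
      unfolding pull_def by (subst sig_cong[of "\<lambda>_. 0" "\<lambda>j\<in>{1..n}. 0"]) auto
    ultimately have "F = pull (\<lambda>j\<in>{1..n}. 0) ?G" by simp
    moreover have "(\<lambda>j\<in>{1..n}. 0) \<in> P" using m0 by simp
    ultimately show "\<exists>y\<in>P. (\<forall>j\<in>{1..n}. y j = 0) \<and> (\<exists>G. opt n G \<and> F = pull y G)"
      using o by (metis restrict_apply')
  qed
next
  case (2 C i)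
  show ?case
  proof (intro allI impI)
    fix F assume F: "hyb C F" "real (card F) = M"
    have ms': "2 * s < m \<or> s = 1" "2 * s < m \<or> m = 2 \<and> s = 1" using ms by auto
    have "hyb (insert i C) (conv 0 i F)" using hyb_conv[OF F(1) 2(2,3)] s1 by simp
    moreover have "real (card (conv 0 i F)) = M" by (rule extremal_lines(1)[OF ms'(1) 2(1-3) F])
    ultimately obtain y G where y: "y \<in> P" "\<forall>j\<in>insert i C. y j = 0" and G: "opt n G" "conv 0 i F = pull y G"
      using 2(4) by blast
    have pt: "p < 1/2 \<or> 2 \<le> t" using ms m0 by (auto simp: divide_simps)
    obtain T r where T: "T \<subseteq> {1..n}" "card T = t + 2 * r" "2 \<le> t \<or> r = 0" "p = 1/2 \<Longrightarrow> n \<le> t + 2 * r + 1"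
      and Ge: "G = thr n T (t + r)" by (rule franklE[OF opt_is_frankl[OF pt tn G(1)]]) (rule that)
    have "m = 2 * s \<Longrightarrow> p = 1/2" using s1 by simp
    hence "\<exists>y'\<in>P. (\<forall>j\<in>C. y' j = 0) \<and> F = pull y' (thr n T (t + r))"
      by (intro extend_window[OF ms'(2) 2(1-3) F y(1) _ _ T(1-3)]) (use y(2) G Ge T(4) in auto)
    thus "\<exists>y\<in>P. (\<forall>j\<in>C. y j = 0) \<and> (\<exists>G. opt n G \<and> F = pull y G)" using G Ge by blast
  qed
qed


section \<open>Translation into the notions of the statement\<close>

lemma zmod_pow_eq: "zmod_pow m n = P" by (simp add: zmod_pow_def)

lemma sigma_eq: "sigma m n s y x = sig y x"
  unfolding sigma_def sig_def win_iff ..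

lemma agreeing_iff: "agreeing m n t s F \<longleftrightarrow> hyb {} F"
proof -
  have "(\<exists>I\<subseteq>{1..n}. card I = t \<and> (\<forall>i\<in>I. \<not> far (x i) (y i))) \<longleftrightarrow> t \<le> card {i\<in>{1..n}. \<not> far (x i) (y i)}" for x y
  proof
    assume "\<exists>I\<subseteq>{1..n}. card I = t \<and> (\<forall>i\<in>I. \<not> far (x i) (y i))"
    then obtain I where I: "I \<subseteq> {i\<in>{1..n}. \<not> far (x i) (y i)}" "card I = t" by blast
    show "t \<le> card {i\<in>{1..n}. \<not> far (x i) (y i)}" unfolding I(2)[symmetric] by (rule card_mono[OF _ I(1)]) simp
  next
    assume "t \<le> card {i\<in>{1..n}. \<not> far (x i) (y i)}"
    then obtain I where "I \<subseteq> {i\<in>{1..n}. \<not> far (x i) (y i)}" "card I = t" by (meson obtain_subset_with_card_n)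
    thus "\<exists>I\<subseteq>{1..n}. card I = t \<and> (\<forall>i\<in>I. \<not> far (x i) (y i))" by blast
  qed
  thus ?thesis unfolding agreeing_def hyb_def far_iff zmod_pow_eq agr_def by simp
qed

lemma mu_zmod_eq:
  assumes "F \<subseteq> P" shows "mu_zmod m n F = real (card F) / real m ^ n"
  unfolding mu_zmod_def zmod_pow_eq using measure_uniform_count_measure[OF finite_P assms] card_P by simp

lemma win_not_far:
  assumes "win y a" "win y b" shows "\<not> far a b"
proof -
  let ?d = "(a - y) mod int m - (b - y) mod int m"
  have "[a - b = ?d] (mod int m)" unfolding cong_def by (simp add: mod_diff_eq)
  moreover have "?d \<in> {-(int s - 1)..int s - 1}" using assms by (auto simp: win_def)
  ultimately show ?thesis unfolding far_iff[symmetric] by blast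
qed

text \<open>Offsets in a common window differ by at most \<open>s - 1\<close>, so common hits are
  agreements; this gives the lower bound for the maximum.\<close>

lemma hyb_pull:
  assumes G: "intersecting n t G" shows "hyb {} (pull y G)"
  unfolding hyb_def
proof (intro conjI ballI)
  show "pull y G \<subseteq> P" by (auto simp: pull_def)
  fix x x' assume "x \<in> pull y G" "x' \<in> pull y G"
  hence "t \<le> card (sig y x \<inter> sig y x')" using G by (simp add: intersecting_def pull_def)
  also have "\<dots> \<le> card {i\<in>{1..n}. agr {} i (x i) (x' i)}"
    by (rule card_mono) (auto simp: sig_def agr_def dest: win_not_far)
  finally show "t \<le> card {i\<in>{1..n}. agr {} i (x i) (x' i)}" .
qed

lemma mu_zmod_le: "hyb {} F \<Longrightarrow> mu_zmod m n F \<le> w_p n t p"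
  using hyb_bound[of "{}"] m0 by (simp add: mu_zmod_eq hyb_def divide_simps mult.commute)

lemma w_zmod_eq: "w_zmod m n t s = w_p n t p"
  unfolding w_zmod_def
proof (rule Max_eqI[OF w_zmod_set(1)])
  show "y \<le> w_p n t p" if "y \<in> {mu_zmod m n \<F> |\<F>. agreeing m n t s \<F>}" for y
    using that mu_zmod_le by (auto simp: agreeing_iff)
  obtain G where G: "opt n G" using opt_exists by blast
  let ?F = "pull (\<lambda>_. 0) G"
  have "G \<subseteq> Pow {1..n}" using opt_sub[OF G] by blast
  hence "real (card ?F) = M" using card_pull G opt_iff by simp
  moreover have "?F \<subseteq> P" by (auto simp: pull_def)
  ultimately have "mu_zmod m n ?F = w_p n t p" using m0 by (simp add: mu_zmod_eq)
  moreover have "agreeing m n t s ?F" unfolding agreeing_iff by (rule hyb_pull[OF opt_int[OF G]])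
  ultimately show "w_p n t p \<in> {mu_zmod m n \<F> |\<F>. agreeing m n t s \<F>}" by force
qed

lemma extremal_equivalent:
  assumes ms: "2 * s < m \<or> m = 2 \<and> s = 1 \<and> 2 \<le> t"
    and F: "agreeing m n t s F" "mu_zmod m n F = w_p n t p"
  shows "\<exists>G. intersecting n t G \<and> mu_p n p G = w_p n t p \<and> equivalent_family m n s F G"
proof -
  have h: "hyb {} F" "F \<subseteq> P" using F(1) by (auto simp: agreeing_iff hyb_def)
  have eq: "equivalent_family m n s F G" if "y \<in> P" "F = pull y G" for y G
    unfolding equivalent_family_def zmod_pow_eq using that by (auto simp: sigma_eq pull_def)
  show ?thesis
  proof (cases "t \<le> n")
    case True
    have "real (card F) = M" using F(2) m0 by (simp add: mu_zmod_eq[OF h(2)] field_simps)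
    then obtain y G where "y \<in> P" "opt n G" "F = pull y G" using hyb_unique[OF ms True, of "{}"] h(1) by blast
    thus ?thesis using eq opt_iff by blast
  next
    \<comment> \<open>For \<open>n < t\<close> only the empty family is left, and any base point
      serves.\<close>
    case False
    have "F = {}"
    proof (rule ccontr)
      assume "F \<noteq> {}"
      then obtain x where "x \<in> F" by blast
      hence "t \<le> card {i\<in>{1..n}. agr {} i (x i) (x i)}" using h(1) by (auto simp: hyb_def)
      also have "\<dots> \<le> card {1..n}" by (intro card_mono) auto
      finally show False using False by simp
    qed
    moreover have "(\<lambda>j\<in>{1..n}. 0) \<in> P" using m0 by simp
    moreover have "intersecting n t {}" by (simp add: intersecting_def)
    moreover have "mu_p n p {} = w_p n t p"
      using F(2) \<open>F = {}\<close> by (simp add: mu_zmod_eq mu_p_def)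
    moreover have "pull (\<lambda>j\<in>{1..n}. 0) {} = {}" by (simp add: pull_def)
    ultimately show ?thesis using eq by metis
  qed
qed

end

theorem theorem5p3:
  fixes n m t s :: nat
  assumes "n \<ge> 1" and "m \<ge> 1" and "t \<ge> 1" and "s \<ge> 1" and "real s \<le> real m / 2"
  shows "w_zmod m n t s = w_p n t (real s / real m) \<and>
    (real s < real m / 2 \<or> (m = 2 \<and> s = 1 \<and> t > 1) \<longrightarrow>
      (\<forall>\<F>. agreeing m n t s \<F> \<and> mu_zmod m n \<F> = w_p n t (real s / real m) \<longrightarrow>
        (\<exists>\<G>. intersecting n t \<G> \<and> mu_p n (real s / real m) \<G> = w_p n t (real s / real m) \<and>
             equivalent_family m n s \<F> \<G>)))"
proof -
  have c: "2 * s \<le> m" using assms(5) by (simp add: field_simps flip: of_nat_mult)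
  interpret hybrid m s n t using assms c by unfold_locales
  have "2 * s < m \<or> m = 2 \<and> s = 1 \<and> 2 \<le> t" if "real s < real m / 2 \<or> m = 2 \<and> s = 1 \<and> t > 1"
    using that by auto
  thus ?thesis using w_zmod_eq extremal_equivalent by blast
qed

end
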